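(* Let $\mathfrak a$ be a Lazard Lie ring. Then $\mathrm{Aut}(\mathfrak a)_i=\exp(\mathrm{Der}(\mathfrak a)_i)$ for all $i\ge1$. In particular, $\exp:\mathrm{Laz}(\mathrm{Der}(\mathfrak a)^+)\to\mathrm{Aut}(\mathfrak a)^+$ is a group isomorphism and thus $\mathrm{Aut}(\mathfrak a)^+$ is a Lazard group.
   Context: A filtered group is a group $G$ with normal subgroups $G=G_0\supseteq G_1\supseteq\cdots$, $[G_i,G_j]\subseteq G_{i+j}$; a filtered Lie ring is a Lie ring with ideals $\mathfrak g=\mathfrak g_0\supseteq\mathfrak g_1\supseteq\cdots$, $[\mathfrak g_i,\mathfrak g_j]\subseteq\mathfrak g_{i+j}$. Each is topologized by taking cosets of the filtration terms as a base. Either is Lazard if it is Hausdorff and complete, its $0$-th and $1$-st terms coincide, and for all $i\ge1$ and all $n\ge1$ whose prime divisors are $\le i$, each element of the $i$-th term has a unique $n$-th root (resp. can be uniquely divided by $n$) in the $i$-th term. For a Lazard Lie ring $\mathfrak g$, $\mathrm{Laz}(\mathfrak g)=(\mathfrak g,\mathrm{BCH})$ is the group given by the Baker–Campbell–Hausdorff series, evaluated as a limit; it is a Lazard group for the same filtration. For a filtered Lie ring $\mathfrak a$: $\mathrm{End}(\mathfrak a)$ is the ring of filtration-preserving endomorphisms of $(\mathfrak a,+)$, filtered by $\mathrm{End}(\mathfrak a)_j=\{f:f(\mathfrak a_i)\subseteq\mathfrak a_{i+j}\ \forall i\ge 0\}$; $\mathrm{Der}(\mathfrak a)$ is the Lie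 ring (commutator bracket) of derivations of $\mathfrak a$ in $\mathrm{End}(\mathfrak a)$, with $\mathrm{Der}(\mathfrak a)_i=\mathrm{Der}(\mathfrak a)\cap\mathrm{End}(\mathfrak a)_i$; $\mathrm{Aut}(\mathfrak a)$ is the group of filtered Lie ring automorphisms of $\mathfrak a$, with $\mathrm{Aut}(\mathfrak a)_i=\{f\in\mathrm{Aut}(\mathfrak a): f-\mathrm{id}\in\mathrm{End}(\mathfrak a)_i\}$. For a filtered object $X$, $X^+$ denotes $X_1$ regarded as a filtered object on its own, with $(X^+)_0=X_1$ and $(X^+)_i=X_i$ for $i\ge1$. $\exp(\delta)=\sum_{m\ge0}\frac1{m!}\delta^m$ for $\delta\in\mathrm{End}(\mathfrak a)_1$. *)

theory Defs
  imports "HOL-Analysis.Analysis" "HOL-Algebra.Bij" "HOL-Algebra.AbelCoset" "HOL-Computational_Algebra.Primes"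
begin

section \<open>Filtered groups and Lazard groups\<close>

locale filtered_group = group G for G (structure) +
  fixes F :: "nat \<Rightarrow> 'a set"
  assumes filt_zero: "F 0 = carrier G"
    and filt_decreasing: "F (Suc i) \<subseteq> F i"
    and filt_normal: "F i \<lhd> G"
    and filt_commutator:
      "\<lbrakk>x \<in> F i; y \<in> F j\<rbrakk> \<Longrightarrow> x \<otimes> y \<otimes> inv x \<otimes> inv y \<in> F (i + j)"

text \<open>
  The next notions are stated for a multiplicatively written group \<open>G\<close>; for the additive
  group of a Lie ring or of an endomorphism ring they are used with \<open>add_monoid\<close>.
  All filtration terms are normal and decreasing, so left and right cosets agree and the
  cosets are a base (not only a subbase) of the topology they generate.
\<close>

definition filt_topology :: "('a, 'm) monoid_scheme \<Rightarrow> (nat \<Rightarrow> 'a set) \<Rightarrow> 'a topology" where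
  "filt_topology G F = topology_generated_by {x <#\<^bsub>G\<^esub> F i | x i. x \<in> carrier G}"

definition filt_Cauchy :: "('a, 'm) monoid_scheme \<Rightarrow> (nat \<Rightarrow> 'a set) \<Rightarrow> (nat \<Rightarrow> 'a) \<Rightarrow> bool" where
  "filt_Cauchy G F s \<longleftrightarrow> range s \<subseteq> carrier G \<and>
     (\<forall>k. \<exists>N. \<forall>m\<ge>N. \<forall>n\<ge>N. inv\<^bsub>G\<^esub> (s m) \<otimes>\<^bsub>G\<^esub> s n \<in> F k)"

text \<open>Sequences suffice for completeness, as the filtration is countable.\<close>

definition filt_complete :: "('a, 'm) monoid_scheme \<Rightarrow> (nat \<Rightarrow> 'a set) \<Rightarrow> bool" where
  "filt_complete G F \<longleftrightarrow>
     (\<forall>s. filt_Cauchy G F s \<longrightarrow> (\<exists>l. limitin (filt_topology G F) s l sequentially))"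

definition filt_lim :: "('a, 'm) monoid_scheme \<Rightarrow> (nat \<Rightarrow> 'a set) \<Rightarrow> (nat \<Rightarrow> 'a) \<Rightarrow> 'a" where
  "filt_lim G F s = (THE l. limitin (filt_topology G F) s l sequentially)"

definition filt_root :: "('a, 'm) monoid_scheme \<Rightarrow> (nat \<Rightarrow> 'a set) \<Rightarrow> nat \<Rightarrow> nat \<Rightarrow> 'a \<Rightarrow> 'a" where
  "filt_root G F i n x = (THE y. y \<in> F i \<and> y [^]\<^bsub>G\<^esub> n = x)"

definition lazard_filtration :: "('a, 'm) monoid_scheme \<Rightarrow> (nat \<Rightarrow> 'a set) \<Rightarrow> bool" where
  "lazard_filtration G F \<longleftrightarrow>
     Hausdorff_space (filt_topology G F) \<and> filt_complete G F \<and> F 0 = F 1 \<and>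
     (\<forall>i\<ge>1. \<forall>n\<ge>(1::nat). (\<forall>p. Factorial_Ring.prime p \<and> p dvd n \<longrightarrow> p \<le> i) \<longrightarrow>
        (\<forall>x\<in>F i. \<exists>!y. y \<in> F i \<and> y [^]\<^bsub>G\<^esub> n = x))"

locale lazard_group = filtered_group +
  assumes lazard: "lazard_filtration G F"


section \<open>Filtered Lie rings and Lazard Lie rings\<close>

text \<open>
  Lie rings are encoded in the record type of rings: the field \<open>mult\<close> is the Lie bracket
  and the field \<open>one\<close> is ignored.
\<close>

locale lie_ring = abelian_group L for L (structure) +
  assumes bracket_closed: "\<lbrakk>x \<in> carrier L; y \<in> carrier L\<rbrakk> \<Longrightarrow> x \<otimes> y \<in> carrier L"
    and bracket_add_left:
      "\<lbrakk>x \<in> carrier L; y \<in> carrier L; z \<in> carrier L\<rbrakk> \<Longrightarrow> (x \<oplus> y) \<otimes> z = x \<otimes> z \<oplus> y \<otimes> z"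
    and bracket_add_right:
      "\<lbrakk>x \<in> carrier L; y \<in> carrier L; z \<in> carrier L\<rbrakk> \<Longrightarrow> x \<otimes> (y \<oplus> z) = x \<otimes> y \<oplus> x \<otimes> z"
    and bracket_self: "x \<in> carrier L \<Longrightarrow> x \<otimes> x = \<zero>"
    and jacobi:
      "\<lbrakk>x \<in> carrier L; y \<in> carrier L; z \<in> carrier L\<rbrakk> \<Longrightarrow>
         x \<otimes> (y \<otimes> z) \<oplus> y \<otimes> (z \<otimes> x) \<oplus> z \<otimes> (x \<otimes> y) = \<zero>"

locale lie_ideal = lie_ring L + additive_subgroup I L for I and L (structure) +
  assumes bracket_ideal: "\<lbrakk>x \<in> carrier L; y \<in> I\<rbrakk> \<Longrightarrow> x \<otimes> y \<in> I"

locale filtered_lie_ring = lie_ring L for L (structure) +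
  fixes F :: "nat \<Rightarrow> 'a set"
  assumes filt_zero: "F 0 = carrier L"
    and filt_decreasing: "F (Suc i) \<subseteq> F i"
    and filt_ideal: "lie_ideal (F i) L"
    and filt_bracket: "\<lbrakk>x \<in> F i; y \<in> F j\<rbrakk> \<Longrightarrow> x \<otimes> y \<in> F (i + j)"

locale lazard_lie_ring = filtered_lie_ring +
  assumes lazard: "lazard_filtration (add_monoid L) F"


section \<open>The Baker--Campbell--Hausdorff group of a Lazard Lie ring\<close>

fun nested_bracket :: "('a, 'm) ring_scheme \<Rightarrow> 'a list \<Rightarrow> 'a" where
  "nested_bracket L [] = \<zero>\<^bsub>L\<^esub>"
| "nested_bracket L [x] = x"
| "nested_bracket L (x # y # zs) = x \<otimes>\<^bsub>L\<^esub> nested_bracket L (y # zs)"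

definition bch_word :: "'a \<Rightarrow> 'a \<Rightarrow> (nat \<times> nat) list \<Rightarrow> 'a list" where
  "bch_word x y ps = concat (map (\<lambda>(r, s). replicate r x @ replicate s y) ps)"

definition bch_index :: "nat \<Rightarrow> (nat \<times> nat) list set" where
  "bch_index n = {ps. (\<forall>(r, s)\<in>set ps. r + s > 0) \<and> (\<Sum>(r, s)\<leftarrow>ps. r + s) = n}"

lemma finite_bch_index: "finite (bch_index n)"
proof (rule finite_subset)
  show "bch_index n \<subseteq> {ps. set ps \<subseteq> {..n} \<times> {..n} \<and> length ps \<le> n}"
  proof
    fix ps assume "ps \<in> bch_index n"
    then have "\<forall>(r, s)\<in>set ps. r + s > 0" "(\<Sum>(r, s)\<leftarrow>ps. r + s) = n"
      by (auto simp: bch_index_def)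
    then have "set ps \<subseteq> {..n} \<times> {..n} \<and> length ps \<le> n"
    proof (induction ps arbitrary: n)
      case (Cons p ps)
      obtain r s where p: "p = (r, s)" by (cases p)
      have "set ps \<subseteq> {..n - (r + s)} \<times> {..n - (r + s)} \<and> length ps \<le> n - (r + s)"
        using Cons.prems p by (intro Cons.IH) auto
      moreover have "r + s > 0" "r + s \<le> n"
        using Cons.prems p by auto
      ultimately show ?case using p by fastforce
    qed simp
    then show "ps \<in> {ps. set ps \<subseteq> {..n} \<times> {..n} \<and> length ps \<le> n}" by simp
  qed
  show "finite {ps. set ps \<subseteq> {..n} \<times> {..n} \<and> length ps \<le> n}"
    by (intro finite_lists_length_le) auto
qed

text \<open>
  The homogeneous component of degree \<open>n \<ge> 1\<close> of the series
  \<open>log (exp x exp y)\<close>, in Dynkin's form: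
  the sum over \<open>k \<ge> 1\<close> and pairs \<open>(r\<^sub>1, s\<^sub>1), \<dots>, (r\<^sub>k, s\<^sub>k)\<close> with \<open>r\<^sub>j + s\<^sub>j > 0\<close> and
  total sum \<open>n\<close> of
  \<open>(-1)^(k-1) / (n k r\<^sub>1! s\<^sub>1! \<dots> r\<^sub>k! s\<^sub>k!)\<close> times the right-nested bracket of
  \<open>x^r\<^sub>1 y^s\<^sub>1 \<dots> x^r\<^sub>k y^s\<^sub>k\<close>.
  The nested bracket lies in \<open>F n\<close> when \<open>x, y \<in> F 1\<close>, and the prime divisors of the denominator
  are at most \<open>n\<close>, so that the division takes place in \<open>F n\<close>.
\<close>

definition bch_term :: "('a, 'm) ring_scheme \<Rightarrow> (nat \<Rightarrow> 'a set) \<Rightarrow> nat \<Rightarrow> 'a \<Rightarrow> 'a \<Rightarrow> 'a" where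
  "bch_term L F n x y =
     (\<Oplus>\<^bsub>L\<^esub>ps\<in>bch_index n.
        let q = filt_root (add_monoid L) F n
                  (n * length ps * (\<Prod>(r, s)\<leftarrow>ps. fact r * fact s))
                  (nested_bracket L (bch_word x y ps))
        in if odd (length ps) then q else \<ominus>\<^bsub>L\<^esub> q)"

definition BCH :: "('a, 'm) ring_scheme \<Rightarrow> (nat \<Rightarrow> 'a set) \<Rightarrow> 'a \<Rightarrow> 'a \<Rightarrow> 'a" where
  "BCH L F x y =
     filt_lim (add_monoid L) F (\<lambda>N. \<Oplus>\<^bsub>L\<^esub>n\<in>{1..N}. bch_term L F n x y)"

definition Laz :: "('a, 'm) ring_scheme \<Rightarrow> (nat \<Rightarrow> 'a set) \<Rightarrow> 'a monoid" where
  "Laz L F = \<lparr>carrier = carrier L, mult = BCH L F, one = \<zero>\<^bsub>L\<^esub>\<rparr>"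


section \<open>Endomorphisms, derivations and automorphisms\<close>

text \<open>Maps on the carrier are represented by extensional functions, as in \<^const>\<open>Bij\<close>.\<close>

definition End_ring :: "('a, 'm) ring_scheme \<Rightarrow> (nat \<Rightarrow> 'a set) \<Rightarrow> ('a \<Rightarrow> 'a) ring" where
  "End_ring L F =
     \<lparr>carrier = {f \<in> hom (add_monoid L) (add_monoid L) \<inter> extensional (carrier L).
                   \<forall>i. f ` F i \<subseteq> F i},
      mult = compose (carrier L),
      one = (\<lambda>x\<in>carrier L. x),
      zero = (\<lambda>x\<in>carrier L. \<zero>\<^bsub>L\<^esub>),
      add = (\<lambda>f g. \<lambda>x\<in>carrier L. f x \<oplus>\<^bsub>L\<^esub> g x)\<rparr>"

definition End_filt :: "('a, 'm) ring_scheme \<Rightarrow> (nat \<Rightarrow> 'a set) \<Rightarrow> nat \<Rightarrow> ('a \<Rightarrow> 'a) set" where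
  "End_filt L F j = {f \<in> carrier (End_ring L F). \<forall>i. f ` F i \<subseteq> F (i + j)}"

definition derivations :: "('a, 'm) ring_scheme \<Rightarrow> (nat \<Rightarrow> 'a set) \<Rightarrow> ('a \<Rightarrow> 'a) set" where
  "derivations L F =
     {d \<in> carrier (End_ring L F). \<forall>x\<in>carrier L. \<forall>y\<in>carrier L.
        d (x \<otimes>\<^bsub>L\<^esub> y) = d x \<otimes>\<^bsub>L\<^esub> y \<oplus>\<^bsub>L\<^esub> x \<otimes>\<^bsub>L\<^esub> d y}"

definition Der :: "('a, 'm) ring_scheme \<Rightarrow> (nat \<Rightarrow> 'a set) \<Rightarrow> ('a \<Rightarrow> 'a) ring" where
  "Der L F = (End_ring L F)
     \<lparr>carrier := derivations L F,
      mult := (\<lambda>f g. f \<otimes>\<^bsub>End_ring L F\<^esub> g \<ominus>\<^bsub>End_ring L F\<^esub> g \<otimes>\<^bsub>End_ring L F\<^esub> f)\<rparr>"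

definition Der_filt :: "('a, 'm) ring_scheme \<Rightarrow> (nat \<Rightarrow> 'a set) \<Rightarrow> nat \<Rightarrow> ('a \<Rightarrow> 'a) set" where
  "Der_filt L F i = carrier (Der L F) \<inter> End_filt L F i"

definition Aut :: "('a, 'm) ring_scheme \<Rightarrow> (nat \<Rightarrow> 'a set) \<Rightarrow> ('a \<Rightarrow> 'a) monoid" where
  "Aut L F = BijGroup (carrier L)
     \<lparr>carrier := {f \<in> Bij (carrier L) \<inter> hom (add_monoid L) (add_monoid L).
        (\<forall>x\<in>carrier L. \<forall>y\<in>carrier L. f (x \<otimes>\<^bsub>L\<^esub> y) = f x \<otimes>\<^bsub>L\<^esub> f y) \<and>
        (\<forall>i. f ` F i = F i)}\<rparr>"

definition Aut_filt :: "('a, 'm) ring_scheme \<Rightarrow> (nat \<Rightarrow> 'a set) \<Rightarrow> nat \<Rightarrow> ('a \<Rightarrow> 'a) set" where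
  "Aut_filt L F i =
     {f \<in> carrier (Aut L F). f \<ominus>\<^bsub>End_ring L F\<^esub> \<one>\<^bsub>End_ring L F\<^esub> \<in> End_filt L F i}"

text \<open>
  For \<open>\<delta>\<close> in the first term, \<open>\<delta>^m\<close> lies in the \<open>m\<close>-th term of the filtration of the
  endomorphism ring, and \<open>\<delta>^m / m!\<close> is the quotient in that term.
\<close>

definition exp_End :: "('a, 'm) ring_scheme \<Rightarrow> (nat \<Rightarrow> 'a set) \<Rightarrow> ('a \<Rightarrow> 'a) \<Rightarrow> 'a \<Rightarrow> 'a" where
  "exp_End L F \<delta> =
     filt_lim (add_monoid (End_ring L F)) (End_filt L F)
       (\<lambda>N. \<Oplus>\<^bsub>End_ring L F\<^esub>m\<in>{..N}.
          filt_root (add_monoid (End_ring L F)) (End_filt L F) m (fact m)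
            (\<delta> [^]\<^bsub>End_ring L F\<^esub> m))"


section \<open>The filtered object starting at the first term\<close>

definition plus_obj ::
  "('a, 'm) partial_object_scheme \<Rightarrow> (nat \<Rightarrow> 'a set) \<Rightarrow> ('a, 'm) partial_object_scheme" where
  "plus_obj X F = X\<lparr>carrier := F 1\<rparr>"

definition plus_filt :: "(nat \<Rightarrow> 'a set) \<Rightarrow> nat \<Rightarrow> 'a set" where
  "plus_filt F i = (if i = 0 then F 1 else F i)"

end

theory Submission
  imports Defs "HOL-Computational_Algebra.Formal_Power_Series"
begin

text \<open>
  For an endomorphism \<open>\<delta>\<close> of positive filtration degree the series \<open>exp \<delta>\<close> and
  \<open>log (1 + \<delta>)\<close> make sense because \<open>\<delta>\<^sup>m\<close> lies in the \<open>m\<close>-th term, where division by the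
  integers up to \<open>m\<close> is unique. The proof rests on one evaluation principle. Call a
  noncommutative power series in \<open>X, Y\<close> integral if the coefficient of each word of length \<open>n\<close> is a
  fraction whose denominator has only prime divisors \<open>\<le> n\<close>. Integral series form a ring, and
  sending \<open>X, Y\<close> to endomorphisms \<open>\<delta>, \<epsilon>\<close> of positive degree is a ring homomorphism into the
  endomorphisms that takes order to filtration degree (\<open>V_mult\<close>, \<open>V_filt\<close>) and is compatible with
  substitution into \<open>exp\<close> and \<open>log\<close> (\<open>exp_End_V\<close>, \<open>ev_compose\<close>). Identities between power series over
  the reals thereby become identities between endomorphisms, although the underlying group may
  have torsion. In particular \<open>exp\<close> and \<open>log\<close> are mutually inverse between endomorphisms of positive
  degree and their translates by \<open>1\<close>.

  The group law of the Baker--Campbell--Hausdorff series is such an identity: the series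
  \<open>log (exp X exp Y)\<close> equals Dynkin's sum of nested commutators (\<open>dynkin_formula\<close>). This is proved by
  applying the derivation \<open>D\<close> that multiplies each word by its length. Put \<open>Z = log (exp X exp Y)\<close>.
  On the one hand \<open>D (exp Z) = \<phi>(ad Z)(D Z) exp Z\<close> with \<open>\<phi>(t) = (exp t - 1) / t\<close>; on the other hand
  \<open>D (exp X exp Y) = (X + exp(ad X) Y) exp X exp Y\<close>. Since \<open>exp (ad Z) = exp (ad X) exp (ad Y)\<close>,
  inverting \<open>\<phi>\<close> gives \<open>D Z = \<Sum> (-1)\<^sup>k / (k + 1) (exp (ad X) exp (ad Y) - 1)\<^sup>k (X + exp (ad X) Y)\<close>,
  and expanding the exponentials produces Dynkin's terms one by one.

  It remains to match derivations with automorphisms. A map of the Lie ring is a derivation or a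
  bracket homomorphism according to how it acts on the bracket, regarded as an element of the group of
  filtered functions of two arguments. That group is again complete, separated and divisible in the
  same sense, so the evaluation principle holds for it. Let \<open>U\<^sub>1, U\<^sub>2, U\<^sub>3\<close> be its operators induced by
  an endomorphism \<open>u\<close> acting on the first argument, on the second argument, and on the value.
  They commute. A derivation satisfies \<open>U\<^sub>3 = U\<^sub>1 + U\<^sub>2\<close> on the bracket, whence
  \<open>exp U\<^sub>3 = exp U\<^sub>1 exp U\<^sub>2\<close> there (\<open>exp_derivation_bracket\<close>); conversely, if \<open>1 + u\<close> is an automorphism,
  then \<open>1 + U\<^sub>3 = (1 + U\<^sub>1) (1 + U\<^sub>2)\<close> on the bracket and taking logarithms shows that \<open>log (1 + u)\<close> is
  a derivation (\<open>log_derivation\<close>). Additivity of \<open>log\<close> on commuting factors is the case of the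
  Baker--Campbell--Hausdorff formula in which all brackets vanish.

  So \<open>exp\<close> maps the \<open>i\<close>-th term of the derivations bijectively onto the \<open>i\<close>-th term of the automorphisms
  and carries the Baker--Campbell--Hausdorff product to composition (\<open>BCH_exp\<close>); the group axioms for that
  product follow by transport. Limits and roots of automorphisms come from limits of endomorphisms
  and from division of derivations (\<open>AP_lazard\<close>).
\<close>

(* Filtration indices are written as 1, so 1 must not be rewritten to Suc 0. *)
declare One_nat_def [simp del]

section \<open>Power series in two noncommuting variables\<close>

text \<open>
  A series is its family of coefficients, indexed by words in the letters \<open>X\<close> (\<open>True\<close>) and
  \<open>Y\<close> (\<open>False\<close>). Real instead of rational coefficients make the type a real algebra; the
  denominators are controlled separately by \<open>integ\<close>.
\<close>

typedef ncs = "UNIV :: (bool list \<Rightarrow> real) set"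
  morphisms cf Ncs ..

setup_lifting type_definition_ncs

lemma cf_Ncs [simp]: "cf (Ncs f) = f"
  by (simp add: Ncs_inverse)

lemma ncs_eqI: "(\<And>w. cf a w = cf b w) \<Longrightarrow> a = b"
  by (metis cf_inject ext)

instantiation ncs :: real_algebra_1
begin

lift_definition zero_ncs :: ncs is "\<lambda>w. 0" .
lift_definition one_ncs :: ncs is "\<lambda>w. if w = [] then 1 else 0" .
lift_definition plus_ncs :: "ncs \<Rightarrow> ncs \<Rightarrow> ncs" is "\<lambda>f g w. f w + g w" .
lift_definition minus_ncs :: "ncs \<Rightarrow> ncs \<Rightarrow> ncs" is "\<lambda>f g w. f w - g w" .
lift_definition uminus_ncs :: "ncs \<Rightarrow> ncs" is "\<lambda>f w. - f w" .
lift_definition scaleR_ncs :: "real \<Rightarrow> ncs \<Rightarrow> ncs" is "\<lambda>r f w. r * f w" .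
lift_definition times_ncs :: "ncs \<Rightarrow> ncs \<Rightarrow> ncs" is
  "\<lambda>f g w. \<Sum>i\<le>length w. f (take i w) * g (drop i w)" .

instance
proof
  fix a b c :: ncs and r s :: real
  show "a + b + c = a + (b + c)" "a + b = b + a" "0 + a = a" "- a + a = 0" "a - b = a + - b"
    by (transfer; force)+
  show "r *\<^sub>R (a + b) = r *\<^sub>R a + r *\<^sub>R b" "(r + s) *\<^sub>R a = r *\<^sub>R a + s *\<^sub>R a"
    "r *\<^sub>R s *\<^sub>R a = (r * s) *\<^sub>R a" "1 *\<^sub>R a = a"
    by (transfer; auto simp: algebra_simps)+
  show "(a + b) * c = a * c + b * c" "a * (b + c) = a * b + a * c"
    by (transfer; auto simp: algebra_simps sum.distrib)+
  show "r *\<^sub>R a * b = r *\<^sub>R (a * b)" "a * r *\<^sub>R b = r *\<^sub>R (a * b)"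
    by (transfer; auto simp: algebra_simps sum_distrib_left)+
  show "(0::ncs) \<noteq> 1"
    by (transfer; auto simp: fun_eq_iff)
  show "1 * a = a"
  proof (transfer, rule ext)
    fix a :: "bool list \<Rightarrow> real" and w :: "bool list"
    have "(\<Sum>i\<le>length w. (if take i w = [] then 1 else 0) * a (drop i w)) =
          (\<Sum>i\<in>{0}. (if take i w = [] then 1 else 0) * a (drop i w))"
      by (intro sum.mono_neutral_right) auto
    then show "(\<Sum>i\<le>length w. (if take i w = [] then 1 else 0) * a (drop i w)) = a w"
      by simp
  qed
  show "a * 1 = a"
  proof (transfer, rule ext)
    fix a :: "bool list \<Rightarrow> real" and w :: "bool list"
    have "(\<Sum>i\<le>length w. a (take i w) * (if drop i w = [] then 1 else 0)) =
          (\<Sum>i\<in>{length w}. a (take i w) * (if drop i w = [] then 1 else 0))"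
      by (intro sum.mono_neutral_right) auto
    then show "(\<Sum>i\<le>length w. a (take i w) * (if drop i w = [] then 1 else 0)) = a w"
      by simp
  qed
  show "a * b * c = a * (b * c)"
  proof (transfer, rule ext)
    fix a b c :: "bool list \<Rightarrow> real" and w :: "bool list"
    define g where "g i j k = a (take i w) * b (take j (drop i w)) * c (drop (length w - k) w)" for i j k
    have "(\<Sum>i\<le>length w. (\<Sum>j\<le>length (take i w). a (take j (take i w)) * b (drop j (take i w))) * c (drop i w))
        = (\<Sum>i\<le>length w. \<Sum>j\<le>i. g j (i - j) (length w - i))"
      by (intro sum.cong) (auto simp: sum_distrib_right g_def drop_take min_def)
    also have "\<dots> = (\<Sum>i\<le>length w. \<Sum>j\<le>length w - i. g i j (length w - i - j))"
      using fps_mult_assoc_lemma[of g "length w" "length w"] by (simp add: atLeast0AtMost)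
    also have "\<dots> = (\<Sum>i\<le>length w. a (take i w) *
        (\<Sum>j\<le>length (drop i w). b (take j (drop i w)) * c (drop j (drop i w))))"
      by (intro sum.cong) (auto simp: sum_distrib_left g_def add.commute mult.assoc)
    finally show "(\<Sum>i\<le>length w. (\<Sum>j\<le>length (take i w). a (take j (take i w)) * b (drop j (take i w))) * c (drop i w))
      = (\<Sum>i\<le>length w. a (take i w) *
        (\<Sum>j\<le>length (drop i w). b (take j (drop i w)) * c (drop j (drop i w))))" .
  qed
qed

end

lemma cf_simps [simp]:
  "cf 0 w = 0" "cf (a + b) w = cf a w + cf b w" "cf (a - b) w = cf a w - cf b w"
  "cf (- a) w = - cf a w" "cf (r *\<^sub>R a) w = r * cf a w"
  by (transfer; simp)+

lemma cf_one: "cf 1 w = (if w = [] then 1 else 0)"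
  by transfer simp

lemma cf_mult: "cf (a * b) w = (\<Sum>i\<le>length w. cf a (take i w) * cf b (drop i w))"
  by transfer simp

lemma cf_sum [simp]: "cf (\<Sum>i\<in>A. f i) w = (\<Sum>i\<in>A. cf (f i) w)"
  by (induction A rule: infinite_finite_induct) auto

subsection \<open>The order of a series\<close>

definition ordge :: "nat \<Rightarrow> ncs \<Rightarrow> bool" where
  "ordge n f \<longleftrightarrow> (\<forall>w. length w < n \<longrightarrow> cf f w = 0)"

lemma ordge_0 [simp]: "ordge 0 f" and ordge_zero [simp]: "ordge n 0"
  by (auto simp: ordge_def)

lemma ordge_mono: "ordge m f \<Longrightarrow> n \<le> m \<Longrightarrow> ordge n f"
  by (auto simp: ordge_def)

lemma ordge_add: "ordge n f \<Longrightarrow> ordge n g \<Longrightarrow> ordge n (f + g)"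
  and ordge_diff: "ordge n f \<Longrightarrow> ordge n g \<Longrightarrow> ordge n (f - g)"
  and ordge_uminus: "ordge n f \<Longrightarrow> ordge n (- f)"
  and ordge_scale: "ordge n f \<Longrightarrow> ordge n (r *\<^sub>R f)"
  by (auto simp: ordge_def)

lemma ordge_sum: "(\<And>i. i \<in> A \<Longrightarrow> ordge n (f i)) \<Longrightarrow> ordge n (\<Sum>i\<in>A. f i)"
  by (auto simp: ordge_def)

lemma ordge_mult:
  assumes "ordge m f" "ordge n g" shows "ordge (m + n) (f * g)"
  unfolding ordge_def cf_mult
proof (intro allI impI sum.neutral ballI)
  fix w :: "bool list" and i assume "length w < m + n" "i \<in> {..length w}"
  then have "length (take i w) < m \<or> length (drop i w) < n" by auto
  then show "cf f (take i w) * cf g (drop i w) = 0"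
    using assms by (auto simp: ordge_def)
qed

lemma ordge_power: "ordge 1 f \<Longrightarrow> ordge m (f ^ m)"
proof (induction m)
  case (Suc m) then show ?case using ordge_mult[of 1 f m "f ^ m"] by (simp add: One_nat_def)
qed simp

text \<open>
  Series that agree up to every order are equal; all identities between infinite sums are
  reduced to finite sums in this way.
\<close>

lemma ordge_eqI: "(\<And>N. ordge N (a - b)) \<Longrightarrow> a = b"
proof (rule ncs_eqI)
  fix w :: "bool list" assume "\<And>N. ordge N (a - b)"
  then have "ordge (Suc (length w)) (a - b)" by blast
  then show "cf a w = cf b w" by (auto simp: ordge_def)
qed

subsection \<open>Power series in an order-raising operator\<close>

text \<open>
  These two classes of operators on series replace continuity and topological nilpotence: an
  operator that raises the order may be substituted into any power series.
\<close>

definition preserving :: "(ncs \<Rightarrow> ncs) \<Rightarrow> bool" where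
  "preserving T \<longleftrightarrow> linear T \<and> (\<forall>n v. ordge n v \<longrightarrow> ordge n (T v))"

definition raising :: "(ncs \<Rightarrow> ncs) \<Rightarrow> bool" where
  "raising T \<longleftrightarrow> linear T \<and> (\<forall>n v. ordge n v \<longrightarrow> ordge (Suc n) (T v))"

text \<open>
  The operator \<open>c(T) = \<Sum> c\<^sub>m T\<^sup>m\<close>. In degree \<open>n\<close> only the summands with \<open>m \<le> n\<close> contribute
  when \<open>T\<close> raises the order, so the truncated sum is the full one.
\<close>

definition act :: "real fps \<Rightarrow> (ncs \<Rightarrow> ncs) \<Rightarrow> ncs \<Rightarrow> ncs" where
  "act c T v = Ncs (\<lambda>w. \<Sum>m\<le>length w. fps_nth c m * cf ((T ^^ m) v) w)"

lemma raising_imp_preserving: "raising T \<Longrightarrow> preserving T"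
  unfolding raising_def preserving_def by (meson Suc_n_not_le_n nat_le_linear ordge_mono)

lemma linear_pow: "linear T \<Longrightarrow> linear (T ^^ m)" for T :: "ncs \<Rightarrow> ncs"
  by (induction m) (auto simp: linear_iff)

lemma preserving_pow: "preserving T \<Longrightarrow> preserving (T ^^ m)"
  by (induction m) (auto simp: preserving_def linear_iff)

lemma raising_pow: "raising T \<Longrightarrow> ordge n v \<Longrightarrow> ordge (n + m) ((T ^^ m) v)"
  by (induction m) (auto simp: raising_def)

lemma cf_pow_eq_0: "raising T \<Longrightarrow> length w < m \<Longrightarrow> cf ((T ^^ m) v) w = 0"
  using raising_pow[of T 0 v m] by (auto simp: ordge_def)

lemma cf_act:
  assumes "raising T" "length w \<le> N"
  shows "cf (act c T v) w = (\<Sum>m\<le>N. fps_nth c m * cf ((T ^^ m) v) w)"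
  unfolding act_def cf_Ncs using assms
  by (intro sum.mono_neutral_left) (auto simp: cf_pow_eq_0 not_le)

lemma act_approx:
  "raising T \<Longrightarrow> ordge (Suc N) (act c T v - (\<Sum>m\<le>N. fps_nth c m *\<^sub>R (T ^^ m) v))"
  by (auto simp: ordge_def cf_act[of T _ N])

lemma linear_act: "raising T \<Longrightarrow> linear (act c T)"
proof (rule linearI)
  fix r and a b assume T: "raising T"
  then have l: "linear (T ^^ m)" for m by (auto simp: raising_def linear_pow)
  show "act c T (a + b) = act c T a + act c T b" "act c T (r *\<^sub>R b) = r *\<^sub>R act c T b"
    by (auto intro!: ncs_eqI simp: act_def linear_add[OF l] linear_scale[OF l]
        algebra_simps sum.distrib sum_distrib_left)
qed

lemma raising_act:
  assumes "raising T" "fps_nth c 0 = 0" shows "raising (act c T)"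
  unfolding raising_def
proof (intro conjI allI impI)
  show "linear (act c T)" by (simp add: assms linear_act)
  fix n v assume v: "ordge n v"
  show "ordge (Suc n) (act c T v)"
    unfolding ordge_def act_def cf_Ncs
  proof (intro allI impI sum.neutral ballI)
    fix w :: "bool list" and m assume w: "length w < Suc n"
    show "fps_nth c m * cf ((T ^^ m) v) w = 0"
    proof (cases m)
      case (Suc k)
      then show ?thesis using raising_pow[OF assms(1) v, of m] w by (auto simp: ordge_def)
    qed (use assms in auto)
  qed
qed

text \<open>
  Up to any given order \<open>c(T)\<close> is a polynomial in \<open>T\<close>, and such polynomials commute with whatever
  commutes with \<open>T\<close>.
\<close>

lemma act_commute:
  assumes T: "raising T" and S: "preserving S" and comm: "\<And>v. S (T v) = T (S v)"
  shows "S (act c T v) = act c T (S v)"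
proof (rule ordge_eqI)
  fix N
  let ?p = "\<lambda>v. \<Sum>m\<le>N. fps_nth c m *\<^sub>R (T ^^ m) v"
  have lin: "linear S" using S by (simp add: preserving_def)
  have "S ((T ^^ m) v) = (T ^^ m) (S v)" for m
    by (induction m) (auto simp: comm)
  then have "S (?p v) = ?p (S v)"
    by (simp add: linear_sum[OF lin] linear_scale[OF lin])
  then have "S (act c T v) - act c T (S v) = S (act c T v - ?p v) - (act c T (S v) - ?p (S v))"
    by (simp add: linear_diff[OF lin])
  moreover have "ordge (Suc N) (S (act c T v - ?p v))"
    using S act_approx[OF T] by (auto simp: preserving_def)
  ultimately have "ordge (Suc N) (S (act c T v) - act c T (S v))"
    using ordge_diff[OF _ act_approx[OF T]] by presburger
  then show "ordge N (S (act c T v) - act c T (S v))"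
    by (rule ordge_mono) simp
qed

lemma funpow_add': "(T ^^ i) ((T ^^ j) v) = (T ^^ (j + i)) v"
  by (simp add: funpow_add add.commute[of j])

text \<open>
  Multiplicativity and compatibility with composition let every identity of ordinary power series
  be read as an identity of operators.
\<close>

lemma act_mult:
  assumes T: "raising T"
  shows "act (c * d) T v = act c T (act d T v)"
proof (rule ncs_eqI)
  fix w :: "bool list"
  let ?n = "length w"
  have comm: "(T ^^ m) (act d T v) = act d T ((T ^^ m) v)" for m
    by (intro act_commute) (auto simp: T raising_imp_preserving preserving_pow funpow_swap1)
  define g where "g i j = fps_nth c i * fps_nth d j * cf ((T ^^ (i + j)) v) w" for i j
  have "cf (act c T (act d T v)) w = (\<Sum>i\<le>?n. \<Sum>j\<le>?n. g i j)"
    unfolding cf_act[OF T order_refl] comm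
    by (simp add: sum_distrib_left g_def mult.assoc funpow_add' add.commute)
  also have "\<dots> = (\<Sum>i\<le>?n. \<Sum>j\<le>?n - i. g i j)"
    by (intro sum.cong sum.mono_neutral_right) (auto simp: g_def cf_pow_eq_0[OF T])
  also have "\<dots> = (\<Sum>(i,j)\<in>{(i,j). i + j \<le> ?n}. g i j)"
    by (subst sum.Sigma) (auto intro!: sum.cong)
  also have "\<dots> = (\<Sum>k\<le>?n. \<Sum>i\<le>k. g i (k - i))"
    by (rule sum.triangle_reindex_eq)
  also have "\<dots> = cf (act (c * d) T v) w"
    by (simp add: act_def fps_mult_nth g_def sum_distrib_right atLeast0AtMost)
  finally show "cf (act (c * d) T v) w = cf (act c T (act d T v)) w" by simp
qed

lemma act_const: "act (fps_const r) T v = r *\<^sub>R v"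
proof (rule ncs_eqI)
  fix w
  have "cf (act (fps_const r) T v) w = (\<Sum>m\<in>{0}. fps_nth (fps_const r) m * cf ((T ^^ m) v) w)"
    unfolding act_def cf_Ncs by (intro sum.mono_neutral_right) auto
  then show "cf (act (fps_const r) T v) w = cf (r *\<^sub>R v) w" by simp
qed

lemma act_one [simp]: "act 1 T v = v"
  using act_const[of 1 T v] by simp

lemma act_X: "raising T \<Longrightarrow> act fps_X T v = T v"
proof (rule ncs_eqI)
  fix w :: "bool list" assume T: "raising T"
  have "cf (act fps_X T v) w = (\<Sum>m\<le>Suc (length w). fps_nth fps_X m * cf ((T ^^ m) v) w)"
    by (intro cf_act T) simp
  also have "\<dots> = (\<Sum>m\<in>{1}. fps_nth fps_X m * cf ((T ^^ m) v) w)"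
    by (intro sum.mono_neutral_right) auto
  finally show "cf (act fps_X T v) w = cf (T v) w" by (simp add: One_nat_def)
qed

lemma act_add: "act (c + d) T v = act c T v + act d T v"
  and act_diff: "act (c - d) T v = act c T v - act d T v"
  by (auto intro!: ncs_eqI simp: act_def algebra_simps sum.distrib sum_subtractf)

lemma act_power:
  "raising T \<Longrightarrow> act (d ^ i) T v = ((act d T) ^^ i) v"
  by (induction i) (auto simp: act_mult)

lemma act_compose:
  assumes T: "raising T" and d: "fps_nth d 0 = 0"
  shows "act (c oo d) T v = act c (act d T) v"
proof (rule ncs_eqI)
  fix w :: "bool list"
  let ?n = "length w"
  have z: "fps_nth (d ^ i) m = 0" if "m < i" for i m
    using d that by (metis startsby_zero_power_prefix)
  have "cf (act c (act d T) v) w = (\<Sum>i\<le>?n. fps_nth c i * cf (act (d ^ i) T v) w)"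
    by (simp add: act_def[of c] act_power T)
  also have "\<dots> = (\<Sum>i\<le>?n. \<Sum>m\<le>?n. fps_nth c i * fps_nth (d ^ i) m * cf ((T ^^ m) v) w)"
    by (simp add: act_def sum_distrib_left mult.assoc)
  also have "\<dots> = (\<Sum>m\<le>?n. \<Sum>i\<le>?n. fps_nth c i * fps_nth (d ^ i) m * cf ((T ^^ m) v) w)"
    by (rule sum.swap)
  also have "\<dots> = (\<Sum>m\<le>?n. \<Sum>i\<le>m. fps_nth c i * fps_nth (d ^ i) m * cf ((T ^^ m) v) w)"
    by (intro sum.cong sum.mono_neutral_right) (auto simp: z)
  also have "\<dots> = cf (act (c oo d) T v) w"
    by (simp add: act_def fps_compose_nth atLeast0AtMost sum_distrib_right)
  finally show "cf (act (c oo d) T v) w = cf (act c (act d T) v) w" by simp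
qed

subsection \<open>Substitution into a power series\<close>

text \<open>
  Substituting a series \<open>u\<close> into \<open>c\<close> is the operator \<open>c\<close> of left multiplication by \<open>u\<close>, applied to
  \<open>1\<close>; the laws of \<open>act\<close> then specialise to substitution.
\<close>

definition subst :: "real fps \<Rightarrow> ncs \<Rightarrow> ncs" where
  "subst c u = act c ((*) u) 1"

definition ad :: "ncs \<Rightarrow> ncs \<Rightarrow> ncs" where
  "ad u v = u * v - v * u"

definition nexp :: "ncs \<Rightarrow> ncs" where
  "nexp u = subst (fps_exp 1) u"

lemma raising_left_mult: "ordge 1 u \<Longrightarrow> raising ((*) u)"
  unfolding raising_def using ordge_mult[of 1 u] by (auto simp: linear_iff distrib_left Suc_eq_plus1_left)

lemma raising_right_mult: "ordge 1 u \<Longrightarrow> raising (\<lambda>v. v * u)"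
  unfolding raising_def using ordge_mult[where n = 1] by (auto simp: linear_iff distrib_right Suc_eq_plus1)

lemma raising_ad: "ordge 1 u \<Longrightarrow> raising (ad u)"
  using raising_left_mult[of u] raising_right_mult[of u]
  unfolding raising_def ad_def by (auto simp: linear_iff algebra_simps intro: ordge_diff)

lemma linear_ad: "linear (ad u)"
  by (auto simp: linear_iff ad_def algebra_simps)

lemma preserving_right_mult: "preserving (\<lambda>v. v * u)"
  unfolding preserving_def using ordge_mult[where n = 0] by (auto simp: linear_iff algebra_simps)

lemma left_mult_funpow: "(((*) u) ^^ m) v = u ^ m * v" for u v :: ncs
  by (induction m) (auto simp: mult.assoc)

lemma cf_subst: "cf (subst c u) w = (\<Sum>m\<le>length w. fps_nth c m * cf (u ^ m) w)"
  by (simp add: subst_def act_def left_mult_funpow)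

lemma subst_mult: "ordge 1 u \<Longrightarrow> subst c u * v = act c ((*) u) v"
  unfolding subst_def
  using act_commute[of "(*) u" "\<lambda>x. x * v" c 1]
  by (simp add: raising_left_mult preserving_right_mult mult.assoc)

lemma subst_times: "ordge 1 u \<Longrightarrow> subst (c * d) u = subst c u * subst d u"
  by (simp add: subst_mult) (simp add: subst_def act_mult raising_left_mult)

lemma ordge_subst: "ordge 1 u \<Longrightarrow> fps_nth c 0 = 0 \<Longrightarrow> ordge 1 (subst c u)"
  unfolding subst_def using raising_act[of "(*) u" c] raising_left_mult[of u]
  by (auto simp: raising_def One_nat_def)

lemma subst_compose:
  "ordge 1 u \<Longrightarrow> fps_nth d 0 = 0 \<Longrightarrow> subst (c oo d) u = subst c (subst d u)"
  unfolding subst_def[of c] subst_def[of "c oo d"]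
proof -
  assume u: "ordge 1 u" "fps_nth d 0 = 0"
  then have "(*) (subst d u) = act d ((*) u)" by (auto simp: subst_mult)
  then show "act (c oo d) ((*) u) 1 = act c ((*) (subst d u)) 1"
    using u by (simp add: act_compose raising_left_mult)
qed

lemma subst_X: "ordge 1 u \<Longrightarrow> subst fps_X u = u"
  by (simp add: subst_def act_X raising_left_mult)

lemma subst_add: "subst (c + d) u = subst c u + subst d u"
  and subst_diff: "subst (c - d) u = subst c u - subst d u"
  and subst_const: "subst (fps_const r) u = r *\<^sub>R 1"
  and subst_one [simp]: "subst 1 u = 1"
  by (simp_all add: subst_def act_add act_diff act_const)

text \<open>
  The function \<open>exp t exp (-t) = 1\<close> of one variable, read at \<open>u\<close>.
\<close>

lemma nexp_uminus: "ordge 1 u \<Longrightarrow> nexp u * nexp (- u) = 1"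
proof -
  assume u: "ordge 1 u"
  have "subst (fps_const (-1) * fps_X) u = - u"
    using u by (simp add: subst_times subst_X subst_const)
  then have "nexp (- u) = subst (fps_exp 1 oo (fps_const (-1) * fps_X)) u"
    using u subst_compose[of u "fps_const (-1) * fps_X" "fps_exp 1"] by (simp add: nexp_def)
  then have "nexp u * nexp (- u) = subst (fps_exp 1 * fps_exp (-1)) u"
    using u by (simp add: nexp_def subst_times)
  then show ?thesis by (simp flip: fps_exp_add_mult)
qed

lemma nexp_ln: "ordge 1 u \<Longrightarrow> nexp (subst (fps_ln 1) u) = 1 + u"
proof -
  assume u: "ordge 1 u"
  have "(fps_exp 1 - 1) oo fps_ln (1::real) = fps_X"
    using fps_inv_right[of "fps_exp (1::real) - 1"] fps_ln_fps_exp_inv[of "1::real"] by simp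
  then have "fps_exp 1 oo fps_ln (1::real) = 1 + fps_X"
    by (simp add: fps_compose_sub_distrib algebra_simps)
  then show ?thesis
    using u by (simp add: nexp_def subst_add subst_X flip: subst_compose)
qed

lemma ln_exp_fps: "fps_ln (1::real) oo (fps_exp 1 - 1) = fps_X"
  using fps_inv[of "fps_exp (1::real) - 1"] fps_ln_fps_exp_inv[of "1::real"] by simp

lemma ln_nexp: "ordge 1 u \<Longrightarrow> subst (fps_ln 1) (nexp u - 1) = u"
  using subst_compose[of u "fps_exp 1 - 1" "fps_ln 1"]
  by (simp add: nexp_def subst_diff ln_exp_fps subst_X)

subsection \<open>Convergent sums\<close>

text \<open>
  To be used only if the \<open>m\<close>-th member has order at least \<open>m\<close>: then the members left out do not
  contribute to the coefficient.
\<close>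

definition fsum :: "(nat \<Rightarrow> ncs) \<Rightarrow> ncs" where
  "fsum a = Ncs (\<lambda>w. \<Sum>m\<le>length w. cf (a m) w)"

lemma cf_fsum:
  assumes "\<And>m. ordge m (a m)" "length w \<le> N"
  shows "cf (fsum a) w = (\<Sum>m\<le>N. cf (a m) w)"
  unfolding fsum_def cf_Ncs using assms
  by (intro sum.mono_neutral_left) (auto simp: ordge_def)

lemma fsum_mult:
  assumes a: "\<And>m. ordge m (a m)" and b: "\<And>m. ordge m (b m)"
  shows "fsum a * fsum b = fsum (\<lambda>m. \<Sum>i\<le>m. a i * b (m - i))"
proof (rule ncs_eqI)
  fix w :: "bool list"
  let ?n = "length w"
  have ab: "cf (a p * b q) w = 0" if "?n < p + q" for p q
    using ordge_mult[OF a b, of p q] that by (simp add: ordge_def)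
  have "cf (fsum a * fsum b) w =
      (\<Sum>i\<le>?n. \<Sum>p\<le>?n. \<Sum>q\<le>?n. cf (a p) (take i w) * cf (b q) (drop i w))"
    by (simp add: cf_mult cf_fsum[OF a, of _ ?n] cf_fsum[OF b, of _ ?n] sum_product)
  also have "\<dots> = (\<Sum>p\<le>?n. \<Sum>i\<le>?n. \<Sum>q\<le>?n. cf (a p) (take i w) * cf (b q) (drop i w))"
    by (rule sum.swap)
  also have "\<dots> = (\<Sum>p\<le>?n. \<Sum>q\<le>?n. cf (a p * b q) w)"
    unfolding cf_mult by (intro sum.cong refl sum.swap)
  also have "\<dots> = (\<Sum>p\<le>?n. \<Sum>q\<le>?n - p. cf (a p * b q) w)"
    by (rule sum.cong[OF refl], rule sum.mono_neutral_right) (auto intro: ab)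
  also have "\<dots> = (\<Sum>(p,q)\<in>{(p,q). p + q \<le> ?n}. cf (a p * b q) w)"
    by (subst sum.Sigma) (auto intro!: sum.cong)
  also have "\<dots> = (\<Sum>k\<le>?n. \<Sum>i\<le>k. cf (a i * b (k - i)) w)"
    by (rule sum.triangle_reindex_eq)
  finally show "cf (fsum a * fsum b) w = cf (fsum (\<lambda>m. \<Sum>i\<le>m. a i * b (m - i))) w"
    by (simp add: fsum_def)
qed

lemma nexp_fsum: "nexp u = fsum (\<lambda>m. (1 / fact m) *\<^sub>R u ^ m)"
  by (auto intro!: ncs_eqI simp: nexp_def cf_subst fsum_def)

lemma act_exp_fsum: "act (fps_exp 1) T v = fsum (\<lambda>m. (1 / fact m) *\<^sub>R (T ^^ m) v)"
  by (auto intro!: ncs_eqI simp: act_def fsum_def)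

subsection \<open>Conjugation and the degree derivation\<close>

text \<open>
  The Euler derivation, which multiplies a word by its length. It recovers the homogeneous
  components of a series from a closed expression without a grading parameter.
\<close>

definition euler :: "ncs \<Rightarrow> ncs" where
  "euler f = Ncs (\<lambda>w. real (length w) * cf f w)"

lemma cf_euler [simp]: "cf (euler f) w = real (length w) * cf f w"
  by (simp add: euler_def)

lemma euler_mult: "euler (f * g) = euler f * g + f * euler g"
proof (rule ncs_eqI)
  fix w
  show "cf (euler (f * g)) w = cf (euler f * g + f * euler g) w"
    by (auto simp: cf_mult sum_distrib_left min_def algebra_simps simp flip: sum.distrib intro!: sum.cong)
qed

lemma euler_scale: "euler (r *\<^sub>R f) = r *\<^sub>R euler f"
  by (rule ncs_eqI) simp

lemma ordge_euler: "ordge n f \<Longrightarrow> ordge n (euler f)"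
  by (auto simp: ordge_def)

text \<open>
  This recursion replaces the binomial theorem for \<open>u = ad u + (right multiplication by u)\<close>.
  With divided powers the binomial coefficients disappear: in \<open>(m + 1) C (m + 1)\<close> the factor \<open>m + 1\<close>
  splits as \<open>i + (m + 1 - i)\<close>, the first part differentiates \<open>a\<close> and the second one the exponential.
  The inhomogeneity \<open>h\<close> is needed for the derivative of the exponential.
\<close>

lemma divided_power_convolution:
  fixes u :: ncs and a h :: "nat \<Rightarrow> ncs"
  defines "g \<equiv> \<lambda>m. (1 / fact m) *\<^sub>R u ^ m"
  defines "C \<equiv> \<lambda>m. \<Sum>i\<le>m. a i * g (m - i)"
  assumes rec: "\<And>i. real (Suc i) *\<^sub>R a (Suc i) = h i + ad u (a i)"
  shows "real (Suc m) *\<^sub>R C (Suc m) = u * C m + (\<Sum>i\<le>m. h i * g (m - i))"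
proof -
  have g: "real (Suc l) *\<^sub>R g (Suc l) = u * g l" for l
    by (simp add: g_def)
  have "real (Suc m) *\<^sub>R C (Suc m) =
      (\<Sum>i\<le>Suc m. real i *\<^sub>R (a i * g (Suc m - i))) +
      (\<Sum>i\<le>Suc m. real (Suc m - i) *\<^sub>R (a i * g (Suc m - i)))"
    unfolding C_def scaleR_sum_right sum.distrib[symmetric] scaleR_add_left[symmetric]
    by (intro sum.cong) (auto simp flip: of_nat_add)
  also have "(\<Sum>i\<le>Suc m. real i *\<^sub>R (a i * g (Suc m - i))) =
      (\<Sum>i\<le>m. (h i + ad u (a i)) * g (m - i))"
    by (subst sum.atMost_Suc_shift) (simp flip: rec)
  also have "(\<Sum>i\<le>Suc m. real (Suc m - i) *\<^sub>R (a i * g (Suc m - i))) =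
      (\<Sum>i\<le>m. a i * (u * g (m - i)))"
    by (simp, intro sum.cong) (auto simp: Suc_diff_le g[symmetric])
  finally show ?thesis
    by (simp add: C_def sum_distrib_left ad_def algebra_simps sum.distrib sum_subtractf)
qed

text \<open>
  The convolution of the divided powers of \<open>ad u\<close> at \<open>v\<close> with those of \<open>u\<close> satisfies the recursion of
  the divided powers of \<open>u\<close> multiplied by \<open>v\<close>.
\<close>

lemma nexp_conjugate:
  assumes u: "ordge 1 u"
  shows "nexp u * v = act (fps_exp 1) (ad u) v * nexp u"
proof -
  let ?a = "\<lambda>m. (1 / fact m) *\<^sub>R (ad u ^^ m) v"
  let ?g = "\<lambda>m. (1 / fact m) *\<^sub>R u ^ m"
  have sc: "ad u (r *\<^sub>R z) = r *\<^sub>R ad u z" for r z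
    by (simp add: ad_def algebra_simps)
  have C: "(\<Sum>i\<le>m. ?a i * ?g (m - i)) = (1 / fact m) *\<^sub>R u ^ m * v" for m
  proof (induction m)
    case (Suc m)
    have "real (Suc m) *\<^sub>R (\<Sum>i\<le>Suc m. ?a i * ?g (Suc m - i)) =
        u * (\<Sum>i\<le>m. ?a i * ?g (m - i)) + (\<Sum>i\<le>m. 0 * ?g (m - i))"
      by (rule divided_power_convolution) (simp add: sc)
    also have "\<dots> = real (Suc m) *\<^sub>R ((1 / fact (Suc m)) *\<^sub>R u ^ Suc m * v)"
      unfolding Suc by (simp add: mult.assoc)
    finally show ?case by (rule real_vector.scale_left_imp_eq[rotated]) simp
  qed simp
  have o: "ordge m (?a m)" "ordge m (?g m)" for m
    using raising_pow[OF raising_ad[OF u], of 0 v m] ordge_power[OF u] by (auto intro: ordge_scale)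
  have "act (fps_exp 1) (ad u) v * nexp u = fsum (\<lambda>m. (1 / fact m) *\<^sub>R u ^ m * v)"
    unfolding act_exp_fsum nexp_fsum by (subst fsum_mult[OF o]) (simp only: C)
  also have "\<dots> = act (fps_exp 1) ((*) u) v"
    by (simp add: act_exp_fsum left_mult_funpow)
  finally show ?thesis by (simp add: nexp_def subst_mult u)
qed

text \<open>
  The power series of \<open>(exp t - 1) / t\<close>.
\<close>

definition fps_phi :: "real fps" where
  "fps_phi = Abs_fps (\<lambda>n. 1 / fact (Suc n))"

text \<open>
  The derivative of the exponential: \<open>D u\<close> does not commute with \<open>u\<close>, and collecting the powers of \<open>u\<close>
  to its right produces iterated commutators.
\<close>

lemma euler_nexp:
  assumes u: "ordge 1 u"
  shows "euler (nexp u) = act fps_phi (ad u) (euler u) * nexp u"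
proof -
  define a where "a m = (if m = 0 then 0 else (1 / fact m) *\<^sub>R (ad u ^^ (m - 1)) (euler u))" for m
  let ?g = "\<lambda>m. (1 / fact m) *\<^sub>R u ^ m"
  have sc: "ad u (r *\<^sub>R z) = r *\<^sub>R ad u z" for r z
    by (simp add: ad_def algebra_simps)
  have C: "(\<Sum>i\<le>m. a i * ?g (m - i)) = euler (?g m)" for m
  proof (induction m)
    case 0
    show ?case by (auto intro!: ncs_eqI simp: a_def cf_one)
  next
    case (Suc m)
    let ?h = "\<lambda>i::nat. if i = 0 then euler u else 0"
    have "real (Suc m) *\<^sub>R (\<Sum>i\<le>Suc m. a i * ?g (Suc m - i)) =
        u * (\<Sum>i\<le>m. a i * ?g (m - i)) + (\<Sum>i\<le>m. ?h i * ?g (m - i))"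
    proof (rule divided_power_convolution)
      show "real (Suc i) *\<^sub>R a (Suc i) = ?h i + ad u (a i)" for i
        by (cases i) (auto simp: a_def sc, auto simp: ad_def)
    qed
    also have "(\<Sum>i\<le>m. ?h i * ?g (m - i)) = (\<Sum>i\<in>{0}. ?h i * ?g (m - i))"
      by (intro sum.mono_neutral_right) auto
    also have "u * (\<Sum>i\<le>m. a i * ?g (m - i)) + (\<Sum>i\<in>{0}. ?h i * ?g (m - i)) = euler (u * ?g m)"
      unfolding Suc euler_mult by simp
    also have "u * ?g m = real (Suc m) *\<^sub>R ?g (Suc m)"
      by simp
    finally show ?case unfolding euler_scale by (rule real_vector.scale_left_imp_eq[rotated]) simp
  qed
  have o2: "ordge m (?g m)" for m
    using ordge_power[OF u] by (auto intro: ordge_scale)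
  have o1: "ordge m (a m)" for m
    using raising_pow[OF raising_ad[OF u] ordge_euler[OF u], of "m - 1"] by (auto simp: a_def intro: ordge_scale)
  have "act fps_phi (ad u) (euler u) = fsum a"
  proof (rule ncs_eqI)
    fix w :: "bool list"
    have "cf (fsum a) w = (\<Sum>m\<le>Suc (length w). cf (a m) w)"
      by (intro cf_fsum o1) simp
    also have "\<dots> = cf (act fps_phi (ad u) (euler u)) w"
      by (subst sum.atMost_Suc_shift) (simp add: a_def act_def fps_phi_def)
    finally show "cf (act fps_phi (ad u) (euler u)) w = cf (fsum a) w" by simp
  qed
  then have "act fps_phi (ad u) (euler u) * nexp u = fsum (\<lambda>m. euler (?g m))"
    unfolding nexp_fsum by (simp only: fsum_mult[OF o1 o2] C)
  also have "\<dots> = euler (nexp u)"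
    by (auto intro!: ncs_eqI simp: nexp_fsum fsum_def sum_distrib_left)
  finally show ?thesis by simp
qed

subsection \<open>The logarithm of a product of exponentials\<close>

definition bch_series :: "ncs \<Rightarrow> ncs \<Rightarrow> ncs" where
  "bch_series x y = subst (fps_ln 1) (nexp x * nexp y - 1)"

lemma cf_nexp_Nil [simp]: "cf (nexp u) [] = 1"
  by (simp add: nexp_def cf_subst cf_one)

lemma ordge_1_iff: "ordge 1 u \<longleftrightarrow> cf u [] = 0"
  by (auto simp: ordge_def)

lemma ordge_nexp_mult: "ordge 1 (nexp x * nexp y - 1)"
  by (simp add: ordge_1_iff cf_mult cf_one)

lemma ordge_bch_series: "ordge 1 (bch_series x y)"
  by (simp add: bch_series_def ordge_subst ordge_nexp_mult)

lemma nexp_bch_series: "nexp (bch_series x y) = nexp x * nexp y"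
  by (simp add: bch_series_def nexp_ln ordge_nexp_mult)

lemma nexp_right_cancel:
  "ordge 1 u \<Longrightarrow> a * nexp u = b * nexp u \<Longrightarrow> a = b"
  by (metis mult.assoc mult.right_neutral nexp_uminus)

text \<open>
  The power series of \<open>log (1 + t) / t\<close>.
\<close>

definition fps_psi :: "real fps" where
  "fps_psi = Abs_fps (\<lambda>k. (-1) ^ k / real (Suc k))"

text \<open>
  At \<open>exp t - 1\<close> the series \<open>fps_psi\<close> has the value \<open>t / (exp t - 1)\<close>.
\<close>

lemma psi_phi: "(fps_psi oo (fps_exp 1 - 1)) * fps_phi = 1"
proof -
  have phi: "fps_X * fps_phi = fps_exp 1 - 1"
    by (rule fps_ext) (auto simp: fps_phi_def fps_X_mult_nth gr0_conv_Suc)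
  have psi: "fps_X * fps_psi = fps_ln 1"
    by (rule fps_ext) (auto simp: fps_psi_def fps_ln_nth fps_X_mult_nth)
  have e0: "fps_nth (fps_exp (1::real) - 1) 0 = 0" by simp
  have "fps_X = (fps_X * fps_psi) oo (fps_exp 1 - 1)"
    by (simp add: psi ln_exp_fps)
  also have "\<dots> = (fps_X oo (fps_exp 1 - 1)) * (fps_psi oo (fps_exp 1 - 1))"
    by (rule fps_compose_mult_distrib[OF e0])
  also have "\<dots> = fps_X * ((fps_psi oo (fps_exp 1 - 1)) * fps_phi)"
    using e0 by (simp add: phi[symmetric] mult_ac)
  finally show ?thesis by simp
qed

text \<open>
  With \<open>Z = log (exp x exp y)\<close> one has \<open>B = exp (ad Z) - 1\<close>, because conjugation by
  \<open>exp x exp y\<close> is both \<open>exp (ad Z)\<close> and \<open>exp (ad x) exp (ad y)\<close>. Comparing the two expressions for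
  \<open>D (exp Z)\<close> gives \<open>\<phi>(ad Z)(D Z) = V\<close>, and \<open>\<phi>(ad Z)\<close> is inverted by \<open>\<psi>(B)\<close>.
\<close>

lemma euler_bch_series:
  assumes x: "ordge 1 x" and y: "ordge 1 y"
  defines "B \<equiv> \<lambda>v. act (fps_exp 1) (ad x) (act (fps_exp 1) (ad y) v) - v"
  defines "V \<equiv> act fps_phi (ad x) (euler x) + act (fps_exp 1) (ad x) (act fps_phi (ad y) (euler y))"
  shows "raising B" "euler (bch_series x y) = act fps_psi B V"
proof -
  let ?Z = "bch_series x y"
  have Z: "ordge 1 ?Z" by (rule ordge_bch_series)
  have "act (fps_exp 1) (ad ?Z) v * nexp ?Z =
      act (fps_exp 1) (ad x) (act (fps_exp 1) (ad y) v) * nexp ?Z" for v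
  proof -
    have "nexp x * (w * nexp y) = act (fps_exp 1) (ad x) w * (nexp x * nexp y)" for w
      by (simp add: nexp_conjugate[OF x, of w] flip: mult.assoc)
    then have "nexp x * nexp y * v = act (fps_exp 1) (ad x) (act (fps_exp 1) (ad y) v) * (nexp x * nexp y)"
      by (simp add: mult.assoc nexp_conjugate[OF y, of v])
    then show ?thesis
      unfolding nexp_conjugate[OF Z, symmetric] unfolding nexp_bch_series .
  qed
  then have B: "B = act (fps_exp 1 - 1) (ad ?Z)"
    using nexp_right_cancel[OF Z] by (auto simp: B_def act_diff)
  then show "raising B" by (simp add: raising_act raising_ad Z)
  have "nexp x * (v * nexp y) = act (fps_exp 1) (ad x) v * (nexp x * nexp y)" for v
    by (simp add: nexp_conjugate[OF x, of v] flip: mult.assoc)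
  then have "euler (nexp x * nexp y) = V * (nexp x * nexp y)"
    unfolding euler_mult euler_nexp[OF x] euler_nexp[OF y] V_def
    by (simp add: distrib_right mult.assoc)
  then have "act fps_phi (ad ?Z) (euler ?Z) * nexp ?Z = V * nexp ?Z"
    unfolding euler_nexp[OF Z, symmetric] unfolding nexp_bch_series .
  then have "act fps_phi (ad ?Z) (euler ?Z) = V"
    by (rule nexp_right_cancel[OF Z])
  then have "act fps_psi B V = act ((fps_psi oo (fps_exp 1 - 1)) * fps_phi) (ad ?Z) (euler ?Z)"
    by (simp add: B act_mult act_compose raising_ad Z)
  then show "euler ?Z = act fps_psi B V"
    by (simp add: psi_phi)
qed

subsection \<open>Dynkin's expansion\<close>

definition letter :: "bool \<Rightarrow> ncs" where
  "letter b = Ncs (\<lambda>w. if w = [b] then 1 else 0)"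

text \<open>
  The analogue, in the algebra of series, of \<open>nested_bracket\<close>.
\<close>

fun nested_comm :: "bool list \<Rightarrow> ncs" where
  "nested_comm [] = 0"
| "nested_comm [b] = letter b"
| "nested_comm (b # c # w) = ad (letter b) (nested_comm (c # w))"

text \<open>
  Taking commutators with a letter shifts the degree by exactly one, so a homogeneous component of
  an iterated commutator depends on a single component of its argument.
\<close>

definition vanishes_in_degree :: "nat \<Rightarrow> ncs \<Rightarrow> bool" where
  "vanishes_in_degree m f \<longleftrightarrow> (\<forall>w. length w = m \<longrightarrow> cf f w = 0)"

lemma ordge_letter: "ordge 1 (letter b)"
  by (auto simp: ordge_1_iff letter_def)

lemma euler_letter: "euler (letter b) = letter b"
  by (rule ncs_eqI) (auto simp: letter_def)

lemma cf_letter_mult: "cf (letter b * f) w = (case w of [] \<Rightarrow> 0 | c # v \<Rightarrow> if b = c then cf f v else 0)"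
proof (cases w)
  case Nil then show ?thesis by (simp add: cf_mult letter_def)
next
  case (Cons c v)
  have "cf (letter b * f) w = (\<Sum>i\<in>{1}. cf (letter b) (take i w) * cf f (drop i w))"
    unfolding cf_mult using Cons
    by (intro sum.mono_neutral_right) (auto simp: letter_def take_Cons split: nat.splits)
  then show ?thesis using Cons by (auto simp: letter_def One_nat_def)
qed

lemma cf_mult_letter: "cf (f * letter b) w = (if w = [] then 0 else if last w = b then cf f (butlast w) else 0)"
proof (cases w rule: rev_cases)
  case Nil then show ?thesis by (simp add: cf_mult letter_def)
next
  case (snoc v c)
  have "cf (f * letter b) w = (\<Sum>i\<in>{length v}. cf f (take i w) * cf (letter b) (drop i w))"
    unfolding cf_mult using snoc
    by (intro sum.mono_neutral_right) (auto simp: letter_def Cons_eq_append_conv append_eq_Cons_conv)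
  then show ?thesis using snoc by (auto simp: letter_def)
qed

lemma vanishes_ad: "vanishes_in_degree m f \<Longrightarrow> vanishes_in_degree (Suc m) (ad (letter b) f)"
  by (auto simp: vanishes_in_degree_def ad_def cf_letter_mult cf_mult_letter split: list.splits)

lemma vanishes_ad_pow:
  "vanishes_in_degree m f \<Longrightarrow> vanishes_in_degree (r + m) ((ad (letter b) ^^ r) f)"
  by (induction r) (auto dest: vanishes_ad)

lemma linear_ad_pow: "linear (ad u ^^ r)"
  by (rule linear_pow linear_ad)+

lemma nested_comm_Cons: "w \<noteq> [] \<Longrightarrow> nested_comm (b # w) = ad (letter b) (nested_comm w)"
  by (cases w) auto

lemma nested_comm_replicate: "w \<noteq> [] \<Longrightarrow> nested_comm (replicate r b @ w) = (ad (letter b) ^^ r) (nested_comm w)"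
  by (induction r) (auto simp: nested_comm_Cons)

lemma cf_nested_comm_eq_0: "length w \<noteq> length v \<Longrightarrow> cf (nested_comm v) w = 0"
proof (induction v arbitrary: w rule: nested_comm.induct)
  case (2 b) then show ?case by (auto simp: letter_def)
next
  case (3 b c v)
  then show ?case by (auto simp: ad_def cf_letter_mult cf_mult_letter split: list.splits)
qed simp

lemma ad_self [simp]: "ad u u = 0"
  by (simp add: ad_def)

lemma ad_zero [simp]: "ad u 0 = 0"
  by (simp add: ad_def)

lemma nested_comm_replicate_single: "nested_comm (replicate r b) = (if r = 1 then letter b else 0)"
proof (induction r)
  case (Suc r)
  show ?case
  proof (cases r)
    case (Suc k)
    then have "nested_comm (replicate (Suc r) b) = ad (letter b) (nested_comm (replicate r b))" by simp
    then show ?thesis using Suc.IH Suc by simp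
  qed (simp add: One_nat_def)
qed simp

abbreviation xy_word :: "(nat \<times> nat) list \<Rightarrow> bool list" where
  "xy_word \<equiv> bch_word True False"

definition bch_denom :: "(nat \<times> nat) list \<Rightarrow> real" where
  "bch_denom ps = (\<Prod>(r, s)\<leftarrow>ps. fact r * fact s)"

text \<open>
  A summand of Dynkin's formula without the factor \<open>(-1)\<^sup>k\<^sup>-\<^sup>1 / (n k)\<close>, which depends only on the
  degree \<open>n\<close> and the number \<open>k\<close> of pairs.
\<close>

definition dynkin_term :: "(nat \<times> nat) list \<Rightarrow> ncs" where
  "dynkin_term ps = (1 / bch_denom ps) *\<^sub>R nested_comm (xy_word ps)"

definition bch_index_of_length :: "nat \<Rightarrow> nat \<Rightarrow> (nat \<times> nat) list set" where
  "bch_index_of_length k n = {ps \<in> bch_index n. length ps = k}"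

definition dynkin_sum :: "nat \<Rightarrow> nat \<Rightarrow> ncs" where
  "dynkin_sum k n = (\<Sum>ps\<in>bch_index_of_length k n. dynkin_term ps)"

lemma length_bch_word: "length (bch_word x y ps) = (\<Sum>(r, s)\<leftarrow>ps. r + s)"
  by (induction ps) (auto simp: bch_word_def)

lemma xy_word_Cons: "xy_word ((r, s) # ps) = replicate r True @ replicate s False @ xy_word ps"
  by (simp add: bch_word_def)

lemma finite_bch_index_of_length: "finite (bch_index_of_length k n)"
  by (simp add: bch_index_of_length_def finite_bch_index)

lemma bch_index_of_length_Suc:
  "bch_index_of_length (Suc k) n = (\<lambda>(p, ps). p # ps) ` (SIGMA p:{(r, s). 0 < r + s \<and> r + s \<le> n}. bch_index_of_length k (n - (fst p + snd p)))"
proof (intro equalityI subsetI)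
  fix ps assume "ps \<in> bch_index_of_length (Suc k) n"
  then obtain r s qs where ps: "ps = (r, s) # qs" and "length qs = k"
    "r + s > 0" "\<forall>(r, s)\<in>set qs. r + s > 0" "r + s + (\<Sum>(r, s)\<leftarrow>qs. r + s) = n"
    by (cases ps) (auto simp: bch_index_of_length_def bch_index_def)
  then have "((r, s), qs) \<in> (SIGMA p:{(r, s). 0 < r + s \<and> r + s \<le> n}. bch_index_of_length k (n - (fst p + snd p)))"
    by (auto simp: bch_index_of_length_def bch_index_def)
  then show "ps \<in> (\<lambda>(p, ps). p # ps) ` (SIGMA p:{(r, s). 0 < r + s \<and> r + s \<le> n}. bch_index_of_length k (n - (fst p + snd p)))"
    unfolding ps by force
qed (auto simp: bch_index_of_length_def bch_index_def)

lemma finite_pairs: "finite {(r, s). 0 < r + s \<and> r + s \<le> (n::nat)}"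
  by (rule finite_subset[of _ "{..n} \<times> {..n}"]) auto

lemma dynkin_term_Cons:
  assumes "ps \<noteq> []" "\<forall>(r, s)\<in>set ps. r + s > 0"
  shows "dynkin_term ((r, s) # ps) = (1 / (fact r * fact s)) *\<^sub>R
     (ad (letter True) ^^ r) ((ad (letter False) ^^ s) (dynkin_term ps))"
proof -
  have "xy_word ps \<noteq> []" using assms by (cases ps) (auto simp: xy_word_Cons)
  then show ?thesis
    by (simp add: dynkin_term_def bch_denom_def xy_word_Cons nested_comm_replicate linear_scale[OF linear_ad_pow])
qed

text \<open>
  Splitting off the first pair \<open>(r, s)\<close> applies \<open>ad X\<^sup>r ad Y\<^sup>s / (r! s!)\<close> to the rest, that is, one
  summand of \<open>exp (ad X) exp (ad Y) - 1\<close>. The rest must be nonempty: the last pair is a nested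
  commutator in its own right.
\<close>

lemma dynkin_sum_Suc:
  assumes "k > 0"
  shows "dynkin_sum (Suc k) n = (\<Sum>(r, s)\<in>{(r, s). 0 < r + s \<and> r + s \<le> n}. (1 / (fact r * fact s)) *\<^sub>R
     (ad (letter True) ^^ r) ((ad (letter False) ^^ s) (dynkin_sum k (n - (r + s)))))"
proof -
  let ?S = "SIGMA p:{(r, s). 0 < r + s \<and> r + s \<le> n}. bch_index_of_length k (n - (fst p + snd p))"
  have "dynkin_sum (Suc k) n = (\<Sum>(p, ps)\<in>?S. dynkin_term (p # ps))"
    unfolding dynkin_sum_def bch_index_of_length_Suc by (subst sum.reindex) (auto simp: inj_on_def case_prod_unfold)
  also have "\<dots> = (\<Sum>p\<in>{(r, s). 0 < r + s \<and> r + s \<le> n}. \<Sum>ps\<in>bch_index_of_length k (n - (fst p + snd p)). dynkin_term (p # ps))"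
    by (rule sum.Sigma[symmetric]) (use finite_pairs[of n] in \<open>auto simp: finite_bch_index_of_length\<close>)
  also have "\<dots> = (\<Sum>(r, s)\<in>{(r, s). 0 < r + s \<and> r + s \<le> n}. (1 / (fact r * fact s)) *\<^sub>R
     (ad (letter True) ^^ r) ((ad (letter False) ^^ s) (dynkin_sum k (n - (r + s)))))"
  proof (intro sum.cong refl, clarsimp)
    fix r s
    have "(\<Sum>ps\<in>bch_index_of_length k (n - (r + s)). dynkin_term ((r, s) # ps)) =
       (\<Sum>ps\<in>bch_index_of_length k (n - (r + s)). (1 / (fact r * fact s)) *\<^sub>R
     (ad (letter True) ^^ r) ((ad (letter False) ^^ s) (dynkin_term ps)))"
      using assms by (intro sum.cong refl dynkin_term_Cons) (auto simp: bch_index_of_length_def bch_index_def)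
    then show "(\<Sum>ps\<in>bch_index_of_length k (n - (r + s)). dynkin_term ((r, s) # ps)) = (1 / (fact r * fact s)) *\<^sub>R
     (ad (letter True) ^^ r) ((ad (letter False) ^^ s) (dynkin_sum k (n - (r + s))))"
      by (simp add: dynkin_sum_def linear_sum[OF linear_ad_pow] scaleR_sum_right)
  qed
  finally show ?thesis .
qed

text \<open>
  A nested commutator ending in two equal letters vanishes. So of the words \<open>X\<^sup>r Y\<^sup>s\<close> only \<open>X\<close> and those with
  \<open>s = 1\<close> survive, and they are the components of \<open>X + exp (ad X) Y\<close>.
\<close>

lemma dynkin_sum_1:
  assumes "n > 0"
  shows "dynkin_sum 1 n = (if n = 1 then letter True else 0) +
    (1 / fact (n - 1)) *\<^sub>R (ad (letter True) ^^ (n - 1)) (letter False)"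
proof -
  have idx: "bch_index_of_length 1 n = (\<lambda>r. [(r, n - r)]) ` {..n}"
    using assms by (auto simp: bch_index_of_length_def bch_index_def length_Suc_conv One_nat_def image_iff)
  have "dynkin_sum 1 n = (\<Sum>r\<le>n. dynkin_term [(r, n - r)])"
    unfolding dynkin_sum_def idx by (subst sum.reindex) (auto simp: inj_on_def)
  also have "\<dots> = dynkin_term [(n, 0)] + dynkin_term [(n - 1, 1)]"
  proof -
    have "dynkin_term [(r, n - r)] = 0" if "r < n - 1" for r
    proof -
      have "nested_comm (replicate r True @ replicate (n - r) False) =
          (ad (letter True) ^^ r) (nested_comm (replicate (n - r) False))"
        using that by (intro nested_comm_replicate) auto
      also have "\<dots> = 0"
      proof -
        have "n - r \<noteq> 1" using that by auto
        then show ?thesis by (simp add: nested_comm_replicate_single linear_0[OF linear_ad_pow])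
      qed
      finally show ?thesis by (simp add: dynkin_term_def bch_word_def)
    qed
    moreover have "{..n} = {..<n - 1} \<union> {n - 1, n}" using assms by auto
    ultimately have "(\<Sum>r\<le>n. dynkin_term [(r, n - r)]) = (\<Sum>r\<in>{n - 1, n}. dynkin_term [(r, n - r)])"
      by (intro sum.mono_neutral_right) auto
    then show ?thesis using assms by (simp add: add.commute)
  qed
  also have "dynkin_term [(n, 0)] = (if n = 1 then letter True else 0)"
    by (simp add: dynkin_term_def bch_denom_def bch_word_def nested_comm_replicate_single)
  also have "dynkin_term [(n - 1, 1)] = (1 / fact (n - 1)) *\<^sub>R (ad (letter True) ^^ (n - 1)) (letter False)"
    using nested_comm_replicate[of "[False]" "n - 1" True] by (simp add: dynkin_term_def bch_denom_def bch_word_def One_nat_def)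
  finally show ?thesis .
qed

text \<open>
  In the formula for \<open>D Z\<close> of \<open>euler_bch_series\<close>, the vector \<open>V\<close> collects the terms with one pair, and each
  application of \<open>B\<close> prefixes one more pair; so \<open>B\<^sup>k V\<close> collects the terms with \<open>k + 1\<close> pairs.
\<close>

lemma dynkin_formula:
  assumes w: "length w = n" and n: "n > 0"
  shows "real n * cf (bch_series (letter True) (letter False)) w =
    (\<Sum>ps\<in>bch_index n. (-1) ^ (length ps - 1) / (real (length ps) * bch_denom ps) * cf (nested_comm (xy_word ps)) w)"
proof -
  let ?x = "letter True" and ?y = "letter False"
  define B where "B = (\<lambda>v. act (fps_exp 1) (ad ?x) (act (fps_exp 1) (ad ?y) v) - v)"
  define V where "V = act fps_phi (ad ?x) (euler ?x) + act (fps_exp 1) (ad ?x) (act fps_phi (ad ?y) (euler ?y))"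
  have B: "raising B" and eul: "euler (bch_series ?x ?y) = act fps_psi B V"
    using euler_bch_series[OF ordge_letter ordge_letter] by (auto simp: B_def V_def)
  have ra: "raising (ad (letter b))" for b by (simp add: ordge_letter raising_ad)
  have phi: "act fps_phi (ad (letter b)) (letter b) = letter b" for b
  proof (rule ncs_eqI)
    fix w
    have z: "(ad (letter b) ^^ m) (letter b) = (if m = 0 then letter b else 0)" for m
      by (induction m) auto
    have "cf (act fps_phi (ad (letter b)) (letter b)) w =
        (\<Sum>m\<in>{0}. fps_nth fps_phi m * cf ((ad (letter b) ^^ m) (letter b)) w)"
      unfolding act_def cf_Ncs by (intro sum.mono_neutral_right) (auto simp: z)
    then show "cf (act fps_phi (ad (letter b)) (letter b)) w = cf (letter b) w"
      by (simp add: fps_phi_def)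
  qed
  have V: "V = ?x + act (fps_exp 1) (ad ?x) ?y"
    by (simp add: V_def euler_letter phi)
  have cfB: "cf (B v) w = (\<Sum>(r, s)\<in>{(r, s). 0 < r + s \<and> r + s \<le> n}. 1 / (fact r * fact s) *
      cf ((ad ?x ^^ r) ((ad ?y ^^ s) v)) w)" if w: "length w = n" for v w n
  proof -
    let ?g = "\<lambda>r s. 1 / (fact r * fact s) * cf ((ad ?x ^^ r) ((ad ?y ^^ s) v)) w"
    have z: "cf ((ad ?x ^^ r) ((ad ?y ^^ s) v)) w = 0" if "n < r + s" for r s
    proof -
      have "ordge (r + s) ((ad ?x ^^ r) ((ad ?y ^^ s) v))"
        using raising_pow[OF ra raising_pow[OF ra, of 0 v s False], of r True] by (simp add: add.commute)
      then show ?thesis using that w by (simp add: ordge_def)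
    qed
    have inner: "cf ((ad ?x ^^ r) (act (fps_exp 1) (ad ?y) v)) w =
        (\<Sum>s\<le>n. 1 / fact s * cf ((ad ?x ^^ r) ((ad ?y ^^ s) v)) w)" for r
    proof -
      have "ordge (Suc n) ((ad ?x ^^ r) (act (fps_exp 1) (ad ?y) v - (\<Sum>s\<le>n. (1 / fact s) *\<^sub>R (ad ?y ^^ s) v)))"
        using act_approx[OF ra[of False], where N = n and c = "fps_exp 1" and v = v]
          preserving_pow[OF raising_imp_preserving[OF ra[of True]], where m = r]
        by (simp add: preserving_def)
      then show ?thesis using w
        by (simp add: linear_diff[OF linear_ad_pow] linear_sum[OF linear_ad_pow]
            linear_scale[OF linear_ad_pow] ordge_def)
    qed
    have "cf (act (fps_exp 1) (ad ?x) (act (fps_exp 1) (ad ?y) v)) w = (\<Sum>r\<le>n. \<Sum>s\<le>n. ?g r s)"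
      by (simp add: act_def[of _ "ad ?x"] w inner sum_divide_distrib mult.commute)
    also have "\<dots> = (\<Sum>r\<le>n. \<Sum>s\<le>n - r. ?g r s)"
      by (rule sum.cong[OF refl], rule sum.mono_neutral_right) (auto simp: not_le less_diff_conv2 intro!: z)
    also have "\<dots> = (\<Sum>(r, s)\<in>{(r, s). r + s \<le> n}. ?g r s)"
      by (subst sum.Sigma) (auto intro!: sum.cong)
    also have "{(r, s). r + s \<le> n} = insert (0, 0) {(r, s). 0 < r + s \<and> r + s \<le> n}"
      by auto
    also have "(\<Sum>(r, s)\<in>\<dots>. ?g r s) = cf v w + (\<Sum>(r, s)\<in>{(r, s). 0 < r + s \<and> r + s \<le> n}. ?g r s)"
      by (subst sum.insert) (use finite_pairs[of n] in auto)
    finally show ?thesis by (simp add: B_def)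
  qed
  \<comment> \<open>Iterating \<open>B\<close> builds Dynkin's sums pair by pair.\<close>
  have BV: "cf ((B ^^ k) V) w = cf (dynkin_sum (Suc k) m) w" if "length w = m" for k m w
    using that
  proof (induction k arbitrary: m w)
    case 0
    show ?case
    proof (cases "m = 0")
      case True
      then have "dynkin_sum (Suc 0) m = 0"
        by (auto simp: dynkin_sum_def bch_index_of_length_def bch_index_def length_Suc_conv intro!: sum.neutral)
      moreover have "cf V w = 0"
        using 0 True by (simp add: V act_def letter_def)
      ultimately show ?thesis by simp
    next
      case False
      have nb: "(ad ?x ^^ r) ?y = nested_comm (replicate r True @ [False])" for r
        by (simp add: nested_comm_replicate)
      have "cf (act (fps_exp 1) (ad ?x) ?y) w = (\<Sum>r\<in>{m - 1}. 1 / fact r * cf ((ad ?x ^^ r) ?y) w)"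
        unfolding act_def cf_Ncs using False 0
        by (intro sum.mono_neutral_cong_right) (auto simp: nb intro!: cf_nested_comm_eq_0)
      moreover have "cf ?x w = cf (if m = 1 then ?x else 0) w"
        using 0 by (auto simp: letter_def)
      ultimately show ?thesis
        using dynkin_sum_1[of m] False by (simp add: V One_nat_def)
    qed
  next
    case (Suc k)
    let ?u = "(B ^^ k) V"
    have "cf ((ad ?x ^^ r) ((ad ?y ^^ s) ?u)) w =
        cf ((ad ?x ^^ r) ((ad ?y ^^ s) (dynkin_sum (Suc k) (m - (r + s))))) w" if "r + s \<le> m" for r s
    proof -
      have "vanishes_in_degree (m - (r + s)) (?u - dynkin_sum (Suc k) (m - (r + s)))"
        using Suc.IH by (simp add: vanishes_in_degree_def)
      then have "vanishes_in_degree (r + (s + (m - (r + s))))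
          ((ad ?x ^^ r) ((ad ?y ^^ s) (?u - dynkin_sum (Suc k) (m - (r + s)))))"
        by (intro vanishes_ad_pow)
      moreover have "r + (s + (m - (r + s))) = m" using that by simp
      ultimately show ?thesis using Suc.prems
        by (simp add: vanishes_in_degree_def linear_diff[OF linear_ad_pow])
    qed
    then show ?case
      unfolding funpow.simps comp_def cfB[OF Suc.prems] dynkin_sum_Suc[of "Suc k", OF zero_less_Suc] cf_sum
      by (intro sum.cong refl) auto
  qed
  have len: "0 < length ps" "length ps \<le> n" if "ps \<in> bch_index n" for ps
  proof -
    have "\<forall>(r, s)\<in>set ps. r + s > 0 \<Longrightarrow> length ps \<le> (\<Sum>(r, s)\<leftarrow>ps. r + s)"
      by (induction ps) auto
    then show "length ps \<le> n" using that by (auto simp: bch_index_def)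
    show "0 < length ps" using that n by (auto simp: bch_index_def)
  qed
  let ?h = "\<lambda>ps. (-1) ^ (length ps - 1) / (real (length ps) * bch_denom ps) * cf (nested_comm (xy_word ps)) w"
  have "real n * cf (bch_series ?x ?y) w = cf (act fps_psi B V) w"
    using w by (simp flip: eul)
  also have "\<dots> = (\<Sum>k\<le>n. (-1) ^ k / real (Suc k) * cf (dynkin_sum (Suc k) n) w)"
    by (simp add: act_def fps_psi_def w BV)
  also have "\<dots> = (\<Sum>k\<le>n. \<Sum>ps\<in>bch_index_of_length (Suc k) n. ?h ps)"
    by (intro sum.cong refl) (auto simp: dynkin_sum_def dynkin_term_def bch_index_of_length_def sum_distrib_left intro!: sum.cong)
  also have "\<dots> = (\<Sum>k\<le>n. \<Sum>ps\<in>{ps\<in>bch_index n. length ps - 1 = k}. ?h ps)"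
    by (intro sum.cong refl) (auto simp: bch_index_of_length_def dest: len(1))
  also have "\<dots> = (\<Sum>ps\<in>bch_index n. ?h ps)"
    by (intro sum.group) (auto simp: finite_bch_index dest: len(2))
  finally show ?thesis .
qed

section \<open>Topologies given by filtrations\<close>

text \<open>
  The left cosets of a descending chain of subgroups form the base of a topology, because two
  cosets through a common point are nested.
\<close>

locale descending_subgroups = group G for G (structure) +
  fixes F :: "nat \<Rightarrow> 'a set"
  assumes filt_subgroup: "subgroup (F i) G"
    and filt_Suc_subset: "F (Suc i) \<subseteq> F i"
begin

lemma filt_antimono: "i \<le> j \<Longrightarrow> F j \<subseteq> F i"
  by (rule lift_Suc_antimono_le[of F, OF filt_Suc_subset])

lemma filt_in_carrier: "x \<in> F i \<Longrightarrow> x \<in> carrier G"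
  by (rule subgroup.mem_carrier[OF filt_subgroup])

lemma mem_coset_iff:
  assumes "x \<in> carrier G" "y \<in> carrier G"
  shows "y \<in> x <# F i \<longleftrightarrow> inv x \<otimes> y \<in> F i"
proof
  assume "y \<in> x <# F i"
  then obtain h where "h \<in> F i" "y = x \<otimes> h" by (auto simp: l_coset_def)
  then show "inv x \<otimes> y \<in> F i"
    using assms filt_in_carrier[of h i] by (simp add: m_assoc[symmetric])
next
  assume "inv x \<otimes> y \<in> F i"
  moreover have "y = x \<otimes> (inv x \<otimes> y)"
    using assms by (simp add: m_assoc[symmetric])
  ultimately show "y \<in> x <# F i" by (auto simp: l_coset_def)
qed

lemma coset_subset_carrier: "x \<in> carrier G \<Longrightarrow> x <# F i \<subseteq> carrier G"
  by (auto simp: l_coset_def dest: filt_in_carrier)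

lemma filt_trans:
  assumes "x \<in> carrier G" "y \<in> carrier G" "z \<in> carrier G"
    and "inv x \<otimes> y \<in> F i" "inv y \<otimes> z \<in> F i"
  shows "inv x \<otimes> z \<in> F i"
proof -
  have "y \<otimes> (inv y \<otimes> z) = z"
    using assms(2,3) by (simp add: m_assoc[symmetric])
  then have "inv x \<otimes> z = (inv x \<otimes> y) \<otimes> (inv y \<otimes> z)"
    using assms(1-3) by (simp add: m_assoc)
  then show ?thesis
    using assms subgroup.m_closed[OF filt_subgroup] by simp
qed

lemma filt_sym:
  assumes "x \<in> carrier G" "y \<in> carrier G" "inv x \<otimes> y \<in> F i"
  shows "inv y \<otimes> x \<in> F i"
  using subgroup.m_inv_closed[OF filt_subgroup assms(3)] assms by (simp add: inv_mult_group)

lemma openin_filt_topology: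
  "openin (filt_topology G F) U \<longleftrightarrow> U \<subseteq> carrier G \<and> (\<forall>x\<in>U. \<exists>i. x <# F i \<subseteq> U)"
proof
  let ?S = "{x <# F i | x i. x \<in> carrier G}"
  assume "openin (filt_topology G F) U"
  then have "generate_topology_on ?S U"
    by (simp add: filt_topology_def openin_topology_generated_by_iff)
  then show "U \<subseteq> carrier G \<and> (\<forall>x\<in>U. \<exists>i. x <# F i \<subseteq> U)"
  proof induction
    case (Int a b)
    show ?case
    proof (intro conjI ballI)
      fix x assume x: "x \<in> a \<inter> b"
      then obtain i j where "x <# F i \<subseteq> a" "x <# F j \<subseteq> b" using Int by blast
      moreover have "x <# F (max i j) \<subseteq> x <# F i" "x <# F (max i j) \<subseteq> x <# F j"
        using filt_antimono[of i "max i j"] filt_antimono[of j "max i j"] by (auto simp: l_coset_def)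
      ultimately show "\<exists>i. x <# F i \<subseteq> a \<inter> b" by blast
    qed (use Int in auto)
  next
    case (UN K)
    then show ?case by blast
  next
    case (Basis s)
    then obtain y i where s: "s = y <# F i" and y: "y \<in> carrier G" by blast
    have "x <# F i \<subseteq> s" if "x \<in> s" for x
    proof
      fix z assume z: "z \<in> x <# F i"
      have x: "x \<in> carrier G"
        using that coset_subset_carrier[OF y, of i] by (auto simp: s)
      then have z': "z \<in> carrier G"
        using z coset_subset_carrier[of x i] by auto
      then show "z \<in> s"
        using that z filt_trans[OF y x z'] unfolding s by (simp add: mem_coset_iff x y)
    qed
    then show ?case using coset_subset_carrier s y by auto
  qed simp
next
  assume U: "U \<subseteq> carrier G \<and> (\<forall>x\<in>U. \<exists>i. x <# F i \<subseteq> U)"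
  show "openin (filt_topology G F) U"
  proof (subst openin_subopen, intro ballI)
    fix x assume x: "x \<in> U"
    then obtain i where i: "x <# F i \<subseteq> U" using U by blast
    have "openin (filt_topology G F) (x <# F i)"
      unfolding filt_topology_def using x U by (intro topology_generated_by_Basis) auto
    moreover have "x \<in> x <# F i"
      using x U subgroup.one_closed[OF filt_subgroup] by (auto simp: mem_coset_iff)
    ultimately show "\<exists>T. openin (filt_topology G F) T \<and> x \<in> T \<and> T \<subseteq> U"
      using i by blast
  qed
qed

lemma coset_open: "x \<in> carrier G \<Longrightarrow> openin (filt_topology G F) (x <# F i)"
  unfolding filt_topology_def by (intro topology_generated_by_Basis) auto

lemma topspace_filt_topology: "topspace (filt_topology G F) = carrier G"
proof
  show "topspace (filt_topology G F) \<subseteq> carrier G"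
    using openin_filt_topology openin_topspace by blast
  have "openin (filt_topology G F) (carrier G)"
    unfolding openin_filt_topology using coset_subset_carrier by blast
  then show "carrier G \<subseteq> topspace (filt_topology G F)"
    by (simp add: openin_subset)
qed

lemma limitin_filt_topology:
  assumes "range s \<subseteq> carrier G"
  shows "limitin (filt_topology G F) s l sequentially \<longleftrightarrow>
    l \<in> carrier G \<and> (\<forall>k. \<exists>N. \<forall>n\<ge>N. inv l \<otimes> s n \<in> F k)"
proof
  assume lim: "limitin (filt_topology G F) s l sequentially"
  then have l: "l \<in> carrier G" by (simp add: limitin_def topspace_filt_topology)
  moreover have "\<exists>N. \<forall>n\<ge>N. inv l \<otimes> s n \<in> F k" for k
  proof -
    have "l \<in> l <# F k"
      using l subgroup.one_closed[OF filt_subgroup] by (auto simp: mem_coset_iff)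
    then have "eventually (\<lambda>n. s n \<in> l <# F k) sequentially"
      using lim l coset_open by (auto simp: limitin_def)
    moreover have "s n \<in> carrier G" for n using assms by auto
    ultimately show ?thesis
      using l by (auto simp: eventually_sequentially mem_coset_iff)
  qed
  ultimately show "l \<in> carrier G \<and> (\<forall>k. \<exists>N. \<forall>n\<ge>N. inv l \<otimes> s n \<in> F k)" by blast
next
  assume r: "l \<in> carrier G \<and> (\<forall>k. \<exists>N. \<forall>n\<ge>N. inv l \<otimes> s n \<in> F k)"
  have s: "s n \<in> carrier G" for n using assms by auto
  show "limitin (filt_topology G F) s l sequentially"
    unfolding limitin_def topspace_filt_topology
  proof (intro conjI allI impI)
    fix U assume "openin (filt_topology G F) U \<and> l \<in> U"
    then obtain k where k: "l <# F k \<subseteq> U" by (auto simp: openin_filt_topology)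
    obtain N where "\<forall>n\<ge>N. inv l \<otimes> s n \<in> F k" using r by blast
    then have "\<forall>n\<ge>N. s n \<in> U" using k r s mem_coset_iff by blast
    then show "eventually (\<lambda>n. s n \<in> U) sequentially"
      by (auto simp: eventually_sequentially)
  qed (use r in auto)
qed

lemma Hausdorff_filt_topology:
  "Hausdorff_space (filt_topology G F) \<longleftrightarrow> (\<forall>x\<in>carrier G. (\<forall>k. x \<in> F k) \<longrightarrow> x = \<one>)"
proof
  assume H: "Hausdorff_space (filt_topology G F)"
  show "\<forall>x\<in>carrier G. (\<forall>k. x \<in> F k) \<longrightarrow> x = \<one>"
  proof (intro ballI impI)
    fix x assume x: "x \<in> carrier G" "\<forall>k. x \<in> F k"
    have r: "range (\<lambda>n::nat. x) \<subseteq> carrier G" using x by auto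
    have lim: "limitin (filt_topology G F) (\<lambda>n. x) x sequentially"
      "limitin (filt_topology G F) (\<lambda>n. x) \<one> sequentially"
      using x subgroup.one_closed[OF filt_subgroup]
      by (auto simp: limitin_filt_topology[OF r] topspace_filt_topology)
    show "x = \<one>"
      by (rule limitin_Hausdorff_unique[OF lim sequentially_bot H])
  qed
next
  assume sep: "\<forall>x\<in>carrier G. (\<forall>k. x \<in> F k) \<longrightarrow> x = \<one>"
  show "Hausdorff_space (filt_topology G F)"
    unfolding Hausdorff_space_def topspace_filt_topology
  proof (intro allI impI, elim conjE)
    fix x y assume x: "x \<in> carrier G" and y: "y \<in> carrier G" and "x \<noteq> y"
    have "y = x \<otimes> (inv x \<otimes> y)" using x y by (simp add: m_assoc[symmetric])
    then have "inv x \<otimes> y \<noteq> \<one>" using x \<open>x \<noteq> y\<close> by auto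
    then obtain k where k: "inv x \<otimes> y \<notin> F k" using sep x y by blast
    have "disjnt (x <# F k) (y <# F k)"
      unfolding disjnt_iff
    proof (intro allI notI, elim conjE)
      fix z assume z: "z \<in> x <# F k" "z \<in> y <# F k"
      then have zc: "z \<in> carrier G" using coset_subset_carrier x by blast
      then show False
        using z k filt_sym[of y z k] filt_trans[of x z y k] x y by (simp add: mem_coset_iff)
    qed
    moreover have "x \<in> x <# F k" "y \<in> y <# F k"
      using x y subgroup.one_closed[OF filt_subgroup] by (auto simp: mem_coset_iff)
    ultimately show "\<exists>U V. openin (filt_topology G F) U \<and> openin (filt_topology G F) V \<and>
        x \<in> U \<and> y \<in> V \<and> disjnt U V"
      using coset_open x y by blast
  qed
qed

lemma filt_lim_eq:
  assumes "Hausdorff_space (filt_topology G F)" "range s \<subseteq> carrier G" "l \<in> carrier G"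
    and "\<And>k. \<exists>N. \<forall>n\<ge>N. inv l \<otimes> s n \<in> F k"
  shows "filt_lim G F s = l"
  unfolding filt_lim_def
proof (rule the_equality)
  show lim: "limitin (filt_topology G F) s l sequentially"
    using assms by (simp add: limitin_filt_topology)
  show "l' = l" if "limitin (filt_topology G F) s l' sequentially" for l'
    by (rule limitin_Hausdorff_unique[OF that lim sequentially_bot assms(1)])
qed

text \<open>
  Every Cauchy sequence has a subsequence whose successive quotients lie in successive terms, and it
  suffices to find a limit of that subsequence. For such sequences the limit is approached at a known
  rate.
\<close>

lemma filt_complete_iff:
  "filt_complete G F \<longleftrightarrow>
   (\<forall>s. (\<forall>n. s n \<in> carrier G) \<and> (\<forall>n. inv (s n) \<otimes> s (Suc n) \<in> F n) \<longrightarrow>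
      (\<exists>l\<in>carrier G. \<forall>n. inv l \<otimes> s n \<in> F n))"
proof (intro iffI allI impI)
  fix s assume compl: "filt_complete G F"
    and s: "(\<forall>n. s n \<in> carrier G) \<and> (\<forall>n. inv (s n) \<otimes> s (Suc n) \<in> F n)"
  have step: "inv (s n) \<otimes> s m \<in> F n" if "n \<le> m" for n m
    using that
  proof (induction m rule: dec_induct)
    case base
    then show ?case using s subgroup.one_closed[OF filt_subgroup] by simp
  next
    case (step m)
    have "inv (s m) \<otimes> s (Suc m) \<in> F n" using s filt_antimono[OF step(1)] by blast
    then show ?case using filt_trans step s by blast
  qed
  have r: "range s \<subseteq> carrier G" using s by auto
  have "filt_Cauchy G F s"
    unfolding filt_Cauchy_def
  proof (intro conjI allI r)
    fix k
    have "inv (s m) \<otimes> s n \<in> F k" if "m \<ge> k" "n \<ge> k" for m n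
      using filt_trans[OF _ _ _ filt_sym[OF _ _ step[OF that(1)]] step[OF that(2)]] s by blast
    then show "\<exists>N. \<forall>m\<ge>N. \<forall>n\<ge>N. inv (s m) \<otimes> s n \<in> F k" by blast
  qed
  then obtain l where "limitin (filt_topology G F) s l sequentially"
    using compl by (auto simp: filt_complete_def)
  then have l: "l \<in> carrier G" "\<And>k. \<exists>N. \<forall>n\<ge>N. inv l \<otimes> s n \<in> F k"
    by (auto simp: limitin_filt_topology[OF r])
  have "inv l \<otimes> s n \<in> F n" for n
  proof -
    obtain N where "\<forall>m\<ge>N. inv l \<otimes> s m \<in> F n" using l(2) by blast
    then have "inv l \<otimes> s (max n N) \<in> F n" by simp
    then show ?thesis
      using filt_trans[of l "s (max n N)" "s n" n] filt_sym[OF _ _ step[of n "max n N"]] l s by simp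
  qed
  then show "\<exists>l\<in>carrier G. \<forall>n. inv l \<otimes> s n \<in> F n" using l by blast
next
  assume R: "\<forall>s. (\<forall>n. s n \<in> carrier G) \<and> (\<forall>n. inv (s n) \<otimes> s (Suc n) \<in> F n) \<longrightarrow>
      (\<exists>l\<in>carrier G. \<forall>n. inv l \<otimes> s n \<in> F n)"
  show "filt_complete G F"
    unfolding filt_complete_def
  proof (intro allI impI)
    fix s assume C: "filt_Cauchy G F s"
    then have r: "range s \<subseteq> carrier G" by (simp add: filt_Cauchy_def)
    then have sc: "s n \<in> carrier G" for n by auto
    have "\<exists>N. \<forall>m\<ge>N. \<forall>n\<ge>N. inv (s m) \<otimes> s n \<in> F k" for k
      using C by (simp add: filt_Cauchy_def)
    then obtain N where N: "\<And>k m n. m \<ge> N k \<Longrightarrow> n \<ge> N k \<Longrightarrow> inv (s m) \<otimes> s n \<in> F k"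
      by metis
    \<comment> \<open>The partial sums turn the moduli into a monotone choice of indices.\<close>
    define M where "M k = (\<Sum>j\<le>k. N j)" for k
    have M: "N k \<le> M k" "M k \<le> M (Suc k)" for k
      by (auto simp: M_def intro: member_le_sum)
    have "inv (s (M k)) \<otimes> s (M (Suc k)) \<in> F k" for k
      using N[of k] M[of k] by simp
    then obtain l where l: "l \<in> carrier G" "\<And>n. inv l \<otimes> s (M n) \<in> F n"
      using R[rule_format, of "\<lambda>k. s (M k)"] sc by blast
    have "inv l \<otimes> s n \<in> F k" if "n \<ge> M k" for n k
      using filt_trans[OF l(1) sc sc l(2) N[of k "M k" n]] M[of k] that by simp
    then have "limitin (filt_topology G F) s l sequentially"
      using l by (auto simp: limitin_filt_topology[OF r])
    then show "\<exists>l. limitin (filt_topology G F) s l sequentially" by blast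
  qed
qed

end

section \<open>Fractions with small denominators\<close>

text \<open>
  The integers by which the \<open>i\<close>-th term of a Lazard filtration is uniquely divisible.
\<close>

definition smooth :: "nat \<Rightarrow> nat \<Rightarrow> bool" where
  "smooth i n \<longleftrightarrow> n \<ge> 1 \<and> (\<forall>p. Factorial_Ring.prime p \<and> p dvd n \<longrightarrow> p \<le> i)"

definition fractions :: "nat \<Rightarrow> real set" where
  "fractions i = {q. \<exists>a b. smooth i b \<and> q * real b = real_of_int a}"

lemma smooth_pos: "smooth i n \<Longrightarrow> n > 0"
  by (simp add: smooth_def)

lemma smooth_1 [simp]: "smooth i 1"
  by (auto simp: smooth_def)

lemma smooth_mult: "smooth i m \<Longrightarrow> smooth i n \<Longrightarrow> smooth i (m * n)"
  unfolding smooth_def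
proof (intro conjI allI impI)
  fix p assume a: "1 \<le> m \<and> (\<forall>p. Factorial_Ring.prime p \<and> p dvd m \<longrightarrow> p \<le> i)"
    "1 \<le> n \<and> (\<forall>p. Factorial_Ring.prime p \<and> p dvd n \<longrightarrow> p \<le> i)"
    "Factorial_Ring.prime p \<and> p dvd m * n"
  then show "p \<le> i" using prime_dvd_multD[of p m n] by blast
qed (simp add: Suc_le_eq One_nat_def)

lemma smooth_mono: "smooth i n \<Longrightarrow> i \<le> j \<Longrightarrow> smooth j n"
  unfolding smooth_def using order_trans by blast

lemma smooth_0: "smooth 0 n \<Longrightarrow> n = 1"
proof (rule ccontr)
  assume n: "smooth 0 n" "n \<noteq> 1"
  then obtain p where "Factorial_Ring.prime p" "p dvd n"
    using prime_factor_nat by blast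
  then have "p \<le> 0" "p > 0" using n(1) prime_gt_0_nat unfolding smooth_def by blast+
  then show False by simp
qed

lemma smooth_le: "0 < n \<Longrightarrow> n \<le> i \<Longrightarrow> smooth i n"
  unfolding smooth_def using dvd_imp_le order_trans by (metis One_nat_def Suc_leI)

lemma smooth_fact: "n \<le> i \<Longrightarrow> smooth i (fact n)"
proof (induction n)
  case (Suc n)
  then have "smooth i (Suc n * fact n)" using smooth_le[of "Suc n" i] by (intro smooth_mult) auto
  then show ?case by simp
qed simp

lemma fractionsI: "smooth i b \<Longrightarrow> q * real b = real_of_int a \<Longrightarrow> q \<in> fractions i"
  by (auto simp: fractions_def)

lemma fractions_int [simp]: "real_of_int a \<in> fractions i"
  by (rule fractionsI[of i 1]) auto

lemma fractions_0 [simp]: "0 \<in> fractions i" and fractions_1 [simp]: "1 \<in> fractions i"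
  using fractions_int[of 0 i] fractions_int[of 1 i] by simp_all

lemma fractions_mono: "q \<in> fractions i \<Longrightarrow> i \<le> j \<Longrightarrow> q \<in> fractions j"
  by (auto simp: fractions_def intro: smooth_mono)

lemma fractions_mult: "q \<in> fractions i \<Longrightarrow> r \<in> fractions i \<Longrightarrow> q * r \<in> fractions i"
proof -
  assume "q \<in> fractions i" "r \<in> fractions i"
  then obtain a b c d where *: "smooth i b" "q * real b = real_of_int a" "smooth i d" "r * real d = real_of_int c"
    by (auto simp: fractions_def)
  have "q * r * real (b * d) = (q * real b) * (r * real d)"
    by (simp only: of_nat_mult mult_ac)
  also have "\<dots> = real_of_int (a * c)" by (simp add: *)
  finally show ?thesis by (rule fractionsI[OF smooth_mult[OF *(1,3)]])
qed

lemma fractions_add: "q \<in> fractions i \<Longrightarrow> r \<in> fractions i \<Longrightarrow> q + r \<in> fractions i"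
proof -
  assume "q \<in> fractions i" "r \<in> fractions i"
  then obtain a b c d where *: "smooth i b" "q * real b = real_of_int a" "smooth i d" "r * real d = real_of_int c"
    by (auto simp: fractions_def)
  have "(q + r) * real (b * d) = (q * real b) * real d + (r * real d) * real b"
    by (simp add: algebra_simps)
  also have "\<dots> = real_of_int (a * int d + c * int b)" by (simp add: *)
  finally show ?thesis by (rule fractionsI[OF smooth_mult[OF *(1,3)]])
qed

lemma fractions_uminus: "q \<in> fractions i \<Longrightarrow> - q \<in> fractions i"
  using fractions_mult[of "-1" i q] fractions_int[of "-1" i] by simp

lemma fractions_diff: "q \<in> fractions i \<Longrightarrow> r \<in> fractions i \<Longrightarrow> q - r \<in> fractions i"
  using fractions_add[of q i "- r"] fractions_uminus[of r i] by simp

lemma fractions_sum: "(\<And>x. x \<in> A \<Longrightarrow> f x \<in> fractions i) \<Longrightarrow> (\<Sum>x\<in>A. f x) \<in> fractions i"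
  by (induction A rule: infinite_finite_induct) (auto intro: fractions_add)

lemma fractions_inverse: "smooth i b \<Longrightarrow> 1 / real b \<in> fractions i"
  by (rule fractionsI[of i b _ 1]) (auto dest: smooth_pos)

lemma fractions_sign: "(-1) ^ n \<in> fractions i"
  by (induction n) (auto intro: fractions_uminus)

text \<open>
  The ring of series that can be evaluated: a word of length \<open>n\<close> in operators of positive degree
  has values in the \<open>n\<close>-th term, where exactly these fractions act.
\<close>

definition integ :: "ncs \<Rightarrow> bool" where
  "integ f \<longleftrightarrow> (\<forall>w. cf f w \<in> fractions (length w))"

lemma integD: "integ f \<Longrightarrow> cf f w \<in> fractions (length w)"
  by (simp add: integ_def)

lemma integ_0 [simp]: "integ 0" and integ_1 [simp]: "integ 1" and integ_letter [simp]: "integ (letter b)"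
  by (auto simp: integ_def cf_one letter_def)

lemma integ_add: "integ f \<Longrightarrow> integ g \<Longrightarrow> integ (f + g)"
  and integ_diff: "integ f \<Longrightarrow> integ g \<Longrightarrow> integ (f - g)"
  and integ_uminus: "integ f \<Longrightarrow> integ (- f)"
  by (auto simp: integ_def intro: fractions_add fractions_diff fractions_uminus)

lemma integ_sum: "(\<And>x. x \<in> A \<Longrightarrow> integ (f x)) \<Longrightarrow> integ (\<Sum>x\<in>A. f x)"
  by (auto simp: integ_def intro!: fractions_sum)

lemma integ_mult: "integ f \<Longrightarrow> integ g \<Longrightarrow> integ (f * g)"
  unfolding integ_def cf_mult
proof (intro allI fractions_sum fractions_mult)
  fix w :: "bool list" and i assume "\<forall>w. cf f w \<in> fractions (length w)" "\<forall>w. cf g w \<in> fractions (length w)" "i \<in> {..length w}"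
  then show "cf f (take i w) \<in> fractions (length w)" "cf g (drop i w) \<in> fractions (length w)"
    using fractions_mono[of _ "length (take i w)" "length w"] fractions_mono[of _ "length (drop i w)" "length w"]
    by (metis length_take min.cobounded1, metis diff_le_self length_drop)
qed

lemma integ_power: "integ f \<Longrightarrow> integ (f ^ n)"
  by (induction n) (auto intro: integ_mult)

lemma integ_scale_int: "integ f \<Longrightarrow> integ (real_of_int a *\<^sub>R f)"
  by (auto simp: integ_def intro!: fractions_mult)

lemma integ_scale: "integ f \<Longrightarrow> ordge m f \<Longrightarrow> q \<in> fractions m \<Longrightarrow> integ (q *\<^sub>R f)"
  unfolding integ_def
proof
  fix w assume "\<forall>w. cf f w \<in> fractions (length w)" "ordge m f" "q \<in> fractions m"
  then show "cf (q *\<^sub>R f) w \<in> fractions (length w)"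
    by (cases "length w < m") (auto simp: ordge_def intro!: fractions_mult intro: fractions_mono)
qed

text \<open>
  The coefficient of a word of length \<open>n\<close> in \<open>c\<^sub>m f\<^sup>m\<close> vanishes unless \<open>m \<le> n\<close>, so that the
  denominators of the coefficients \<open>c\<^sub>m\<close> are harmless.
\<close>

lemma integ_subst:
  assumes "integ f" and c: "\<And>m. fps_nth c m \<in> fractions m"
  shows "integ (subst c f)"
  unfolding integ_def cf_subst
  using integD[OF integ_power[OF assms(1)]] fractions_mono[OF c] by (auto intro!: fractions_sum fractions_mult)

lemma fps_exp_fractions: "fps_nth (fps_exp 1) m \<in> fractions m"
  using fractions_inverse[OF smooth_fact[of m m]] by simp

lemma fps_ln_fractions: "fps_nth (fps_ln 1) m \<in> fractions m"
proof (cases "m = 0")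
  case False
  then have "(-1) ^ (m - 1) * (1 / real m) \<in> fractions m"
    by (intro fractions_mult fractions_sign fractions_inverse smooth_le) auto
  then show ?thesis using False by (simp add: fps_ln_nth)
qed simp

lemma integ_nexp: "integ f \<Longrightarrow> integ (nexp f)"
  unfolding nexp_def by (rule integ_subst[OF _ fps_exp_fractions])

definition monomial :: "real \<Rightarrow> bool list \<Rightarrow> ncs" where
  "monomial q w = Ncs (\<lambda>v. if v = w then q else 0)"

lemma cf_monomial: "cf (monomial q w) v = (if v = w then q else 0)"
  by (simp add: monomial_def)

lemma integ_monomial: "q \<in> fractions (length w) \<Longrightarrow> integ (monomial q w)"
  by (auto simp: integ_def cf_monomial)

lemma monomial_mult: "monomial q w * monomial r v = monomial (q * r) (w @ v)"
proof (rule ncs_eqI)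
  fix u :: "bool list"
  show "cf (monomial q w * monomial r v) u = cf (monomial (q * r) (w @ v)) u"
  proof (cases "u = w @ v")
    case True
    then have "cf (monomial q w * monomial r v) u =
        (\<Sum>i\<in>{length w}. cf (monomial q w) (take i u) * cf (monomial r v) (drop i u))"
      unfolding cf_mult
    proof (intro sum.mono_neutral_right ballI)
      fix i assume "i \<in> {..length u} - {length w}"
      then have "length (take i u) \<noteq> length w" by auto
      then have "take i u \<noteq> w" by blast
      then show "cf (monomial q w) (take i u) * cf (monomial r v) (drop i u) = 0" by (simp add: cf_monomial)
    qed (use True in auto)
    then show ?thesis using True by (simp add: cf_monomial)
  next
    case False
    have "cf (monomial q w) (take i u) * cf (monomial r v) (drop i u) = 0" for i
      using False append_take_drop_id[of i u] by (auto simp: cf_monomial)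
    then have "cf (monomial q w * monomial r v) u = 0"
      unfolding cf_mult by (intro sum.neutral) simp
    then show ?thesis using False by (simp add: cf_monomial)
  qed
qed

lemma finite_short_words: "finite {w::bool list. length w < N}"
  by (rule finite_subset[OF _ finite_lists_length_le[of UNIV N]]) auto

lemma trunc_approx: "ordge N (f - (\<Sum>w\<in>{w. length w < N}. monomial (cf f w) w))"
  by (auto simp: ordge_def cf_monomial sum.delta finite_short_words)

section \<open>Lazard modules\<close>

text \<open>
  The additive part of the definition of a Lazard Lie ring, without \<open>F 0 = F 1\<close>. That condition may fail
  for endomorphism rings and for functions of two arguments, to which the results below are also
  applied. Completeness is stated for sequences with a known rate of convergence.
\<close>

locale lazard_module = abelian_group L for L (structure) +
  fixes F :: "nat \<Rightarrow> 'a set"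
  assumes F_0: "F 0 = carrier L"
    and F_Suc: "F (Suc i) \<subseteq> F i"
    and F_subgroup: "additive_subgroup (F i) L"
    and F_separated: "(\<And>k. x \<in> F k) \<Longrightarrow> x = \<zero>"
    and F_complete: "(\<And>n. s n \<in> carrier L) \<Longrightarrow> (\<And>n. s (Suc n) \<ominus> s n \<in> F n) \<Longrightarrow>
      \<exists>l\<in>carrier L. \<forall>n. s n \<ominus> l \<in> F n"
    and F_divisible: "1 \<le> i \<Longrightarrow> smooth i b \<Longrightarrow> x \<in> F i \<Longrightarrow> \<exists>!y. y \<in> F i \<and> add_pow L (int b) y = x"
begin

lemma F_antimono: "i \<le> j \<Longrightarrow> F j \<subseteq> F i"
  by (rule lift_Suc_antimono_le[of F, OF F_Suc])

lemma F_carrier: "x \<in> F i \<Longrightarrow> x \<in> carrier L"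
  using F_antimono[of 0 i] F_0 by auto

lemma F_zero: "\<zero> \<in> F i"
  using additive_subgroup.zero_closed[OF F_subgroup] .

lemma F_add: "x \<in> F i \<Longrightarrow> y \<in> F i \<Longrightarrow> x \<oplus> y \<in> F i"
  using additive_subgroup.a_closed[OF F_subgroup] .

lemma F_minus: "x \<in> F i \<Longrightarrow> \<ominus> x \<in> F i"
  using additive_subgroup.a_inv_closed[OF F_subgroup] abelian_group_axioms by blast

lemma F_diff: "x \<in> F i \<Longrightarrow> y \<in> F i \<Longrightarrow> x \<ominus> y \<in> F i"
  unfolding a_minus_def by (intro F_add F_minus)

lemma F_nat_pow: "x \<in> F i \<Longrightarrow> add_pow L (n::nat) x \<in> F i"
  by (induction n) (auto simp: add.nat_pow_Suc intro: F_zero F_add)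

lemma F_int_pow: "x \<in> F i \<Longrightarrow> add_pow L (a::int) x \<in> F i"
proof (cases a rule: int_cases2)
  case (nonneg n)
  then show "x \<in> F i \<Longrightarrow> ?thesis" by (simp add: add_pow_int_ge F_nat_pow)
next
  case (nonpos n)
  then show "x \<in> F i \<Longrightarrow> ?thesis"
    by (simp add: add.int_pow_neg_int F_carrier F_minus F_nat_pow)
qed

lemma F_finsum: "(\<And>x. x \<in> A \<Longrightarrow> f x \<in> F i) \<Longrightarrow> finsum L f A \<in> F i"
proof (induction A rule: infinite_finite_induct)
  case (insert x A)
  then have "f \<in> A \<rightarrow> carrier L" "f x \<in> carrier L" using F_carrier by auto
  then show ?case using insert by (simp add: finsum_insert F_add)
qed (auto simp: F_zero)

lemma F_diff_trans:
  assumes "x \<in> carrier L" "y \<in> carrier L" "z \<in> carrier L" "x \<ominus> y \<in> F i" "y \<ominus> z \<in> F i"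
  shows "x \<ominus> z \<in> F i"
proof -
  have "x \<ominus> z = (x \<ominus> y) \<oplus> (y \<ominus> z)"
  proof -
    have "\<ominus> y \<oplus> (y \<ominus> z) = \<ominus> z"
      using assms(1-3) by (simp add: a_minus_def r_neg1)
    then show ?thesis
      using assms(1-3) by (simp add: a_minus_def a_assoc)
  qed
  then show ?thesis using assms F_add by simp
qed

lemma F_diff_sym: "x \<in> carrier L \<Longrightarrow> y \<in> carrier L \<Longrightarrow> x \<ominus> y \<in> F i \<Longrightarrow> y \<ominus> x \<in> F i"
  using F_minus[of "x \<ominus> y" i] by (simp add: a_minus_def minus_add a_comm)

lemma F_eqI:
  assumes "x \<in> carrier L" "y \<in> carrier L" "\<And>k. x \<ominus> y \<in> F k" shows "x = y"
proof -
  have "x \<oplus> \<ominus> y = \<zero>" using F_separated[OF assms(3)] by (simp add: a_minus_def)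
  then show ?thesis using assms(1,2) minus_equality[of x "\<ominus> y"] by simp
qed

text \<open>
  For \<open>i = 0\<close> this holds because \<open>1\<close> is the only admissible integer.
\<close>

lemma F_torsion_free:
  assumes "smooth i b" "y \<in> F i" "z \<in> F i" "add_pow L (int b) y = add_pow L (int b) z"
  shows "y = z"
proof (cases "i = 0")
  case True
  then have "b = 1" using assms smooth_0 by auto
  then show ?thesis using assms F_carrier by simp
next
  case False
  then have "1 \<le> i" by simp
  from F_divisible[OF this assms(1) F_int_pow[OF assms(3)]]
  show ?thesis using assms by blast
qed

lemma F_divide:
  assumes "smooth i b" "x \<in> F i"
  obtains y where "y \<in> F i" "add_pow L (int b) y = x"
proof (cases "i = 0")
  case True
  then have "b = 1" using assms smooth_0 by auto
  then show ?thesis using that[of x] assms F_carrier by simp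
next
  case False
  then have "1 \<le> i" by simp
  from F_divisible[OF this assms] show ?thesis using that by blast
qed

subsection \<open>Multiplication by fractions\<close>

text \<open>
  The action of a fraction on the \<open>i\<close>-th term. The index has to be recorded, because the group may
  have torsion that only disappears from the \<open>i\<close>-th term on; by \<open>scale_index\<close> larger indices give
  the same value.
\<close>

definition scale :: "nat \<Rightarrow> real \<Rightarrow> 'a \<Rightarrow> 'a" where
  "scale i q x = (THE z. z \<in> F i \<and>
     (\<exists>a b. smooth i b \<and> q * real b = real_of_int a \<and> add_pow L (int b) z = add_pow L a x))"

lemma scale_eqI:
  assumes "x \<in> F i" "z \<in> F i" "smooth i b" "q * real b = real_of_int a"
    and "add_pow L (int b) z = add_pow L a x"
  shows "scale i q x = z"
  unfolding scale_def
proof (rule the_equality)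
  show "z \<in> F i \<and> (\<exists>a b. smooth i b \<and> q * real b = real_of_int a \<and> add_pow L (int b) z = add_pow L a x)"
    using assms by blast
next
  fix z' assume "z' \<in> F i \<and> (\<exists>a b. smooth i b \<and> q * real b = real_of_int a \<and> add_pow L (int b) z' = add_pow L a x)"
  then obtain a' b' where z': "z' \<in> F i" "smooth i b'" "q * real b' = real_of_int a'"
    "add_pow L (int b') z' = add_pow L a' x" by blast
  have "real_of_int (a * int b') = real_of_int (a' * int b)"
    using assms(4) z'(3) by (simp flip: assms(4) z'(3))
  then have ab: "a * int b' = a' * int b" by linarith
  have c: "x \<in> carrier L" "z \<in> carrier L" "z' \<in> carrier L"
    using assms z' F_carrier by auto
  have "add_pow L (int (b * b')) z = add_pow L (int b') (add_pow L (int b) z)"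
    using c by (simp add: add.int_pow_pow)
  also have "\<dots> = add_pow L (a * int b') x"
    using c by (simp add: assms(5) add.int_pow_pow)
  also have "\<dots> = add_pow L (int b) (add_pow L (int b') z')"
    using c by (simp add: ab z'(4) add.int_pow_pow)
  also have "\<dots> = add_pow L (int (b * b')) z'"
    using c by (simp add: add.int_pow_pow mult.commute)
  finally show "z' = z"
    using F_torsion_free[OF smooth_mult[OF assms(3) z'(2)] assms(2) z'(1)] by simp
qed

lemma scale_ex:
  assumes "q \<in> fractions i" "x \<in> F i"
  obtains a b where "smooth i b" "q * real b = real_of_int a" "scale i q x \<in> F i"
    "add_pow L (int b) (scale i q x) = add_pow L a x"
proof -
  obtain a b where ab: "smooth i b" "q * real b = real_of_int a" using assms by (auto simp: fractions_def)
  obtain z where "z \<in> F i" "add_pow L (int b) z = add_pow L a x"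
    using F_divide[OF ab(1) F_int_pow[OF assms(2)]] by blast
  then show ?thesis using that[OF ab] scale_eqI[OF assms(2) _ ab] by simp
qed

lemma scale_mem: "q \<in> fractions i \<Longrightarrow> x \<in> F i \<Longrightarrow> scale i q x \<in> F i"
  using scale_ex by metis

text \<open>
  The quotient exists already in the smaller term, and it is unique in the larger one.
\<close>

lemma scale_index:
  assumes "i \<le> j" "q \<in> fractions i" "x \<in> F j" shows "scale i q x = scale j q x"
proof -
  obtain a b where ab: "smooth i b" "q * real b = real_of_int a" using assms by (auto simp: fractions_def)
  obtain z where z: "z \<in> F j" "add_pow L (int b) z = add_pow L a x"
    using F_divide[OF smooth_mono[OF ab(1) assms(1)] F_int_pow[OF assms(3)]] by blast
  have "scale j q x = z"
    using scale_eqI[OF assms(3) z(1) smooth_mono[OF ab(1) assms(1)] ab(2) z(2)] .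
  moreover have "scale i q x = z"
    using scale_eqI[OF _ _ ab z(2)] assms(3) z(1) F_antimono[OF assms(1)] by blast
  ultimately show ?thesis by simp
qed

lemma scale_mem': "q \<in> fractions i \<Longrightarrow> x \<in> F j \<Longrightarrow> i \<le> j \<Longrightarrow> scale i q x \<in> F j"
  using scale_index[of i j q x] scale_mem[of q j x] fractions_mono by auto

lemma scale_zero: "x \<in> F i \<Longrightarrow> scale i 0 x = \<zero>"
proof -
  assume x: "x \<in> F i"
  have "add_pow L (0::int) x = \<zero>" by (simp add: add_pow_def)
  then show ?thesis using scale_eqI[OF x F_zero, of 1 0 0] by simp
qed

lemma scale_one: "x \<in> F i \<Longrightarrow> scale i 1 x = x"
  using scale_eqI[of x i x 1 1 1] F_carrier by simp

lemma scale_add_left: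
  assumes "q \<in> fractions i" "r \<in> fractions i" "x \<in> F i"
  shows "scale i (q + r) x = scale i q x \<oplus> scale i r x"
proof -
  obtain a b where 1: "smooth i b" "q * real b = real_of_int a" "scale i q x \<in> F i"
    "add_pow L (int b) (scale i q x) = add_pow L a x" using scale_ex[OF assms(1,3)] .
  obtain c d where 2: "smooth i d" "r * real d = real_of_int c" "scale i r x \<in> F i"
    "add_pow L (int d) (scale i r x) = add_pow L c x" using scale_ex[OF assms(2,3)] .
  have c: "x \<in> carrier L" "scale i q x \<in> carrier L" "scale i r x \<in> carrier L"
    using assms 1 2 F_carrier by auto
  show ?thesis
  proof (rule scale_eqI[OF assms(3) F_add[OF 1(3) 2(3)] smooth_mult[OF 1(1) 2(1)]])
    have "(q + r) * real (b * d) = (q * real b) * real d + (r * real d) * real b"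
      by (simp add: algebra_simps)
    then show "(q + r) * real (b * d) = real_of_int (a * int d + c * int b)"
      by (simp add: 1 2)
    have "add_pow L (int (b * d)) (scale i q x \<oplus> scale i r x) =
        add_pow L (int d) (add_pow L (int b) (scale i q x)) \<oplus> add_pow L (int b) (add_pow L (int d) (scale i r x))"
      using c by (simp add: add.int_pow_distrib add.int_pow_pow mult.commute)
    then show "add_pow L (int (b * d)) (scale i q x \<oplus> scale i r x) = add_pow L (a * int d + c * int b) x"
      using c by (simp add: 1 2 add.int_pow_pow add.int_pow_mult)
  qed
qed

lemma scale_add_right:
  assumes "q \<in> fractions i" "x \<in> F i" "y \<in> F i"
  shows "scale i q (x \<oplus> y) = scale i q x \<oplus> scale i q y"
proof -
  obtain a b where ab: "smooth i b" "q * real b = real_of_int a" using assms by (auto simp: fractions_def)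
  obtain u where u: "u \<in> F i" "add_pow L (int b) u = add_pow L a x"
    using F_divide[OF ab(1) F_int_pow[OF assms(2)]] by blast
  obtain v where v: "v \<in> F i" "add_pow L (int b) v = add_pow L a y"
    using F_divide[OF ab(1) F_int_pow[OF assms(3)]] by blast
  have c: "x \<in> carrier L" "y \<in> carrier L" "u \<in> carrier L" "v \<in> carrier L"
    using assms u v F_carrier by auto
  have "scale i q (x \<oplus> y) = u \<oplus> v"
    using c u v by (intro scale_eqI[OF F_add[OF assms(2,3)] F_add[OF u(1) v(1)] ab])
      (simp add: add.int_pow_distrib)
  then show ?thesis
    using scale_eqI[OF assms(2) u(1) ab u(2)] scale_eqI[OF assms(3) v(1) ab v(2)] by simp
qed

lemma scale_mult:
  assumes "q \<in> fractions i" "r \<in> fractions j" "x \<in> F (i + j)"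
  shows "scale i q (scale j r x) = scale (i + j) (q * r) x"
proof -
  have r: "r \<in> fractions (i + j)" and q: "q \<in> fractions (i + j)"
    using fractions_mono assms by auto
  have y: "scale j r x = scale (i + j) r x"
    using assms by (intro scale_index) auto
  obtain c d where 2: "smooth (i + j) d" "r * real d = real_of_int c" "scale (i + j) r x \<in> F (i + j)"
    "add_pow L (int d) (scale (i + j) r x) = add_pow L c x" using scale_ex[OF r assms(3)] .
  have qy: "scale i q (scale j r x) = scale (i + j) q (scale (i + j) r x)"
    unfolding y using assms 2(3) by (intro scale_index) auto
  obtain a b where 1: "smooth (i + j) b" "q * real b = real_of_int a" "scale (i + j) q (scale (i + j) r x) \<in> F (i + j)"
    "add_pow L (int b) (scale (i + j) q (scale (i + j) r x)) = add_pow L a (scale (i + j) r x)"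
    using scale_ex[OF q 2(3)] .
  have "scale (i + j) (q * r) x = scale (i + j) q (scale (i + j) r x)"
  proof (rule scale_eqI[OF assms(3) 1(3) smooth_mult[OF 1(1) 2(1)]])
    have "q * r * real (b * d) = (q * real b) * (r * real d)"
      by (simp only: of_nat_mult mult_ac)
    then show "q * r * real (b * d) = real_of_int (c * a)" by (simp add: 1 2)
    have c: "x \<in> carrier L" "scale (i + j) r x \<in> carrier L" "scale (i + j) q (scale (i + j) r x) \<in> carrier L"
      using assms(3) 1(3) 2(3) F_carrier by auto
    have "add_pow L (int (b * d)) (scale (i + j) q (scale (i + j) r x)) =
       add_pow L (int d) (add_pow L (int b) (scale (i + j) q (scale (i + j) r x)))"
      using c by (simp add: add.int_pow_pow)
    also have "\<dots> = add_pow L a (add_pow L (int d) (scale (i + j) r x))"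
      unfolding 1(4) using c by (simp add: add.int_pow_pow mult.commute)
    also have "\<dots> = add_pow L (c * a) x"
      unfolding 2(4) using c by (simp add: add.int_pow_pow)
    finally show "add_pow L (int (b * d)) (scale (i + j) q (scale (i + j) r x)) = add_pow L (c * a) x" .
  qed
  then show ?thesis by (simp add: qy)
qed

end

lemma add_pow_hom:
  assumes "abelian_group L" "abelian_group M" "\<phi> \<in> hom (add_monoid L) (add_monoid M)" "x \<in> carrier L"
  shows "\<phi> (add_pow L (a::int) x) = add_pow M a (\<phi> x)"
proof -
  interpret L: abelian_group L by fact
  interpret M: abelian_group M by fact
  have "group_hom (add_monoid L) (add_monoid M) \<phi>"
    using assms L.a_group M.a_group by (simp add: group_hom_def group_hom_axioms_def)
  from group_hom.hom_int_pow[OF this, of x a] assms(4)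
  show ?thesis by (simp add: add_pow_def)
qed

lemma scale_hom:
  assumes "lazard_module L F" "lazard_module M E" "\<phi> \<in> hom (add_monoid L) (add_monoid M)"
    and "\<phi> ` F i \<subseteq> E i" "q \<in> fractions i" "x \<in> F i"
  shows "\<phi> (lazard_module.scale L F i q x) = lazard_module.scale M E i q (\<phi> x)"
proof -
  interpret L: lazard_module L F by fact
  interpret M: lazard_module M E by fact
  obtain a b where ab: "smooth i b" "q * real b = real_of_int a" "L.scale i q x \<in> F i"
    "add_pow L (int b) (L.scale i q x) = add_pow L a x" using L.scale_ex[OF assms(5,6)] .
  have "add_pow M (int b) (\<phi> (L.scale i q x)) = add_pow M a (\<phi> x)"
    using arg_cong[OF ab(4), of \<phi>] assms(3,6) ab(3) L.F_carrier
    by (simp add: add_pow_hom[OF L.abelian_group_axioms M.abelian_group_axioms])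
  then show ?thesis
    using assms(4,6) ab by (intro M.scale_eqI[symmetric, OF _ _ ab(1,2)]) auto
qed

text \<open>
  The word \<open>w\<close> in the operators \<open>d\<close> (for \<open>True\<close>) and \<open>e\<close> (for \<open>False\<close>).
\<close>

fun word_op :: "('a \<Rightarrow> 'a) \<Rightarrow> ('a \<Rightarrow> 'a) \<Rightarrow> bool list \<Rightarrow> 'a \<Rightarrow> 'a" where
  "word_op d e [] x = x"
| "word_op d e (b # w) x = (if b then d else e) (word_op d e w x)"

lemma word_op_append: "word_op d e (w @ v) x = word_op d e w (word_op d e v x)"
  by (induction w) auto

context lazard_module
begin

subsection \<open>Series with coefficients in the module\<close>

text \<open>
  Sums \<open>\<Sum> f\<^sub>w t\<^sub>w\<close> over all words converge if \<open>t\<^sub>w\<close> lies in the term given by the length of \<open>w\<close>.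
  They are treated for arbitrary such families, not only for words in operators, so that one
  naturality statement (\<open>ser_hom\<close>) compares series in different modules.
\<close>

definition adm :: "(bool list \<Rightarrow> 'a) \<Rightarrow> bool" where
  "adm t \<longleftrightarrow> (\<forall>w. t w \<in> F (length w))"

definition part :: "ncs \<Rightarrow> (bool list \<Rightarrow> 'a) \<Rightarrow> nat \<Rightarrow> 'a" where
  "part f t N = (\<Oplus>w\<in>{w. length w < N}. scale (length w) (cf f w) (t w))"

definition ser :: "ncs \<Rightarrow> (bool list \<Rightarrow> 'a) \<Rightarrow> 'a" where
  "ser f t = (THE y. y \<in> carrier L \<and> (\<forall>N. part f t N \<ominus> y \<in> F N))"

lemma adm_term: "integ f \<Longrightarrow> adm t \<Longrightarrow> scale (length w) (cf f w) (t w) \<in> F (length w)"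
  by (auto simp: integ_def adm_def intro: scale_mem)

lemma adm_term_carrier: "integ f \<Longrightarrow> adm t \<Longrightarrow> scale (length w) (cf f w) (t w) \<in> carrier L"
  by (rule F_carrier[OF adm_term])

lemma part_carrier: "integ f \<Longrightarrow> adm t \<Longrightarrow> part f t N \<in> carrier L"
  unfolding part_def by (intro finsum_closed) (auto intro: adm_term_carrier)

lemma part_Suc:
  assumes "integ f" "adm t" shows "part f t (Suc N) \<ominus> part f t N \<in> F N"
proof -
  let ?s = "\<lambda>w. scale (length w) (cf f w) (t w)"
  have sc: "?s w \<in> carrier L" for w using assms by (rule adm_term_carrier)
  have U: "{w. length w < Suc N} = {w::bool list. length w < N} \<union> {w. length w = N}" by auto
  have fin: "finite {w::bool list. length w = N}"
    by (rule finite_subset[OF _ finite_short_words[of "Suc N"]]) auto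
  have "part f t (Suc N) = part f t N \<oplus> finsum L ?s {w. length w = N}"
    unfolding part_def U by (subst finsum_Un_disjoint) (auto simp: finite_short_words fin sc)
  moreover have "finsum L ?s {w. length w = N} \<in> F N"
    using adm_term[OF assms] by (intro F_finsum) auto
  ultimately show ?thesis
    using part_carrier[OF assms, of N] F_carrier
    by (simp add: a_minus_def a_comm[of "part f t N"] a_assoc r_neg)
qed

lemma ser_ex:
  assumes "integ f" "adm t"
  shows "ser f t \<in> carrier L \<and> (\<forall>N. part f t N \<ominus> ser f t \<in> F N)"
  unfolding ser_def
proof (rule theI')
  obtain l where l: "l \<in> carrier L" "\<forall>n. part f t n \<ominus> l \<in> F n"
    using F_complete[of "part f t"] part_Suc[OF assms] part_carrier[OF assms] by blast
  show "\<exists>!y. y \<in> carrier L \<and> (\<forall>N. part f t N \<ominus> y \<in> F N)"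
  proof (rule ex1I)
    fix y assume y: "y \<in> carrier L \<and> (\<forall>N. part f t N \<ominus> y \<in> F N)"
    show "y = l"
    proof (rule F_eqI)
      show "y \<ominus> l \<in> F k" for k
        using y l part_carrier[OF assms, of k] F_diff_trans[of y "part f t k" l k] F_diff_sym[of "part f t k" y k]
        by simp
    qed (use y l in auto)
  qed (use l in auto)
qed

lemma ser_carrier: "integ f \<Longrightarrow> adm t \<Longrightarrow> ser f t \<in> carrier L"
  and ser_part: "integ f \<Longrightarrow> adm t \<Longrightarrow> part f t N \<ominus> ser f t \<in> F N"
  using ser_ex by blast+

lemma ser_eqI:
  assumes "integ f" "adm t" "y \<in> carrier L" "\<And>N. part f t N \<ominus> y \<in> F N"
  shows "ser f t = y"
proof (rule F_eqI)
  show "ser f t \<ominus> y \<in> F k" for k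
    using F_diff_trans[OF ser_carrier part_carrier _ F_diff_sym[OF part_carrier ser_carrier ser_part]] assms
    by blast
qed (use assms ser_carrier in auto)

lemma diff_add_F:
  assumes "a \<in> carrier L" "b \<in> carrier L" "c \<in> carrier L" "d \<in> carrier L" "a \<ominus> c \<in> F N" "b \<ominus> d \<in> F N"
  shows "(a \<oplus> b) \<ominus> (c \<oplus> d) \<in> F N"
proof -
  have "(a \<oplus> b) \<ominus> (c \<oplus> d) = (a \<ominus> c) \<oplus> (b \<ominus> d)"
    using assms(1-4) by (simp add: a_minus_def minus_add a_ac)
  then show ?thesis using assms F_add by simp
qed

lemma ser_add_left:
  assumes "integ f" "integ g" "adm t"
  shows "ser (f + g) t = ser f t \<oplus> ser g t"
proof (rule ser_eqI)
  fix N
  have "part (f + g) t N = part f t N \<oplus> part g t N"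
    unfolding part_def using assms
    by (subst finsum_addf[symmetric])
      (auto intro!: finsum_cong' scale_add_left a_closed adm_term_carrier simp: integ_def adm_def)
  then show "part (f + g) t N \<ominus> (ser f t \<oplus> ser g t) \<in> F N"
    using assms by (simp add: diff_add_F part_carrier ser_carrier ser_part)
qed (use assms in \<open>auto intro: integ_add ser_carrier\<close>)

lemma ser_add_right:
  assumes "integ f" "adm t" "adm u"
  shows "ser f (\<lambda>w. t w \<oplus> u w) = ser f t \<oplus> ser f u"
proof (rule ser_eqI)
  fix N
  have "part f (\<lambda>w. t w \<oplus> u w) N = part f t N \<oplus> part f u N"
    unfolding part_def using assms
    by (subst finsum_addf[symmetric])
      (auto intro!: finsum_cong' scale_add_right a_closed adm_term_carrier simp: integ_def adm_def)
  then show "part f (\<lambda>w. t w \<oplus> u w) N \<ominus> (ser f t \<oplus> ser f u) \<in> F N"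
    using assms by (simp add: diff_add_F part_carrier ser_carrier ser_part)
next
  show "adm (\<lambda>w. t w \<oplus> u w)"
    using assms by (auto simp: adm_def F_add)
qed (use assms in \<open>auto intro: ser_carrier\<close>)

lemma F_closed:
  assumes "y \<in> carrier L" "\<And>N. \<exists>x \<in> F k. x \<ominus> y \<in> F N"
  shows "y \<in> F k"
proof -
  obtain x where x: "x \<in> F k" "x \<ominus> y \<in> F k" using assms(2) by blast
  have "y = x \<ominus> (x \<ominus> y)"
    using x(1) assms(1) F_carrier by (simp add: a_minus_def minus_add a_assoc[symmetric] r_neg)
  then show ?thesis using F_diff[OF x] by simp
qed

text \<open>
  The scaled summands stay in the term of their vectors, since enlarging the index does not
  change the scaling, and terms of the filtration are closed under limits.
\<close>

lemma ser_mem: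
  assumes f: "integ f" and t: "adm t" and k: "\<And>w. cf f w \<noteq> 0 \<Longrightarrow> t w \<in> F k"
  shows "ser f t \<in> F k"
proof -
  have "scale (length w) (cf f w) (t w) \<in> F k" for w
  proof (cases "cf f w = 0")
    case True
    then show ?thesis using t F_zero by (simp add: scale_zero adm_def)
  next
    case False
    show ?thesis
    proof (cases "length w \<le> k")
      case True
      then show ?thesis using k[OF False] f by (auto simp: integ_def intro: scale_mem')
    next
      case False
      then show ?thesis using adm_term[OF f t, of w] F_antimono[of k "length w"] by auto
    qed
  qed
  then have "part f t N \<in> F k" for N
    unfolding part_def by (intro F_finsum)
  then show ?thesis
    using F_closed[OF ser_carrier[OF f t], of k] ser_part[OF f t] by blast
qed

lemma ser_monomial:
  assumes "q \<in> fractions (length w)" "adm t"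
  shows "ser (monomial q w) t = scale (length w) q (t w)"
proof (rule ser_eqI)
  let ?y = "scale (length w) q (t w)"
  have y: "?y \<in> F (length w)" using assms by (auto simp: adm_def intro: scale_mem)
  then have yc: "?y \<in> carrier L" by (rule F_carrier)
  then show "?y \<in> carrier L" .
  fix N
  have eq: "scale (length v) (cf (monomial q w) v) (t v) = (if w = v then ?y else \<zero>)" for v
    using assms by (auto simp: cf_monomial adm_def scale_zero)
  show "part (monomial q w) t N \<ominus> ?y \<in> F N"
  proof (cases "length w < N")
    case True
    have "part (monomial q w) t N = ?y"
      unfolding part_def eq using True yc
      by (subst add.finprod_singleton[of w "{w. length w < N}" "\<lambda>_. ?y", simplified]) (auto simp: finite_short_words)
    then show ?thesis using yc F_zero by (simp add: a_minus_def r_neg)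
  next
    case False
    have "part (monomial q w) t N = (\<Oplus>v\<in>{v::bool list. length v < N}. \<zero>)"
      unfolding part_def eq using False by (intro finsum_cong') auto
    then have "part (monomial q w) t N = \<zero>" by (simp add: finsum_zero)
    then show ?thesis using yc y F_minus False F_antimono[of N "length w"] by (auto simp: a_minus_def)
  qed
qed (use assms integ_monomial in auto)

end

text \<open>
  Filtered additive maps are continuous and commute with division, hence with all convergent series.
\<close>

lemma ser_hom:
  assumes L: "lazard_module L F" and M: "lazard_module M E"
    and hom: "\<phi> \<in> hom (add_monoid L) (add_monoid M)"
    and filt: "\<And>i. \<phi> ` F i \<subseteq> E i"
    and f: "integ f" and t: "lazard_module.adm F t"
  shows "\<phi> (lazard_module.ser L F f t) = lazard_module.ser M E f (\<lambda>w. \<phi> (t w))"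
proof -
  interpret L: lazard_module L F by fact
  interpret M: lazard_module M E by fact
  interpret h: group_hom "add_monoid L" "add_monoid M" \<phi>
    using hom L.a_group M.a_group by (simp add: group_hom_def group_hom_axioms_def)
  have u: "M.adm (\<lambda>w. \<phi> (t w))"
    using t filt by (auto simp: M.adm_def L.adm_def)
  have tc: "L.scale (length w) (cf f w) (t w) \<in> carrier L" for w
    by (rule L.adm_term_carrier[OF f t])
  have fs: "\<phi> (finsum L g A) = finsum M (\<lambda>x. \<phi> (g x)) A" if "finite A" "g \<in> A \<rightarrow> carrier L" for g and A :: "bool list set"
    using that
  proof (induction A)
    case empty
    show ?case using h.hom_one by simp
  next
    case (insert x A)
    then have "\<phi> (finsum L g (insert x A)) = \<phi> (g x) \<oplus>\<^bsub>M\<^esub> \<phi> (finsum L g A)"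
      using h.hom_mult by (simp add: Pi_iff L.finsum_closed)
    then show ?case using insert h.hom_closed by (simp add: Pi_iff)
  qed
  have part: "\<phi> (L.part f t N) = M.part f (\<lambda>w. \<phi> (t w)) N" for N
    unfolding L.part_def M.part_def
    using fs[OF finite_short_words, of "\<lambda>w. L.scale (length w) (cf f w) (t w)" N] tc
      scale_hom[OF L M hom filt] f t
    by (simp add: Pi_iff integ_def L.adm_def)
  have c: "L.ser f t \<in> carrier L" by (rule L.ser_carrier[OF f t])
  have "M.part f (\<lambda>w. \<phi> (t w)) N \<ominus>\<^bsub>M\<^esub> \<phi> (L.ser f t) \<in> E N" for N
  proof -
    have "\<phi> (L.part f t N \<ominus>\<^bsub>L\<^esub> L.ser f t) = \<phi> (L.part f t N) \<ominus>\<^bsub>M\<^esub> \<phi> (L.ser f t)"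
      using h.hom_mult[of "L.part f t N" "\<ominus>\<^bsub>L\<^esub> L.ser f t"] h.hom_inv[of "L.ser f t"] c L.part_carrier[OF f t]
      by (simp add: a_minus_def a_inv_def)
    then show ?thesis using filt[of N] L.ser_part[OF f t, of N] part by auto
  qed
  moreover have "\<phi> (L.ser f t) \<in> carrier M" using h.hom_closed c by simp
  ultimately show ?thesis by (intro M.ser_eqI[symmetric] f u)
qed

section \<open>Constructions of Lazard modules\<close>

lemma (in lazard_module) descending_subgroups: "descending_subgroups (add_monoid L) F"
  by (intro descending_subgroups.intro descending_subgroups_axioms.intro a_group F_Suc
      additive_subgroup.a_subgroup[OF F_subgroup])

lemma (in abelian_group) inv_mult_add_monoid:
  "x \<in> carrier G \<Longrightarrow> y \<in> carrier G \<Longrightarrow> inv\<^bsub>add_monoid G\<^esub> x \<otimes>\<^bsub>add_monoid G\<^esub> y = y \<ominus> x"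
  unfolding a_minus_def a_inv_def[symmetric] by (simp add: a_comm)

lemma (in lazard_module) Hausdorff: "Hausdorff_space (filt_topology (add_monoid L) F)"
proof -
  interpret d: descending_subgroups "add_monoid L" F by (rule descending_subgroups)
  show ?thesis unfolding d.Hausdorff_filt_topology using F_separated by auto
qed

lemma (in lazard_module) filt_lim_add:
  assumes "\<And>n. s n \<in> carrier L" "l \<in> carrier L" "\<And>k. \<exists>N. \<forall>n\<ge>N. s n \<ominus> l \<in> F k"
  shows "filt_lim (add_monoid L) F s = l"
proof -
  interpret d: descending_subgroups "add_monoid L" F by (rule descending_subgroups)
  show ?thesis
  proof (rule d.filt_lim_eq[OF Hausdorff])
    show "range s \<subseteq> carrier (add_monoid L)" using assms by auto
    show "\<exists>N. \<forall>n\<ge>N. inv\<^bsub>add_monoid L\<^esub> l \<otimes>\<^bsub>add_monoid L\<^esub> s n \<in> F k" for k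
      using assms(3)[of k] by (simp only: inv_mult_add_monoid[OF assms(2,1)])
  qed (use assms in auto)
qed

lemma (in lazard_module) lazard_filtration:
  assumes "F 0 = F 1" shows "lazard_filtration (add_monoid L) F"
proof -
  interpret d: descending_subgroups "add_monoid L" F by (rule descending_subgroups)
  have "filt_complete (add_monoid L) F"
    unfolding d.filt_complete_iff
  proof (intro allI impI)
    fix s assume s: "(\<forall>n. s n \<in> carrier (add_monoid L)) \<and>
      (\<forall>n. inv\<^bsub>add_monoid L\<^esub> s n \<otimes>\<^bsub>add_monoid L\<^esub> s (Suc n) \<in> F n)"
    then have sc: "s n \<in> carrier L" for n by simp
    have "inv\<^bsub>add_monoid L\<^esub> s n \<otimes>\<^bsub>add_monoid L\<^esub> s (Suc n) \<in> F n" for n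
      using s by blast
    then have "s (Suc n) \<ominus> s n \<in> F n" for n
      by (simp only: inv_mult_add_monoid[OF sc sc])
    from F_complete[OF sc this] obtain l where l: "l \<in> carrier L" "\<forall>n. s n \<ominus> l \<in> F n"
      by blast
    then have "\<forall>n. inv\<^bsub>add_monoid L\<^esub> l \<otimes>\<^bsub>add_monoid L\<^esub> s n \<in> F n"
      by (simp only: inv_mult_add_monoid[OF l(1) sc] simp_thms)
    moreover have "l \<in> carrier (add_monoid L)" using l by simp
    ultimately show "\<exists>l\<in>carrier (add_monoid L). \<forall>n. inv\<^bsub>add_monoid L\<^esub> l \<otimes>\<^bsub>add_monoid L\<^esub> s n \<in> F n"
      by blast
  qed
  moreover have "\<exists>!y. y \<in> F i \<and> y [^]\<^bsub>add_monoid L\<^esub> n = x"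
    if "i \<ge> 1" "n \<ge> 1" "\<forall>p. Factorial_Ring.prime p \<and> p dvd n \<longrightarrow> p \<le> i" "x \<in> F i" for i x and n :: nat
  proof -
    have "smooth i n" using that by (simp add: smooth_def)
    from F_divisible[OF that(1) this that(4)] show ?thesis
      by (simp add: add_pow_def int_pow_int)
  qed
  ultimately show ?thesis
    unfolding lazard_filtration_def using Hausdorff assms by blast
qed

lemma lazard_moduleI:
  assumes G: "abelian_group L" and F0: "F 0 = carrier L" and FS: "\<And>i. F (Suc i) \<subseteq> F i"
    and sub: "\<And>i. additive_subgroup (F i) L" and laz: "lazard_filtration (add_monoid L) F"
  shows "lazard_module L F"
proof -
  interpret abelian_group L by fact
  interpret d: descending_subgroups "add_monoid L" F
    by (intro descending_subgroups.intro descending_subgroups_axioms.intro a_group FS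
        additive_subgroup.a_subgroup[OF sub])
  have compl: "filt_complete (add_monoid L) F" and haus: "Hausdorff_space (filt_topology (add_monoid L) F)"
    using laz by (auto simp: lazard_filtration_def)
  show ?thesis
  proof (intro lazard_module.intro lazard_module_axioms.intro G F0 FS sub)
    fix x assume "\<And>k. x \<in> F k"
    then show "x = \<zero>\<^bsub>L\<^esub>" using haus F0 unfolding d.Hausdorff_filt_topology by auto
  next
    fix s assume s: "\<And>n. s n \<in> carrier L" "\<And>n. s (Suc n) \<ominus>\<^bsub>L\<^esub> s n \<in> F n"
    have "inv\<^bsub>add_monoid L\<^esub> s n \<otimes>\<^bsub>add_monoid L\<^esub> s (Suc n) \<in> F n" for n
      using s(2) by (simp only: inv_mult_add_monoid[OF s(1) s(1)])
    moreover have "s n \<in> carrier (add_monoid L)" for n using s by simp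
    ultimately obtain l where l: "l \<in> carrier (add_monoid L)"
      "\<forall>n. inv\<^bsub>add_monoid L\<^esub> l \<otimes>\<^bsub>add_monoid L\<^esub> s n \<in> F n"
      using compl unfolding d.filt_complete_iff by blast
    then have l: "l \<in> carrier L" "\<forall>n. inv\<^bsub>add_monoid L\<^esub> l \<otimes>\<^bsub>add_monoid L\<^esub> s n \<in> F n"
      by simp_all
    then have "\<forall>n. s n \<ominus>\<^bsub>L\<^esub> l \<in> F n"
      by (simp only: inv_mult_add_monoid[OF l(1) s(1)] simp_thms)
    then show "\<exists>l\<in>carrier L. \<forall>n. s n \<ominus>\<^bsub>L\<^esub> l \<in> F n"
      using l by blast
  next
    fix i b x assume "1 \<le> i" "smooth i b" "x \<in> F i"
    then have "\<exists>!y. y \<in> F i \<and> y [^]\<^bsub>add_monoid L\<^esub> b = x"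
      using laz unfolding lazard_filtration_def smooth_def by blast
    then show "\<exists>!y. y \<in> F i \<and> add_pow L (int b) y = x"
      by (simp add: add_pow_def int_pow_int)
  qed
qed

text \<open>
  A closed subgroup that contains the quotients of its elements inherits all the axioms. Applied to
  additive functions among all functions and to derivations among endomorphisms.
\<close>

lemma lazard_submodule:
  fixes L (structure)
  assumes "lazard_module L F" and X: "additive_subgroup X L"
    and simps: "carrier L' = X" "zero L' = zero L" "add L' = add L"
    and F': "\<And>i. F' i = X \<inter> F i"
    and closed: "\<And>y. y \<in> carrier L \<Longrightarrow> (\<And>N. \<exists>x\<in>X. x \<ominus>\<^bsub>L\<^esub> y \<in> F N) \<Longrightarrow> y \<in> X"
    and division: "\<And>i b y. 1 \<le> i \<Longrightarrow> smooth i b \<Longrightarrow> y \<in> F i \<Longrightarrow> add_pow L (int b) y \<in> X \<Longrightarrow> y \<in> X"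
  shows "lazard_module L' F'"
proof -
  interpret lazard_module L F by fact
  have Xs: "subgroup X (add_monoid L)" using X by (rule additive_subgroup.a_subgroup)
  have XC: "X \<subseteq> carrier L" using subgroup.subset[OF Xs] by simp
  interpret L': abelian_group L'
  proof (rule abelian_groupI, unfold simps)
    fix x assume "x \<in> X"
    then show "\<exists>y\<in>X. y \<oplus> x = \<zero>"
      using subgroup.m_inv_closed[OF Xs] XC by (intro bexI[of _ "\<ominus> x"]) (auto simp: l_neg a_inv_def[symmetric])
  qed (use XC additive_subgroup.a_closed[OF X] additive_subgroup.zero_closed[OF X] in \<open>auto simp: a_ac subset_iff\<close>)
  have neg: "\<ominus> x \<in> X" if "x \<in> X" for x
    using subgroup.m_inv_closed[OF Xs that] by (simp add: a_inv_def)
  have minus: "\<ominus>\<^bsub>L'\<^esub> x = \<ominus> x" if "x \<in> X" for x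
    using L'.minus_equality[of "\<ominus> x" x] neg[OF that] that XC by (simp add: simps l_neg subset_iff)
  then have diff: "x \<ominus>\<^bsub>L'\<^esub> y = x \<ominus> y" if "y \<in> X" for x y
    using that by (simp add: a_minus_def simps)
  have pow: "add_pow L' (a::int) x = add_pow L a x" if "x \<in> X" for a x
    using add_pow_hom[OF L'.abelian_group_axioms abelian_group_axioms, of "\<lambda>x. x" x a] that XC
    by (auto simp: hom_def simps)
  show ?thesis
  proof (intro lazard_module.intro lazard_module_axioms.intro L'.abelian_group_axioms)
    show "F' 0 = carrier L'" using XC by (auto simp: F' simps F_0)
    show "F' (Suc i) \<subseteq> F' i" for i using F_Suc[of i] by (auto simp: F')
    show "additive_subgroup (F' i) L'" for i
    proof (intro additive_subgroup.intro L'.add.subgroupI)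
      show "F' i \<noteq> {}" using additive_subgroup.zero_closed[OF X] F_zero by (auto simp: F')
    qed (auto simp: F' simps minus neg F_minus F_add additive_subgroup.a_closed[OF X])
    show "x = \<zero>\<^bsub>L'\<^esub>" if "\<And>k. x \<in> F' k" for x
      using F_separated that by (auto simp: F' simps)
  next
    fix s assume s: "\<And>n. s n \<in> carrier L'" "\<And>n. s (Suc n) \<ominus>\<^bsub>L'\<^esub> s n \<in> F' n"
    then have sX: "s n \<in> X" for n by (simp add: simps)
    have sd: "s (Suc n) \<ominus> s n \<in> F n" for n using s(2)[of n] by (simp add: diff sX F')
    have sc: "s n \<in> carrier L" for n using sX XC by auto
    from F_complete[OF sc sd] obtain l where l: "l \<in> carrier L" "\<forall>n. s n \<ominus> l \<in> F n"
      by blast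
    have "l \<in> X" using l sX by (intro closed) auto
    moreover have "s n \<ominus> l \<in> X" for n
      using calculation sX by (simp add: a_minus_def additive_subgroup.a_closed[OF X] neg)
    ultimately show "\<exists>l\<in>carrier L'. \<forall>n. s n \<ominus>\<^bsub>L'\<^esub> l \<in> F' n"
      using l by (auto simp: simps diff F')
  next
    fix i b x assume "1 \<le> i" "smooth i b" and x: "x \<in> F' i"
    then have ex: "\<exists>!y. y \<in> F i \<and> add_pow L (int b) y = x"
      by (intro F_divisible) (auto simp: F')
    moreover have "y \<in> F' i \<and> add_pow L' (int b) y = x \<longleftrightarrow> y \<in> F i \<and> add_pow L (int b) y = x" for y
      using division[OF \<open>1 \<le> i\<close> \<open>smooth i b\<close>, of y] x by (auto simp: F' pow)
    ultimately show "\<exists>!y. y \<in> F' i \<and> add_pow L' (int b) y = x" by simp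
  qed
qed

subsection \<open>Functions with values in a Lazard module\<close>

text \<open>
  Functions from a filtered set \<open>S\<close> that respect the filtrations. Endomorphisms are those functions on
  the module itself that are additive; the functions of two arguments below are another case.
  Only the additive structure is of interest, so product and unit are arbitrary.
\<close>

definition Fun_mod :: "('a, 'm) ring_scheme \<Rightarrow> (nat \<Rightarrow> 'a set) \<Rightarrow> (nat \<Rightarrow> 'b set) \<Rightarrow> ('b \<Rightarrow> 'a) ring" where
  "Fun_mod L F S =
     \<lparr>carrier = {f \<in> extensional (S 0). \<forall>i. f ` S i \<subseteq> F i},
      mult = undefined, one = undefined,
      zero = (\<lambda>x\<in>S 0. \<zero>\<^bsub>L\<^esub>),
      add = (\<lambda>f g. \<lambda>x\<in>S 0. f x \<oplus>\<^bsub>L\<^esub> g x)\<rparr>"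

definition Fun_filt :: "('a, 'm) ring_scheme \<Rightarrow> (nat \<Rightarrow> 'a set) \<Rightarrow> (nat \<Rightarrow> 'b set) \<Rightarrow> nat \<Rightarrow> ('b \<Rightarrow> 'a) set" where
  "Fun_filt L F S j = {f \<in> extensional (S 0). \<forall>i. f ` S i \<subseteq> F (i + j)}"

context lazard_module
begin

text \<open>
  Limits and quotients are taken pointwise. The point is that they respect the filtration of the
  source: at a point of \<open>S i\<close> one has to work in the term \<open>i + j\<close> instead of \<open>j\<close>, and uniqueness shows
  that the results agree.
\<close>

lemma Fun_mod_module:
  assumes S: "\<And>i. S i \<subseteq> S 0"
  shows "lazard_module (Fun_mod L F S) (Fun_filt L F S)"
    and "f \<in> carrier (Fun_mod L F S) \<Longrightarrow> g \<in> carrier (Fun_mod L F S) \<Longrightarrow> x \<in> S 0 \<Longrightarrow>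
       (f \<ominus>\<^bsub>Fun_mod L F S\<^esub> g) x = f x \<ominus> g x"
    and "f \<in> carrier (Fun_mod L F S) \<Longrightarrow> x \<in> S 0 \<Longrightarrow>
       (add_pow (Fun_mod L F S) (a::int) f) x = add_pow L a (f x)"
proof -
  let ?M = "Fun_mod L F S" and ?E = "Fun_filt L F S"
  have E0: "?E 0 = carrier ?M" by (simp add: Fun_filt_def Fun_mod_def)
  have ES: "?E (Suc j) \<subseteq> ?E j" for j
    using F_Suc by (auto simp: Fun_filt_def) blast
  have Ej: "?E j \<subseteq> carrier ?M" for j
    using lift_Suc_antimono_le[of ?E, OF ES, of 0 j] E0 by auto
  have val: "f x \<in> F (i + j)" if "f \<in> ?E j" "x \<in> S i" for f x i j
    using that by (auto simp: Fun_filt_def)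
  have valc: "f x \<in> carrier L" if "f \<in> carrier ?M" "x \<in> S 0" for f x
    using that F_0 by (force simp: Fun_mod_def)
  have add_simp [simp]: "(f \<oplus>\<^bsub>?M\<^esub> g) x = f x \<oplus> g x" "\<zero>\<^bsub>?M\<^esub> x = \<zero>" if "x \<in> S 0" for f g x
    using that by (simp_all add: Fun_mod_def)
  have ext: "f = g" if "f \<in> carrier ?M" "g \<in> carrier ?M" "\<And>x. x \<in> S 0 \<Longrightarrow> f x = g x" for f g
    using that by (auto simp: Fun_mod_def intro: extensionalityI)
  have add_mem: "f \<oplus>\<^bsub>?M\<^esub> g \<in> ?E j" if "f \<in> ?E j" "g \<in> ?E j" for f g j
    using that S F_add by (force simp: Fun_filt_def Fun_mod_def subset_iff)
  have zero_mem: "\<zero>\<^bsub>?M\<^esub> \<in> ?E j" for j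
    using S F_zero by (force simp: Fun_filt_def Fun_mod_def)
  have neg_mem: "(\<lambda>x\<in>S 0. \<ominus> f x) \<in> ?E j" if "f \<in> ?E j" for f j
    using that S F_minus by (force simp: Fun_filt_def subset_iff)
  have neg: "(\<lambda>x\<in>S 0. \<ominus> f x) \<oplus>\<^bsub>?M\<^esub> f = \<zero>\<^bsub>?M\<^esub>" if "f \<in> carrier ?M" for f
    using that neg_mem[of f 0] add_mem[of _ 0 f] zero_mem[of 0]
    by (intro ext) (auto simp: E0 valc l_neg)
  interpret M: abelian_group ?M
  proof (rule abelian_groupI)
    fix f g h assume fgh: "f \<in> carrier ?M" "g \<in> carrier ?M" "h \<in> carrier ?M"
    then show "f \<oplus>\<^bsub>?M\<^esub> g \<oplus>\<^bsub>?M\<^esub> h = f \<oplus>\<^bsub>?M\<^esub> (g \<oplus>\<^bsub>?M\<^esub> h)"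
      using add_mem[of _ 0] by (intro ext) (auto simp: E0 valc a_assoc)
    show "f \<oplus>\<^bsub>?M\<^esub> g = g \<oplus>\<^bsub>?M\<^esub> f"
      using fgh add_mem[of _ 0] by (intro ext) (auto simp: E0 valc a_comm)
  next
    fix f assume f: "f \<in> carrier ?M"
    show "\<zero>\<^bsub>?M\<^esub> \<oplus>\<^bsub>?M\<^esub> f = f"
      using f zero_mem[of 0] add_mem[of _ 0] by (intro ext) (auto simp: E0 valc)
    show "\<exists>g\<in>carrier ?M. g \<oplus>\<^bsub>?M\<^esub> f = \<zero>\<^bsub>?M\<^esub>"
      using neg[OF f] neg_mem[of f 0] f by (auto simp: E0)
  qed (use add_mem[of _ 0] zero_mem[of 0] in \<open>auto simp: E0\<close>)
  have inv: "\<ominus>\<^bsub>?M\<^esub> f = (\<lambda>x\<in>S 0. \<ominus> f x)" if "f \<in> carrier ?M" for f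
    using M.minus_equality[OF neg[OF that] that] neg_mem[of f 0] that by (simp add: E0)
  show diff: "(f \<ominus>\<^bsub>?M\<^esub> g) x = f x \<ominus> g x" if "f \<in> carrier ?M" "g \<in> carrier ?M" "x \<in> S 0" for f g x
    using that by (simp add: a_minus_def inv)
  have eval: "(\<lambda>f. f x) \<in> hom (add_monoid ?M) (add_monoid L)" if "x \<in> S 0" for x
    using that valc by (auto simp: hom_def)
  show pow: "(add_pow ?M (a::int) f) x = add_pow L a (f x)" if "f \<in> carrier ?M" "x \<in> S 0" for f x a
    using add_pow_hom[OF M.abelian_group_axioms abelian_group_axioms eval[OF that(2)] that(1)] .
  show "lazard_module ?M ?E"
  proof (intro lazard_module.intro lazard_module_axioms.intro M.abelian_group_axioms E0 ES)
    show "additive_subgroup (?E j) ?M" for j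
    proof (intro additive_subgroup.intro M.add.subgroupI)
      show "\<ominus>\<^bsub>?M\<^esub> f \<in> ?E j" if "f \<in> ?E j" for f
        using neg_mem[OF that] inv[OF subsetD[OF Ej that]] by simp
    qed (use Ej zero_mem[of j] add_mem in auto)
  next
    fix f assume f: "\<And>k. f \<in> ?E k"
    have "f x \<in> F k" if "x \<in> S 0" for x k using val[OF f that, of k] by simp
    then have "f x = \<zero>" if "x \<in> S 0" for x using F_separated that by blast
    then show "f = \<zero>\<^bsub>?M\<^esub>" using f[of 0] zero_mem[of 0] by (intro ext) (auto simp: E0)
  next
    fix s assume s: "\<And>n. s n \<in> carrier ?M" "\<And>n. s (Suc n) \<ominus>\<^bsub>?M\<^esub> s n \<in> ?E n"
    have "\<exists>l\<in>carrier L. \<forall>n. s n x \<ominus> l \<in> F n" if x: "x \<in> S 0" for x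
    proof (rule F_complete)
      show "s (Suc n) x \<ominus> s n x \<in> F n" for n
        using val[OF s(2) x] x s(1) by (simp add: diff)
    qed (use valc s x in auto)
    then obtain l where l: "\<And>x. x \<in> S 0 \<Longrightarrow> l x \<in> carrier L" "\<And>x n. x \<in> S 0 \<Longrightarrow> s n x \<ominus> l x \<in> F n"
      by metis
    \<comment> \<open>Comparison with the member at index \<open>i + n\<close> yields the degree of the source for free.\<close>
    have rate: "s n x \<ominus> l x \<in> F (i + n)" if x: "x \<in> S i" for x i n
    proof -
      have x0: "x \<in> S 0" using x S by auto
      have c: "s m x \<in> carrier L" for m using valc s x0 by auto
      have step: "s n x \<ominus> s m x \<in> F (i + n)" if "n \<le> m" for m
        using that
      proof (induction m rule: dec_induct)
        case base
        then show ?case using c F_zero by (simp add: a_minus_def r_neg)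
      next
        case (step m)
        have "s (Suc m) x \<ominus> s m x \<in> F (i + m)"
          using val[OF s(2) x, of m] x0 s(1) by (simp add: diff)
        then have "s m x \<ominus> s (Suc m) x \<in> F (i + n)"
          using F_diff_sym c F_antimono[of "i + n" "i + m"] step(1) by auto
        then show ?case using F_diff_trans c step by blast
      qed
      show ?thesis
        using F_diff_trans[OF _ _ _ step[of "i + n"] l(2)[OF x0]] c l(1)[OF x0] by simp
    qed
    have lmem: "restrict l (S 0) \<in> carrier ?M"
    proof -
      have "l x \<in> F i" if x: "x \<in> S i" for x i
      proof -
        have x0: "x \<in> S 0" using x S by auto
        have "s 0 x \<in> F i" using s(1)[of 0] x by (auto simp: Fun_mod_def)
        then show ?thesis
          using F_closed[OF l(1)[OF x0], of i] rate[OF x] val[of "s n" 0 x i for n] s(1) x E0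
          by (metis add.right_neutral le_add2 F_antimono subsetD)
      qed
      then show ?thesis using S by (force simp: Fun_mod_def)
    qed
    have "s n \<ominus>\<^bsub>?M\<^esub> restrict l (S 0) \<in> ?E n" for n
    proof -
      have "s n \<ominus>\<^bsub>?M\<^esub> restrict l (S 0) \<in> carrier ?M" using s lmem by simp
      moreover have "(s n \<ominus>\<^bsub>?M\<^esub> restrict l (S 0)) x \<in> F (i + n)" if x: "x \<in> S i" for x i
      proof -
        have x0: "x \<in> S 0" using x S by auto
        show ?thesis using rate[OF x] x0 s lmem by (simp add: diff)
      qed
      ultimately show ?thesis by (auto simp: Fun_filt_def Fun_mod_def)
    qed
    then show "\<exists>l\<in>carrier ?M. \<forall>n. s n \<ominus>\<^bsub>?M\<^esub> l \<in> ?E n" using lmem by blast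
  next
    fix j b f assume j: "1 \<le> j" and b: "smooth j b" and f: "f \<in> ?E j"
    have "\<exists>y. y \<in> F j \<and> add_pow L (int b) y = f x" if "x \<in> S 0" for x
      using F_divisible[OF j b, of "f x"] val[OF f that] by auto
    then obtain g where g: "\<And>x. x \<in> S 0 \<Longrightarrow> g x \<in> F j" "\<And>x. x \<in> S 0 \<Longrightarrow> add_pow L (int b) (g x) = f x"
      by metis
    \<comment> \<open>The quotient in the term \<open>i + j\<close> is also one in the term \<open>j\<close>, where it is unique.\<close>
    have lev: "g x \<in> F (i + j)" if x: "x \<in> S i" for x i
    proof -
      have x0: "x \<in> S 0" using x S by auto
      obtain y where y: "y \<in> F (i + j)" "add_pow L (int b) y = f x"
        using F_divide[OF smooth_mono[OF b] val[OF f x]] by auto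
      then have "y = g x"
        using F_torsion_free[OF b _ g(1)[OF x0], of y] g(2)[OF x0] F_antimono[of j "i + j"] by auto
      then show ?thesis using y by simp
    qed
    let ?g = "restrict g (S 0)"
    have gm: "?g \<in> ?E j" using lev S by (force simp: Fun_filt_def)
    show "\<exists>!y. y \<in> ?E j \<and> add_pow ?M (int b) y = f"
    proof (rule ex1I)
      have gc: "?g \<in> carrier ?M" using gm Ej by blast
      then show "?g \<in> ?E j \<and> add_pow ?M (int b) ?g = f"
        using gm f Ej g by (auto intro!: ext simp: pow M.add.int_pow_closed)
      fix h assume h: "h \<in> ?E j \<and> add_pow ?M (int b) h = f"
      then have hc: "h \<in> carrier ?M" using Ej by blast
      show "h = ?g"
      proof (rule ext[OF hc gc])
        fix x assume x: "x \<in> S 0"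
        have "add_pow L (int b) (h x) = f x" using h pow[OF hc x] by auto
        then show "h x = ?g x"
          using F_torsion_free[OF b _ g(1)[OF x], of "h x"] g(2)[OF x] val[of h j x 0] h x by simp
      qed
    qed
  qed
qed

end

section \<open>The endomorphism ring of a Lazard module\<close>

context lazard_module
begin

abbreviation (input) "EE \<equiv> End_ring L F"
abbreviation (input) "EF \<equiv> End_filt L F"

abbreviation (input) End_times (infixl "\<star>" 70) where "f \<star> g \<equiv> f \<otimes>\<^bsub>EE\<^esub> g"
abbreviation (input) End_plus (infixl "\<boxplus>" 65) where "f \<boxplus> g \<equiv> f \<oplus>\<^bsub>EE\<^esub> g"
abbreviation (input) End_minus (infixl "\<boxminus>" 65) where "f \<boxminus> g \<equiv> f \<ominus>\<^bsub>EE\<^esub> g"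
abbreviation (input) End_one ("\<one>\<^sub>E") where "\<one>\<^sub>E \<equiv> \<one>\<^bsub>EE\<^esub>"
abbreviation (input) End_zero ("\<zero>\<^sub>E") where "\<zero>\<^sub>E \<equiv> \<zero>\<^bsub>EE\<^esub>"

lemma End_filt_iff:
  "f \<in> EF j \<longleftrightarrow> f \<in> extensional (carrier L) \<and>
     (\<forall>x\<in>carrier L. \<forall>y\<in>carrier L. f (x \<oplus> y) = f x \<oplus> f y) \<and> (\<forall>i. f ` F i \<subseteq> F (i + j))"
proof
  assume "f \<in> EF j"
  then show "f \<in> extensional (carrier L) \<and>
     (\<forall>x\<in>carrier L. \<forall>y\<in>carrier L. f (x \<oplus> y) = f x \<oplus> f y) \<and> (\<forall>i. f ` F i \<subseteq> F (i + j))"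
    by (simp add: End_filt_def End_ring_def hom_def)
next
  assume f: "f \<in> extensional (carrier L) \<and>
     (\<forall>x\<in>carrier L. \<forall>y\<in>carrier L. f (x \<oplus> y) = f x \<oplus> f y) \<and> (\<forall>i. f ` F i \<subseteq> F (i + j))"
  have le: "f ` F i \<subseteq> F i" for i
    using order_trans[OF f[THEN conjunct2, THEN conjunct2, rule_format] F_antimono[OF le_add1]] .
  have "f \<in> carrier L \<rightarrow> carrier L" using le[of 0] by (auto simp: F_0)
  then show "f \<in> EF j"
    using f le by (simp add: End_filt_def End_ring_def hom_def)
qed

lemma End_filt_0: "EF 0 = carrier EE"
  by (auto simp: End_filt_def End_ring_def)

lemma End_filt_carrier: "f \<in> EF j \<Longrightarrow> f \<in> carrier EE"
  by (simp add: End_filt_def)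

lemma End_simps [simp]:
  "x \<in> carrier L \<Longrightarrow> (f \<boxplus> g) x = f x \<oplus> g x"
  "x \<in> carrier L \<Longrightarrow> (f \<star> g) x = f (g x)"
  "x \<in> carrier L \<Longrightarrow> \<zero>\<^sub>E x = \<zero>"
  "x \<in> carrier L \<Longrightarrow> \<one>\<^sub>E x = x"
  by (simp_all add: End_ring_def compose_def)

lemma End_val: "f \<in> EF j \<Longrightarrow> x \<in> F i \<Longrightarrow> f x \<in> F (i + j)"
  by (auto simp: End_filt_def)

lemma End_closed: "f \<in> carrier EE \<Longrightarrow> x \<in> carrier L \<Longrightarrow> f x \<in> carrier L"
  by (auto simp: End_ring_def hom_def)

lemma End_add: "f \<in> carrier EE \<Longrightarrow> x \<in> carrier L \<Longrightarrow> y \<in> carrier L \<Longrightarrow> f (x \<oplus> y) = f x \<oplus> f y"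
  by (auto simp: End_ring_def hom_def)

lemma End_hom: "f \<in> carrier EE \<Longrightarrow> f \<in> hom (add_monoid L) (add_monoid L)"
  by (simp add: End_ring_def)

lemma End_ext:
  "f \<in> carrier EE \<Longrightarrow> g \<in> carrier EE \<Longrightarrow>
   (\<And>x. x \<in> carrier L \<Longrightarrow> f x = g x) \<Longrightarrow> f = g"
  by (auto simp: End_ring_def intro: extensionalityI)

text \<open>
  The form in which separatedness is used: two elements that are approximated by the same elements
  are equal. It transfers equations to limits.
\<close>

lemma F_eq_if_close:
  assumes "a \<in> carrier L" "b \<in> carrier L" "\<And>N. \<exists>c\<in>carrier L. a \<ominus> c \<in> F N \<and> b \<ominus> c \<in> F N"
  shows "a = b"
proof (rule F_eqI[OF assms(1,2)])
  fix k
  obtain c where "c \<in> carrier L" "a \<ominus> c \<in> F k" "b \<ominus> c \<in> F k" using assms(3) by blast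
  then show "a \<ominus> b \<in> F k"
    using F_diff_trans[of a c b k] F_diff_sym[of b c k] assms by blast
qed

text \<open>
  Additivity passes to pointwise limits by continuity and to quotients by unique divisibility.
\<close>

lemma End_module: "lazard_module EE EF"
proof -
  let ?M = "Fun_mod L F F" and ?E = "Fun_filt L F F"
  let ?X = "carrier EE"
  have S: "F i \<subseteq> F 0" for i using F_antimono by simp
  interpret M: lazard_module ?M ?E by (rule Fun_mod_module(1)[where S = F, OF S])
  have XM: "?X \<subseteq> carrier ?M"
    by (auto simp: End_ring_def Fun_mod_def F_0)
  have XI: "f \<in> ?X" if "f \<in> carrier ?M" "\<And>x y. x \<in> carrier L \<Longrightarrow> y \<in> carrier L \<Longrightarrow> f (x \<oplus> y) = f x \<oplus> f y" for f
  proof -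
    have "f x \<in> carrier L" if "x \<in> carrier L" for x
      using \<open>f \<in> carrier ?M\<close> that F_0 by (force simp: Fun_mod_def)
    then show ?thesis using that by (simp add: End_ring_def Fun_mod_def hom_def F_0)
  qed
  have Madd: "(f \<oplus>\<^bsub>?M\<^esub> g) x = f x \<oplus> g x" if "x \<in> carrier L" for f g x
    using that by (simp add: Fun_mod_def F_0)
  have neg: "(\<ominus>\<^bsub>?M\<^esub> f) x = \<ominus> f x" if "f \<in> carrier ?M" "x \<in> carrier L" for f x
  proof -
    have "f x \<in> carrier L" "(\<ominus>\<^bsub>?M\<^esub> f) x \<in> carrier L"
      using that M.a_inv_closed[OF that(1)] F_0 by (force simp: Fun_mod_def)+
    moreover have "(\<ominus>\<^bsub>?M\<^esub> f) x \<oplus> f x = \<zero>"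
    proof -
      have "\<zero>\<^bsub>?M\<^esub> x = \<zero>" using that(2) by (simp add: Fun_mod_def F_0)
      then show ?thesis
        using Madd[OF that(2), of "\<ominus>\<^bsub>?M\<^esub> f" f] M.l_neg[OF that(1)] by simp
    qed
    ultimately show ?thesis by (simp add: minus_equality)
  qed
  have X: "additive_subgroup ?X ?M"
  proof (intro additive_subgroup.intro M.add.subgroupI)
    have "\<zero>\<^bsub>?M\<^esub> \<in> ?X" by (rule XI) (auto simp: Fun_mod_def F_0 F_zero dest: F_carrier)
    then show "?X \<noteq> {}" by auto
    show "\<ominus>\<^bsub>?M\<^esub> f \<in> ?X" if f: "f \<in> ?X" for f
      using f XM by (intro XI) (auto simp: neg End_add End_closed minus_add)
    show "f \<oplus>\<^bsub>?M\<^esub> g \<in> ?X" if f: "f \<in> ?X" "g \<in> ?X" for f g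
      using f XM by (intro XI) (auto simp: Madd End_add End_closed a_ac)
  qed (use XM in auto)
  show ?thesis
  proof (rule lazard_submodule[OF Fun_mod_module(1)[where S = F, OF S] X])
    show "\<zero>\<^sub>E = \<zero>\<^bsub>?M\<^esub>" "add EE = add ?M"
      by (simp_all add: End_ring_def Fun_mod_def F_0)
    show "EF i = ?X \<inter> ?E i" for i
      by (auto simp: End_filt_def Fun_filt_def End_ring_def F_0)
  next
    fix f assume f: "f \<in> carrier ?M" and lim: "\<And>N. \<exists>g\<in>?X. g \<ominus>\<^bsub>?M\<^esub> f \<in> ?E N"
    have fc: "f x \<in> carrier L" if "x \<in> carrier L" for x
      using f that F_0 by (force simp: Fun_mod_def)
    show "f \<in> ?X"
    proof (rule XI[OF f])
      fix x y assume x: "x \<in> carrier L" and y: "y \<in> carrier L"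
      show "f (x \<oplus> y) = f x \<oplus> f y"
      proof (rule F_eq_if_close)
        fix N
        obtain g where g: "g \<in> ?X" "g \<ominus>\<^bsub>?M\<^esub> f \<in> ?E N" using lim by blast
        have d: "g z \<ominus> f z \<in> F N" if "z \<in> carrier L" for z
        proof -
          have "(g \<ominus>\<^bsub>?M\<^esub> f) z \<in> F (0 + N)" using g(2) that F_0 unfolding Fun_filt_def by blast
          moreover have "(g \<ominus>\<^bsub>?M\<^esub> f) z = g z \<ominus> f z"
            using Fun_mod_module(2)[where S = F, OF S, of g f z] g(1) XM f that F_0 by auto
          ultimately show ?thesis by simp
        qed
        have d': "f z \<ominus> g z \<in> F N" if "z \<in> carrier L" for z
          using F_diff_sym[OF End_closed[OF g(1) that] fc[OF that] d[OF that]] .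
        have "f (x \<oplus> y) \<ominus> g (x \<oplus> y) \<in> F N" using x y by (simp add: d')
        moreover have "(f x \<oplus> f y) \<ominus> g (x \<oplus> y) \<in> F N"
          using x y d' diff_add_F[of "f x" "f y" "g x" "g y" N] End_closed[OF g(1)] End_add[OF g(1)] fc by simp_all
        ultimately show "\<exists>c\<in>carrier L. f (x \<oplus> y) \<ominus> c \<in> F N \<and> f x \<oplus> f y \<ominus> c \<in> F N"
          using End_closed[OF g(1)] x y by blast
      qed (use x y fc in auto)
    qed
  next
    fix i b f assume i: "1 \<le> i" "smooth i b" and f: "f \<in> ?E i" and bf: "add_pow ?M (int b) f \<in> ?X"
    have fM: "f \<in> carrier ?M" using f M.F_carrier by blast
    have fF: "f x \<in> F i" if "x \<in> carrier L" for x
      using f that F_0 by (force simp: Fun_filt_def)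
    show "f \<in> ?X"
    proof (rule XI[OF fM])
      fix x y assume xy: "x \<in> carrier L" "y \<in> carrier L"
      have p: "add_pow L (int b) (f z) = add_pow ?M (int b) f z" if "z \<in> carrier L" for z
        using Fun_mod_module(3)[where S = F, OF S, of f z "int b"] fM that F_0 by simp
      have "add_pow L (int b) (f (x \<oplus> y)) = add_pow L (int b) (f x \<oplus> f y)"
        using xy fF[THEN F_carrier] by (simp add: p End_add[OF bf] add.int_pow_distrib)
      then show "f (x \<oplus> y) = f x \<oplus> f y"
        using F_torsion_free[OF i(2)] fF xy F_add by simp
    qed
  qed simp
qed

lemma End_val_minus:
  assumes f: "f \<in> carrier EE" and x: "x \<in> carrier L"
  shows "(\<ominus>\<^bsub>EE\<^esub> f) x = \<ominus> f x"
proof -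
  interpret E: lazard_module "EE" "EF" by (rule End_module)
  have "(\<ominus>\<^bsub>EE\<^esub> f) x \<oplus> f x = \<zero>"
    using E.l_neg[OF f] End_simps(1)[OF x, of "\<ominus>\<^bsub>EE\<^esub> f" f] x by simp
  then show ?thesis
    using minus_equality[of "(\<ominus>\<^bsub>EE\<^esub> f) x" "f x"] f x by (simp add: End_closed)
qed

lemma End_val_diff:
  assumes "f \<in> carrier EE" "g \<in> carrier EE" "x \<in> carrier L"
  shows "(f \<boxminus> g) x = f x \<ominus> g x"
  using assms by (simp add: a_minus_def End_val_minus)

lemma End_val_pow:
  assumes "f \<in> carrier EE" "x \<in> carrier L"
  shows "(add_pow EE (a::int) f) x = add_pow L a (f x)"
proof -
  interpret E: lazard_module "EE" "EF" by (rule End_module)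
  show ?thesis
    by (rule add_pow_hom[OF E.abelian_group_axioms abelian_group_axioms, of "\<lambda>f. f x"])
      (use assms End_closed in \<open>auto simp: hom_def\<close>)
qed

lemma End_mult_filt:
  assumes "f \<in> EF i" "g \<in> EF j"
  shows "f \<star> g \<in> EF (i + j)"
proof -
  have f: "f \<in> carrier EE" and g: "g \<in> carrier EE"
    using assms End_filt_carrier by auto
  have "f (g x) \<in> F (k + (i + j))" if "x \<in> F k" for x k
    using End_val[OF assms(1) End_val[OF assms(2) that]] by (simp add: ac_simps)
  then show ?thesis
    unfolding End_filt_iff using f g F_carrier
    by (auto simp: End_add End_closed) (simp add: End_ring_def)
qed

lemma End_ring: "ring EE"
proof (rule ringI)
  interpret E: lazard_module "EE" "EF" by (rule End_module)
  show "abelian_group EE" ..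
  have mc: "f \<star> g \<in> carrier EE"
    if "f \<in> carrier EE" "g \<in> carrier EE" for f g
    using End_mult_filt[of f 0 g 0] that by (simp add: End_filt_0)
  have one: "\<one>\<^sub>E \<in> carrier EE"
    using F_carrier by (auto simp: End_ring_def hom_def)
  show "monoid EE"
    by (rule monoidI) (auto intro!: mc one End_ext simp: End_closed)
  show "(f \<boxplus> g) \<star> h =
      f \<star> h \<boxplus> g \<star> h"
    "h \<star> (f \<boxplus> g) =
      h \<star> f \<boxplus> h \<star> g"
    if "f \<in> carrier EE" "g \<in> carrier EE" "h \<in> carrier EE" for f g h
    using that by (auto intro!: mc E.a_closed End_ext simp: End_closed End_add)
qed

end

section \<open>Evaluation of noncommutative power series at endomorphisms\<close>

context lazard_module
begin

text \<open>
  Evaluation of a series at \<open>X = d\<close>, \<open>Y = e\<close>.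
\<close>

definition ev :: "('a \<Rightarrow> 'a) \<Rightarrow> ('a \<Rightarrow> 'a) \<Rightarrow> ncs \<Rightarrow> 'a \<Rightarrow> 'a" where
  "ev d e f = (\<lambda>x\<in>carrier L. ser f (\<lambda>w. word_op d e w x))"

lemma End_filt_antimono: "i \<le> j \<Longrightarrow> EF j \<subseteq> EF i"
  using lazard_module.F_antimono[OF End_module] .

lemma word_op_mem:
  assumes "d \<in> EF i" "e \<in> EF i" "x \<in> F k"
  shows "word_op d e w x \<in> F (k + i * length w)"
proof (induction w)
  case (Cons b w)
  have "(if b then d else e) \<in> EF i" using assms by simp
  from End_val[OF this Cons] show ?case by (simp add: ac_simps)
qed (use assms in simp)

lemma word_op_carrier:
  "d \<in> EF i \<Longrightarrow> e \<in> EF i \<Longrightarrow> x \<in> carrier L \<Longrightarrow> word_op d e w x \<in> carrier L"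
  using word_op_mem[of d i e x 0 w] F_carrier by (simp add: F_0)

lemma word_op_add:
  assumes "d \<in> EF i" "e \<in> EF i" "x \<in> carrier L" "y \<in> carrier L"
  shows "word_op d e w (x \<oplus> y) = word_op d e w x \<oplus> word_op d e w y"
proof (induction w)
  case (Cons b w)
  have "(if b then d else e) \<in> carrier EE" using assms End_filt_carrier by auto
  then show ?case using Cons word_op_carrier[OF assms(1,2)] assms(3,4) by (simp add: End_add)
qed simp

lemma adm_word_op:
  assumes "d \<in> EF i" "e \<in> EF i" "1 \<le> i" "x \<in> carrier L"
  shows "adm (\<lambda>w. word_op d e w x)"
  unfolding adm_def
proof
  fix w
  have "word_op d e w x \<in> F (0 + i * length w)" using word_op_mem[OF assms(1,2), of x 0 w] assms(4) by (simp only: F_0)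
  moreover have "length w \<le> 0 + i * length w" using assms(3) by simp
  ultimately show "word_op d e w x \<in> F (length w)" using F_antimono by blast
qed

lemma ev_filt:
  assumes de: "d \<in> EF i" "e \<in> EF i" "1 \<le> i" and f: "integ f" "ordge m f"
  shows "ev d e f \<in> EF (i * m)"
  unfolding End_filt_iff
proof (intro conjI ballI allI)
  show "ev d e f \<in> extensional (carrier L)" by (simp add: ev_def)
  fix x y assume xy: "x \<in> carrier L" "y \<in> carrier L"
  show "ev d e f (x \<oplus> y) = ev d e f x \<oplus> ev d e f y"
    using xy de f by (simp add: ev_def word_op_add ser_add_right adm_word_op)
next
  fix k
  show "ev d e f ` F k \<subseteq> F (k + i * m)"
  proof
    fix y assume "y \<in> ev d e f ` F k"
    then obtain x where x: "x \<in> F k" and y: "y = ev d e f x" by blast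
    have "word_op d e w x \<in> F (k + i * m)" if "cf f w \<noteq> 0" for w
    proof -
      have "m \<le> length w" using that f(2) by (auto simp: ordge_def not_less[symmetric])
      then have "k + i * m \<le> k + i * length w" by simp
      then show ?thesis using word_op_mem[OF de(1,2) x] F_antimono by blast
    qed
    then show "y \<in> F (k + i * m)"
      using F_carrier[OF x] f(1) de by (simp add: y ev_def ser_mem adm_word_op)
  qed
qed

lemma ev_carrier:
  "d \<in> EF i \<Longrightarrow> e \<in> EF i \<Longrightarrow> 1 \<le> i \<Longrightarrow> integ f \<Longrightarrow> ev d e f \<in> carrier EE"
  using ev_filt[of d i e f 0] by (simp add: End_filt_0)

lemma ev_filt_1:
  "d \<in> EF i \<Longrightarrow> e \<in> EF i \<Longrightarrow> 1 \<le> i \<Longrightarrow> integ f \<Longrightarrow> ordge 1 f \<Longrightarrow> ev d e f \<in> EF i"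
  using ev_filt[of d i e f 1] by simp

end

locale lazard_module_pair = lazard_module L F for L (structure) and F +
  fixes d e :: "'a \<Rightarrow> 'a" and i :: nat
  assumes d: "d \<in> End_filt L F i" and e: "e \<in> End_filt L F i" and i: "1 \<le> i"
begin

lemmas dei = d e i

interpretation E: lazard_module "End_ring L F" "End_filt L F" by (rule End_module)
interpretation R: ring "End_ring L F" by (rule End_ring)

abbreviation (input) "V \<equiv> ev d e"

lemma V_closed [intro, simp]: "integ f \<Longrightarrow> V f \<in> carrier EE"
  using ev_carrier[OF dei] .

lemma V_filt: "integ f \<Longrightarrow> ordge m f \<Longrightarrow> V f \<in> EF m"
proof -
  assume "integ f" "ordge m f"
  then have "V f \<in> EF (i * m)" by (rule ev_filt[OF dei])
  moreover have "m \<le> i * m" using i by simp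
  ultimately show ?thesis using End_filt_antimono by blast
qed

lemma V_add: "integ f \<Longrightarrow> integ g \<Longrightarrow> V (f + g) = V f \<boxplus> V g"
  by (intro End_ext E.a_closed V_closed integ_add)
     (auto simp: ev_def ser_add_left adm_word_op[OF dei])

lemma V_zero: "V 0 = \<zero>\<^sub>E"
  using V_add[of 0 0] V_closed[of 0] by (simp add: E.add.l_cancel_one')

lemma V_uminus: "integ f \<Longrightarrow> V (- f) = \<ominus>\<^bsub>EE\<^esub> V f"
  using V_add[of "- f" f] by (intro E.minus_equality[symmetric]) (auto simp: V_zero integ_uminus)

lemma V_diff: "integ f \<Longrightarrow> integ g \<Longrightarrow> V (f - g) = V f \<boxminus> V g"
  using V_add[of f "- g"] by (simp add: V_uminus integ_uminus a_minus_def)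

lemma V_approx: "integ f \<Longrightarrow> integ g \<Longrightarrow> ordge m (f - g) \<Longrightarrow> V f \<boxminus> V g \<in> EF m"
  using V_filt[of "f - g" m] by (simp add: V_diff integ_diff)

lemma V_sum: "finite A \<Longrightarrow> (\<And>a. a \<in> A \<Longrightarrow> integ (f a)) \<Longrightarrow>
  V (\<Sum>a\<in>A. f a) = finsum EE (\<lambda>a. V (f a)) A"
proof (induction A rule: finite_induct)
  case (insert a A)
  then have "V (\<Sum>a\<in>insert a A. f a) = V (f a) \<boxplus> finsum EE (\<lambda>a. V (f a)) A"
    by (simp add: V_add integ_sum)
  then show ?case using insert by (simp add: Pi_iff)
qed (simp add: V_zero)

lemma V_monomial: "q \<in> fractions (length w) \<Longrightarrow> x \<in> carrier L \<Longrightarrow> V (monomial q w) x = scale (length w) q (word_op d e w x)"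
  by (simp add: ev_def ser_monomial adm_word_op[OF dei])

lemma word_op_F: "x \<in> F k \<Longrightarrow> word_op d e w x \<in> F (length w + k)"
proof -
  assume "x \<in> F k"
  then have "word_op d e w x \<in> F (k + i * length w)" by (rule word_op_mem[OF d e])
  moreover have "length w + k \<le> k + i * length w" using i by simp
  ultimately show ?thesis using F_antimono by blast
qed

lemma word_op_image: "word_op d e w ` F k \<subseteq> F k"
  using word_op_F[THEN subsetD[OF F_antimono[OF le_add2]]] by blast

lemma word_op_hom: "word_op d e w \<in> hom (add_monoid L) (add_monoid L)"
  using word_op_carrier[OF d e] word_op_add[OF d e] by (auto simp: hom_def)

lemma V_monomial_mult:
  assumes q: "q \<in> fractions (length w)" and r: "r \<in> fractions (length v)"
  shows "V (monomial q w * monomial r v) = V (monomial q w) \<star> V (monomial r v)"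
proof -
  have qr: "q * r \<in> fractions (length (w @ v))"
    using q r fractions_mono[of q _ "length (w @ v)"] fractions_mono[of r _ "length (w @ v)"] by (intro fractions_mult) auto
  have lm: "lazard_module L F" ..
  show ?thesis
    unfolding monomial_mult
  proof (rule End_ext)
    fix x assume x: "x \<in> carrier L"
    have vx: "word_op d e v x \<in> F (length v)" using word_op_F[of x 0 v] x F_0 by simp
    have sv: "scale (length v) r (word_op d e v x) \<in> F (length v)" by (rule scale_mem[OF r vx])
    have "V (monomial q w) (V (monomial r v) x) = scale (length w) q (word_op d e w (scale (length v) r (word_op d e v x)))"
      using V_monomial[OF q F_carrier[OF sv]] by (simp add: V_monomial r x)
    also have "word_op d e w (scale (length v) r (word_op d e v x)) = scale (length v) r (word_op d e w (word_op d e v x))"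
      by (rule scale_hom[OF lm lm word_op_hom word_op_image r vx])
    also have "scale (length w) q (scale (length v) r (word_op d e w (word_op d e v x))) =
        scale (length w + length v) (q * r) (word_op d e w (word_op d e v x))"
      using word_op_F[OF vx, of w] by (intro scale_mult q r)
    finally show "V (monomial (q * r) (w @ v)) x = (V (monomial q w) \<star> V (monomial r v)) x"
      using V_monomial[OF qr x] x by (simp add: word_op_append)
  qed (use q r qr integ_monomial in auto)
qed

text \<open>
  Both sides are biadditive, so the claim for monomials (\<open>V_monomial_mult\<close>) gives it for truncations.
  Replacing the series by their truncations of order \<open>N\<close> changes both sides only by elements of the
  \<open>N\<close>-th term.
\<close>

lemma V_mult:
  assumes f: "integ f" and g: "integ g"
  shows "V (f * g) = V f \<star> V g"
proof -
  define tr where "tr N f = (\<Sum>w\<in>{w. length w < N}. monomial (cf f w) w)" for N and f :: ncs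
  have tr_integ: "integ (tr N f)" if "integ f" for N f
    unfolding tr_def by (intro integ_sum integ_monomial integD that)
  have step1: "V (monomial q w * tr N g) = V (monomial q w) \<star> V (tr N g)" if "q \<in> fractions (length w)" for q w N
  proof -
    have m: "integ (monomial (cf g v) v)" for v using g by (auto simp: integD integ_monomial)
    have "V (monomial q w * tr N g) = (\<Oplus>\<^bsub>EE\<^esub>v\<in>{v. length v < N}. V (monomial q w * monomial (cf g v) v))"
      unfolding tr_def sum_distrib_left
      by (rule V_sum) (auto intro!: finite_short_words integ_mult m integ_monomial that)
    also have "\<dots> = (\<Oplus>\<^bsub>EE\<^esub>v\<in>{v. length v < N}. V (monomial q w) \<star> V (monomial (cf g v) v))"
      using that integD[OF g] m integ_monomial[OF that]
      by (intro E.finsum_cong') (auto simp: V_monomial_mult)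
    also have "\<dots> = V (monomial q w) \<star> V (tr N g)"
      unfolding tr_def using m integ_monomial[OF that]
      by (subst V_sum) (auto simp: finite_short_words R.finsum_rdistr intro!: R.finsum_rdistr[symmetric])
    finally show ?thesis .
  qed
  have step2: "V (tr N f * tr N g) = V (tr N f) \<star> V (tr N g)" for N
  proof -
    have m: "integ (monomial (cf f v) v)" for v using f by (auto simp: integD integ_monomial)
    have t: "integ (tr N g)" using g by (rule tr_integ)
    have "V (tr N f * tr N g) = (\<Oplus>\<^bsub>EE\<^esub>v\<in>{v. length v < N}. V (monomial (cf f v) v * tr N g))"
      unfolding tr_def[of N f] sum_distrib_right
      by (rule V_sum) (auto intro!: finite_short_words integ_mult m t)
    also have "\<dots> = (\<Oplus>\<^bsub>EE\<^esub>v\<in>{v. length v < N}. V (monomial (cf f v) v) \<star> V (tr N g))"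
      using integD[OF f] m t
      by (intro E.finsum_cong') (auto simp: step1)
    also have "\<dots> = V (tr N f) \<star> V (tr N g)"
      unfolding tr_def[of N f] using m t
      by (subst V_sum) (auto simp: finite_short_words intro!: R.finsum_ldistr[symmetric])
    finally show ?thesis .
  qed
  show ?thesis
  proof (rule E.F_eq_if_close)
    fix N
    let ?f = "tr N f" and ?g = "tr N g"
    have tf: "integ ?f" and tg: "integ ?g" using f g tr_integ by auto
    have of: "ordge N (f - ?f)" and og: "ordge N (g - ?g)" by (auto simp: tr_def trunc_approx)
    have "f * g - ?f * ?g = (f - ?f) * g + ?f * (g - ?g)" by (simp add: algebra_simps)
    moreover have "ordge N ((f - ?f) * g)" "ordge N (?f * (g - ?g))"
      using ordge_mult[OF of, of 0 g] ordge_mult[OF _ og, of 0 ?f] by auto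
    ultimately have "ordge N (f * g - ?f * ?g)" by (simp add: ordge_add)
    then have 1: "V (f * g) \<boxminus> V (?f * ?g) \<in> EF N"
      using f g tf tg by (intro V_approx integ_mult)
    have "V f \<star> V g \<boxminus> V ?f \<star> V ?g =
        (V f \<boxminus> V ?f) \<star> V g \<boxplus> V ?f \<star> (V g \<boxminus> V ?g)"
      using f g tf tg by (simp add: a_minus_def R.l_distr R.r_distr R.l_minus R.r_minus E.a_ac E.r_neg1 E.r_neg2)
    moreover have "(V f \<boxminus> V ?f) \<star> V g \<in> EF N" "V ?f \<star> (V g \<boxminus> V ?g) \<in> EF N"
      using End_mult_filt[OF V_approx[OF f tf of], of "V g" 0] End_mult_filt[OF _ V_approx[OF g tg og], of "V ?f" 0]
        f tf g by (auto simp: End_filt_0)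
    ultimately have "V f \<star> V g \<boxminus> V ?f \<star> V ?g \<in> EF N"
      by (simp add: E.F_add)
    then show "\<exists>c\<in>carrier EE. V (f * g) \<boxminus> c \<in> EF N \<and> V f \<star> V g \<boxminus> c \<in> EF N"
      using 1 step2[of N] tf tg by (intro bexI[of _ "V (?f * ?g)"]) (auto intro: integ_mult)
  qed (use f g in \<open>auto intro: integ_mult\<close>)
qed

lemma V_one: "V 1 = \<one>\<^sub>E"
proof (rule End_ext)
  have eq: "1 = monomial 1 []" by (rule ncs_eqI) (simp add: cf_one cf_monomial)
  show "V 1 x = \<one>\<^sub>E x" if "x \<in> carrier L" for x
    unfolding eq using that F_0 by (simp add: V_monomial scale_one)
qed auto

lemma V_letter: "V (letter b) = (if b then d else e)"
proof (rule End_ext)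
  have eq: "letter b = monomial 1 [b]" by (rule ncs_eqI) (simp add: letter_def cf_monomial)
  show "V (letter b) x = (if b then d else e) x" if "x \<in> carrier L" for x
    unfolding eq using that word_op_F[of x 0 "[b]"] F_0 by (simp add: V_monomial scale_one)
qed (use d e End_filt_carrier in auto)

lemma V_power: "integ f \<Longrightarrow> V (f ^ n) = V f [^]\<^bsub>EE\<^esub> n"
proof (induction n)
  case (Suc n)
  have "f ^ Suc n = f ^ n * f" by (simp add: power_commutes)
  then show ?case using Suc by (simp add: V_mult integ_power)
qed (simp add: V_one)

lemma V_scale_nat: "integ f \<Longrightarrow> V (real n *\<^sub>R f) = add_pow EE (int n) (V f)"
proof (induction n)
  case 0
  have "add_pow EE (0::int) (V f) = \<zero>\<^sub>E" by (simp add: add_pow_def)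
  then show ?case by (simp add: V_zero)
next
  case (Suc n)
  have i: "integ (real n *\<^sub>R f)" using integ_scale_int[OF Suc.prems, of "int n"] by simp
  have "V (real (Suc n) *\<^sub>R f) = V (real n *\<^sub>R f) \<boxplus> V f"
    using V_add[OF i Suc.prems] by (simp add: algebra_simps)
  also have "\<dots> = add_pow EE (int n + 1) (V f)"
    using Suc by (simp add: E.add.int_pow_mult)
  finally show ?case by (simp add: add.commute)
qed

lemma V_scale_int: "integ f \<Longrightarrow> V (real_of_int a *\<^sub>R f) = add_pow EE a (V f)"
proof (cases a rule: int_cases2)
  case (nonpos n)
  assume f: "integ f"
  have "integ (real n *\<^sub>R f)" using integ_scale_int[OF f, of "int n"] by simp
  then have "V (real_of_int a *\<^sub>R f) = \<ominus>\<^bsub>EE\<^esub> add_pow EE (int n) (V f)"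
    using f nonpos V_uminus[of "real n *\<^sub>R f"] by (simp add: V_scale_nat)
  then show ?thesis using nonpos f by (simp add: E.add.int_pow_neg)
qed (use V_scale_nat in simp)

lemma V_scale:
  assumes f: "integ f" "ordge m f" and b: "smooth m b" "q * real b = real_of_int a"
  shows "add_pow EE (int b) (V (q *\<^sub>R f)) = add_pow EE a (V f)" "V (q *\<^sub>R f) \<in> EF m" "integ (q *\<^sub>R f)"
proof -
  show q: "integ (q *\<^sub>R f)" using integ_scale[OF f fractionsI[OF b]] .
  have "real b *\<^sub>R q *\<^sub>R f = real_of_int a *\<^sub>R f" by (simp flip: b(2) add: mult.commute)
  then show "add_pow EE (int b) (V (q *\<^sub>R f)) = add_pow EE a (V f)"
    using V_scale_nat[OF q, of b] V_scale_int[OF f(1), of a] by metis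
  show "V (q *\<^sub>R f) \<in> EF m" using V_filt[OF q] f(2) by (simp add: ordge_scale)
qed

text \<open>
  The roots in the definitions of \<open>exp_End\<close> and \<open>bch_term\<close> are values of series.
\<close>

lemma V_root:
  assumes f: "integ f" "ordge m f" and b: "smooth m b"
  shows "filt_root (add_monoid EE) EF m b (V f) = V ((1 / real b) *\<^sub>R f)"
  unfolding filt_root_def
proof (rule the_equality)
  let ?g = "(1 / real b) *\<^sub>R f"
  have ab: "(1 / real b) * real b = real_of_int 1" using smooth_pos[OF b] by simp
  note g = V_scale[OF f b ab]
  have p: "y [^]\<^bsub>add_monoid EE\<^esub> b = add_pow EE (int b) y" for y
    by (simp add: add_pow_def int_pow_int)
  show 1: "V ?g \<in> EF m \<and> V ?g [^]\<^bsub>add_monoid EE\<^esub> b = V f"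
    unfolding p using g f by simp
  fix y assume "y \<in> EF m \<and> y [^]\<^bsub>add_monoid EE\<^esub> b = V f"
  then show "y = V ?g"
    using 1 E.F_torsion_free[OF b, of y "V ?g"] unfolding p by simp
qed

lemma subst_approx: "ordge 1 u \<Longrightarrow> ordge (Suc N) (subst c u - (\<Sum>m\<le>N. fps_nth c m *\<^sub>R u ^ m))"
  using act_approx[of "(*) u" N c 1] by (simp add: subst_def raising_left_mult left_mult_funpow)

text \<open>
  The partial sums of \<open>exp_End\<close> are the values of the partial sums of the exponential series, which
  converge in order.
\<close>

lemma exp_End_V:
  assumes g: "integ g" "ordge 1 g"
  shows "exp_End L F (V g) = V (nexp g)"
  unfolding exp_End_def
proof (rule E.filt_lim_add)
  let ?r = "\<lambda>m. filt_root (add_monoid EE) EF m (fact m) (V g [^]\<^bsub>EE\<^esub> m)"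
  let ?h = "\<lambda>m. (1 / fact m) *\<^sub>R g ^ m"
  have h: "integ (?h m)" "?r m = V (?h m)" for m
    using V_root[OF integ_power[OF g(1)] ordge_power[OF g(2)] smooth_fact[OF order_refl], of m]
      integ_scale[OF integ_power[OF g(1)] ordge_power[OF g(2)] fractions_inverse[OF smooth_fact[OF order_refl]], of m]
    by (simp_all add: V_power g)
  have s: "(\<Oplus>\<^bsub>EE\<^esub>m\<in>{..N}. ?r m) = V (\<Sum>m\<le>N. ?h m)" for N
    using V_sum[of "{..N}" ?h] h by simp
  show "(\<Oplus>\<^bsub>EE\<^esub>m\<in>{..N}. ?r m) \<in> carrier EE" for N
    unfolding s using h by (intro V_closed integ_sum)
  have n: "integ (nexp g)" using g by (simp add: integ_nexp)
  then show "V (nexp g) \<in> carrier EE" by simp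
  fix k
  have "(\<Oplus>\<^bsub>EE\<^esub>m\<in>{..N}. ?r m) \<boxminus> V (nexp g) \<in> EF k" if "k \<le> N" for N
  proof -
    have "ordge (Suc N) ((\<Sum>m\<le>N. ?h m) - nexp g)"
      using ordge_uminus[OF subst_approx[OF g(2), of N "fps_exp 1"]] by (simp add: nexp_def)
    then have "ordge k ((\<Sum>m\<le>N. ?h m) - nexp g)" using that by (auto intro: ordge_mono)
    then show ?thesis unfolding s using h n by (intro V_approx integ_sum)
  qed
  then show "\<exists>N. \<forall>n\<ge>N. (\<Oplus>\<^bsub>EE\<^esub>m\<in>{..n}. ?r m) \<boxminus> V (nexp g) \<in> EF k" by blast
qed

end

subsection \<open>The homogeneous components of the Baker--Campbell--Hausdorff series\<close>

abbreviation "ncX \<equiv> letter True"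
abbreviation "ncY \<equiv> letter False"

text \<open>
  The integer by which \<open>bch_term\<close> divides a nested bracket.
\<close>

definition bch_divisor :: "nat \<Rightarrow> (nat \<times> nat) list \<Rightarrow> nat" where
  "bch_divisor n ps = n * length ps * (\<Prod>(r, s)\<leftarrow>ps. fact r * fact s)"

definition bch_piece :: "nat \<Rightarrow> (nat \<times> nat) list \<Rightarrow> ncs" where
  "bch_piece n ps = (1 / real (bch_divisor n ps)) *\<^sub>R nested_comm (xy_word ps)"

definition bch_comp :: "nat \<Rightarrow> ncs" where
  "bch_comp n = (\<Sum>ps\<in>bch_index n. if odd (length ps) then bch_piece n ps else - bch_piece n ps)"

lemma real_bch_divisor: "real (bch_divisor n ps) = real n * real (length ps) * bch_denom ps"
proof -
  have "real (\<Prod>(r, s)\<leftarrow>ps. fact r * fact s) = bch_denom ps"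
    unfolding bch_denom_def by (induction ps) auto
  then show ?thesis by (simp only: bch_divisor_def of_nat_mult)
qed

lemma bch_index_length: "ps \<in> bch_index n \<Longrightarrow> length ps \<le> n"
proof -
  have "\<forall>(r, s)\<in>set ps. r + s > 0 \<Longrightarrow> length ps \<le> (\<Sum>(r, s)\<leftarrow>ps. r + s)"
    by (induction ps) auto
  then show "ps \<in> bch_index n \<Longrightarrow> ?thesis" by (auto simp: bch_index_def)
qed

lemma bch_index_Nil: "[] \<in> bch_index n \<Longrightarrow> n = 0"
  by (auto simp: bch_index_def)

lemma length_xy_word: "ps \<in> bch_index n \<Longrightarrow> length (xy_word ps) = n"
  by (simp add: length_bch_word bch_index_def)

text \<open>
  Every factor is at most \<open>n\<close> or the factorial of a number that is.
\<close>

lemma smooth_bch_divisor: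
  assumes "ps \<in> bch_index n" "n > 0" shows "smooth n (bch_divisor n ps)"
proof -
  have "smooth n (\<Prod>(r, s)\<leftarrow>qs. fact r * fact s)" if "\<forall>(r, s)\<in>set qs. r \<le> n \<and> s \<le> n" for qs
    using that by (induction qs) (auto intro!: smooth_mult smooth_fact)
  note prod = this
  have "r + s \<le> n" if "(r, s) \<in> set ps" for r s
  proof -
    have "r + s \<in> set (map (\<lambda>(r, s). r + s) ps)" using that by force
    then have "r + s \<le> (\<Sum>(r, s)\<leftarrow>ps. r + s)" by (rule member_le_sum_list) simp
    then show ?thesis using assms by (simp add: bch_index_def)
  qed
  then have "\<forall>(r, s)\<in>set ps. r \<le> n \<and> s \<le> n" by fastforce
  then have "smooth n (\<Prod>(r, s)\<leftarrow>ps. fact r * fact s)" by (rule prod)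
  moreover have "length ps > 0" using assms bch_index_Nil[of n] by auto
  ultimately show ?thesis
    unfolding bch_divisor_def using assms bch_index_length[OF assms(1)]
    by (intro smooth_mult) (auto intro: smooth_le)
qed

text \<open>
  Dynkin's formula divided by the degree.
\<close>

lemma cf_bch_comp:
  "cf (bch_comp n) w = (if 0 < n \<and> length w = n then cf (bch_series ncX ncY) w else 0)"
proof (cases "n = 0")
  case True
  then show ?thesis by (auto simp: bch_comp_def bch_piece_def bch_divisor_def intro!: sum.neutral)
next
  case n: False
  show ?thesis
  proof (cases "length w = n")
    case False
    have "cf (if odd (length ps) then bch_piece n ps else - bch_piece n ps) w = 0" if "ps \<in> bch_index n" for ps
      using False length_xy_word[OF that] by (simp add: bch_piece_def cf_nested_comm_eq_0)
    then show ?thesis using False by (simp add: bch_comp_def)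
  next
    case True
    have "real n * cf (if odd (length ps) then bch_piece n ps else - bch_piece n ps) w =
       (-1) ^ (length ps - 1) / (real (length ps) * bch_denom ps) * cf (nested_comm (xy_word ps)) w" if "ps \<in> bch_index n" for ps
    proof -
      have "length ps > 0" using that n bch_index_Nil[of n] by auto
      then have "(-1::real) ^ (length ps - 1) = (if odd (length ps) then 1 else -1)" by simp
      then show ?thesis using n by (simp add: bch_piece_def real_bch_divisor)
    qed
    then have "real n * cf (bch_comp n) w = real n * cf (bch_series ncX ncY) w"
      using n by (simp add: dynkin_formula[OF True] bch_comp_def sum_distrib_left)
    then show ?thesis using True n by simp
  qed
qed

lemma bch_series_approx: "ordge (Suc N) (bch_series ncX ncY - (\<Sum>n\<in>{1..N}. bch_comp n))"
  unfolding ordge_def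
proof (intro allI impI)
  fix w :: "bool list" assume w: "length w < Suc N"
  have "(\<Sum>n\<in>{1..N}. cf (bch_comp n) w) = (\<Sum>n\<in>{1..N}. if length w = n then cf (bch_series ncX ncY) w else 0)"
    by (intro sum.cong) (auto simp: cf_bch_comp)
  also have "\<dots> = cf (bch_series ncX ncY) w"
    using w ordge_bch_series[of ncX ncY] by (cases w) (auto simp: ordge_1_iff simp flip: One_nat_def)
  finally show "cf (bch_series ncX ncY - (\<Sum>n\<in>{1..N}. bch_comp n)) w = 0" by simp
qed

lemma ordge_nested_comm: "ordge (length w) (nested_comm w)"
  by (auto simp: ordge_def intro!: cf_nested_comm_eq_0)

lemma integ_nested_comm: "integ (nested_comm w)"
proof (induction w rule: nested_comm.induct)
  case (3 b c w)
  then show ?case by (auto simp: ad_def intro!: integ_diff integ_mult)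
qed auto

lemma integ_bch_series: "integ (bch_series ncX ncY)"
  unfolding bch_series_def
  by (intro integ_subst integ_diff integ_mult integ_nexp fps_ln_fractions) auto

lemma bch_piece_facts:
  assumes "ps \<in> bch_index n" "n > 0"
  shows "integ (bch_piece n ps)" "ordge n (bch_piece n ps)"
  using integ_scale[OF integ_nested_comm ordge_nested_comm, of "1 / real (bch_divisor n ps)" "xy_word ps"] fractions_inverse[OF smooth_bch_divisor[OF assms]]
    length_xy_word[OF assms(1)] ordge_nested_comm[of "xy_word ps"]
  by (auto simp: bch_piece_def intro: ordge_scale)

lemma bch_comp_facts:
  assumes "n > 0" shows "integ (bch_comp n)" "ordge n (bch_comp n)"
  unfolding bch_comp_def
  by (auto intro!: integ_sum ordge_sum integ_uminus ordge_uminus bch_piece_facts assms)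

lemma bch_index_1: "bch_index 1 = {[(1, 0)], [(0, 1)]}"
proof (intro equalityI subsetI)
  fix ps assume ps: "ps \<in> bch_index 1"
  then have "length ps \<le> 1" by (rule bch_index_length)
  moreover have "ps \<noteq> []" using ps bch_index_Nil[of 1] by auto
  ultimately obtain p where p: "ps = [p]" by (cases ps) auto
  obtain r s where rs: "p = (r, s)" by (cases p)
  then have "r + s = 1" using ps p by (simp add: bch_index_def)
  then have "r = 1 \<and> s = 0 \<or> r = 0 \<and> s = 1" by arith
  then show "ps \<in> {[(1, 0)], [(0, 1)]}" by (auto simp: p rs)
qed (auto simp: bch_index_def)

lemma bch_comp_1: "bch_comp 1 = ncX + ncY"
  unfolding bch_comp_def bch_index_1 by (simp add: bch_piece_def bch_divisor_def bch_word_def One_nat_def)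

section \<open>Exponential and logarithm of endomorphisms\<close>

context lazard_module_pair
begin

interpretation E: lazard_module "End_ring L F" "End_filt L F" by (rule End_module)
interpretation R: ring "End_ring L F" by (rule End_ring)

text \<open>
  Evaluating \<open>c\<close> at the value of \<open>g\<close> is evaluating \<open>c(g)\<close>. The summands agree in the \<open>m\<close>-th term after
  multiplication by the denominator of \<open>c\<^sub>m\<close>, hence they agree.
\<close>

lemma ev_compose:
  assumes g: "integ g" "ordge 1 g" and c: "\<And>m. fps_nth c m \<in> fractions m"
  shows "ev (V g) (V g) (subst c ncX) = V (subst c g)"
proof -
  have v: "V g \<in> EF i" using ev_filt_1[OF dei g] .
  interpret P: lazard_module_pair L F "V g" "V g" i by unfold_locales (use v i in auto)
  have sX: "integ (subst c ncX)" and sg: "integ (subst c g)"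
    using c g by (auto intro: integ_subst)
  have X: "integ (ncX ^ m)" "ordge m (ncX ^ m)" "integ (g ^ m)" "ordge m (g ^ m)" for m
    using g by (auto intro: integ_power ordge_power simp: ordge_letter)
  have cX: "integ (fps_nth c m *\<^sub>R ncX ^ m)" "integ (fps_nth c m *\<^sub>R g ^ m)" for m
    by (rule integ_scale[OF X(1,2) c], rule integ_scale[OF X(3,4) c])
  have summand: "P.V (fps_nth c m *\<^sub>R ncX ^ m) = V (fps_nth c m *\<^sub>R g ^ m)" for m
  proof -
    obtain a b where ab: "smooth m b" "fps_nth c m * real b = real_of_int a"
      using c[of m] by (auto simp: fractions_def)
    have "P.V (ncX ^ m) = V (g ^ m)" using g by (simp add: P.V_power P.V_letter V_power)
    then show ?thesis
      using E.F_torsion_free[OF ab(1)] P.V_scale[OF X(1,2) ab] V_scale[OF X(3,4) ab] by simp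
  qed
  show ?thesis
  proof (rule E.F_eq_if_close)
    fix N
    let ?p = "\<Sum>m\<le>N. fps_nth c m *\<^sub>R ncX ^ m" and ?q = "\<Sum>m\<le>N. fps_nth c m *\<^sub>R g ^ m"
    have pq: "P.V ?p = V ?q" using cX by (simp add: P.V_sum V_sum summand)
    have ip: "integ ?p" "integ ?q" using cX by (auto intro: integ_sum)
    have "P.V (subst c ncX) \<boxminus> P.V ?p \<in> EF N"
      using subst_approx[OF ordge_letter, of N c True] by (intro P.V_approx sX ip) (auto intro: ordge_mono)
    moreover have "V (subst c g) \<boxminus> V ?q \<in> EF N"
      using subst_approx[OF g(2), of N c] by (intro V_approx sg ip) (auto intro: ordge_mono)
    ultimately show "\<exists>y\<in>carrier EE. P.V (subst c ncX) \<boxminus> y \<in> EF N \<and> V (subst c g) \<boxminus> y \<in> EF N"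
      using pq ip by (intro bexI[of _ "V ?q"]) auto
  qed (use sX sg in auto)
qed

lemma exp_d: "exp_End L F d = V (nexp ncX)" and exp_e: "exp_End L F e = V (nexp ncY)"
  using exp_End_V[of ncX] exp_End_V[of ncY] by (auto simp: V_letter ordge_letter)

lemma exp_mult: "exp_End L F d \<star> exp_End L F e = exp_End L F (V (bch_series ncX ncY))"
  by (simp add: exp_d exp_e exp_End_V[OF integ_bch_series ordge_bch_series] nexp_bch_series V_mult integ_nexp)

lemma V_nested_comm:
  assumes "zero M = zero EE" "mult M = (\<lambda>f g. f \<star> g \<boxminus> g \<star> f)"
  shows "V (nested_comm w) = nested_bracket M (map (\<lambda>b. if b then d else e) w)"
proof (induction w rule: nested_comm.induct)
  case (3 b c w)
  then show ?case
    by (simp add: assms ad_def V_diff V_mult integ_nested_comm integ_mult V_letter)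
qed (simp_all add: V_zero V_letter assms)

lemma V_bch_comp:
  assumes "n > 0" "zero M = zero EE" "mult M = (\<lambda>f g. f \<star> g \<boxminus> g \<star> f)"
  shows "V (bch_comp n) = (\<Oplus>\<^bsub>EE\<^esub>ps\<in>bch_index n.
     let q = filt_root (add_monoid EE) EF n (n * length ps * (\<Prod>(r, s)\<leftarrow>ps. fact r * fact s))
          (nested_bracket M (bch_word d e ps))
     in if odd (length ps) then q else \<ominus>\<^bsub>EE\<^esub> q)"
    (is "_ = finsum EE ?h _")
proof -
  let ?g = "\<lambda>ps. if odd (length ps) then bch_piece n ps else - bch_piece n ps"
  have gi: "integ (?g ps)" if "ps \<in> bch_index n" for ps
    using bch_piece_facts[OF that assms(1)] by (auto intro: integ_uminus)
  have word: "bch_word d e ps = map (\<lambda>b. if b then d else e) (xy_word ps)" for ps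
    by (induction ps) (auto simp: bch_word_def)
  have eq: "V (?g ps) = ?h ps" if ps: "ps \<in> bch_index n" for ps
  proof -
    have "V (bch_piece n ps) = filt_root (add_monoid EE) EF n (bch_divisor n ps) (V (nested_comm (xy_word ps)))"
      unfolding bch_piece_def using ordge_nested_comm[of "xy_word ps"] length_xy_word[OF ps]
      by (intro V_root[symmetric] integ_nested_comm smooth_bch_divisor ps assms(1)) simp
    then show ?thesis
      using bch_piece_facts[OF ps assms(1)]
      by (simp add: V_uminus Let_def bch_divisor_def word V_nested_comm[OF assms(2,3)])
  qed
  have "V (bch_comp n) = finsum EE (\<lambda>ps. V (?g ps)) (bch_index n)"
    unfolding bch_comp_def using gi by (intro V_sum finite_bch_index)
  also have "\<dots> = finsum EE ?h (bch_index n)"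
  proof (rule E.finsum_cong'[OF refl])
    show "?h \<in> bch_index n \<rightarrow> carrier EE"
    proof
      fix ps assume ps: "ps \<in> bch_index n"
      show "?h ps \<in> carrier EE" unfolding eq[OF ps, symmetric] using gi[OF ps] by (rule V_closed)
    qed
  qed (rule eq)
  finally show ?thesis .
qed

lemma V_bch_approx: "V (bch_series ncX ncY) \<boxminus> (\<Oplus>\<^bsub>EE\<^esub>n\<in>{1..N}. V (bch_comp n)) \<in> EF N"
proof -
  have "(\<Oplus>\<^bsub>EE\<^esub>n\<in>{1..N}. V (bch_comp n)) = V (\<Sum>n\<in>{1..N}. bch_comp n)"
    by (rule V_sum[symmetric]) (auto intro: bch_comp_facts)
  then show ?thesis
    using bch_series_approx[of N]
    by (auto intro!: V_approx integ_bch_series integ_sum bch_comp_facts intro: ordge_mono)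
qed

text \<open>
  For commuting arguments all nested brackets of length at least two vanish, and so do their quotients
  because the term in which the division takes place has no torsion for the divisor. Thus the
  Baker--Campbell--Hausdorff series reduces to its linear part.
\<close>

lemma exp_add_commute:
  assumes comm: "d \<star> e = e \<star> d"
  shows "exp_End L F (d \<boxplus> e) = exp_End L F d \<star> exp_End L F e"
proof -
  have dc: "d \<in> carrier EE" "e \<in> carrier EE" using d e End_filt_carrier by auto
  have nbr0: "V (nested_comm w) = \<zero>\<^sub>E" if "2 \<le> length w" for w
    using that
  proof (induction w rule: nested_comm.induct)
    case (3 b c w)
    show ?case
    proof (cases w)
      case Nil
      then show ?thesis using comm dc
        by (auto simp: ad_def V_diff V_mult integ_mult V_letter a_minus_def E.r_neg)
    next
      case (Cons a v)
      then have "V (nested_comm (c # w)) = \<zero>\<^sub>E" using 3 by simp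
      then show ?thesis using dc
        by (simp add: ad_def V_diff V_mult integ_mult V_letter integ_nested_comm a_minus_def)
    qed
  qed auto
  have piece0: "V (bch_piece n ps) = \<zero>\<^sub>E" if "ps \<in> bch_index n" "2 \<le> n" for n ps
  proof -
    have n: "n > 0" using that by simp
    have b: "smooth n (bch_divisor n ps)" by (rule smooth_bch_divisor[OF that(1) n])
    have ab: "1 / real (bch_divisor n ps) * real (bch_divisor n ps) = real_of_int 1" using smooth_pos[OF b] by simp
    have o: "ordge n (nested_comm (xy_word ps))" using ordge_nested_comm[of "xy_word ps"] length_xy_word[OF that(1)] by simp
    have "add_pow EE (int (bch_divisor n ps)) (V (bch_piece n ps)) = add_pow EE (int (bch_divisor n ps)) \<zero>\<^sub>E"
      using V_scale(1)[OF integ_nested_comm o b ab] nbr0[of "xy_word ps"] length_xy_word[OF that(1)] that(2)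
      by (simp add: bch_piece_def)
    then show ?thesis
      using E.F_torsion_free[OF b] V_filt[OF bch_piece_facts[OF that(1) n]] E.F_zero by blast
  qed
  have comp0: "V (bch_comp n) = \<zero>\<^sub>E" if "2 \<le> n" for n
  proof -
    have "V (bch_comp n) = (\<Oplus>\<^bsub>EE\<^esub>ps\<in>bch_index n. V (if odd (length ps) then bch_piece n ps else - bch_piece n ps))"
      unfolding bch_comp_def using that bch_piece_facts
      by (intro V_sum finite_bch_index) (auto intro: integ_uminus)
    also have "\<dots> = (\<Oplus>\<^bsub>EE\<^esub>ps\<in>bch_index n. \<zero>\<^sub>E)"
      using that bch_piece_facts by (intro E.finsum_cong') (auto simp: V_uminus piece0)
    finally show ?thesis by (simp add: E.finsum_zero)
  qed
  have comp1: "V (bch_comp 1) = d \<boxplus> e"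
    by (simp add: bch_comp_1 V_add V_letter)
  have "V (bch_series ncX ncY) = d \<boxplus> e"
  proof (rule E.F_eq_if_close)
    fix N
    have "(\<Oplus>\<^bsub>EE\<^esub>n\<in>{1..Suc N}. V (bch_comp n)) = (\<Oplus>\<^bsub>EE\<^esub>n\<in>insert 1 {2..Suc N}. V (bch_comp n))"
      by (rule arg_cong[where f = "finsum EE _"]) auto
    also have "\<dots> = V (bch_comp 1) \<boxplus> (\<Oplus>\<^bsub>EE\<^esub>n\<in>{2..Suc N}. V (bch_comp n))"
      using bch_comp_facts by (intro E.finsum_insert) auto
    also have "(\<Oplus>\<^bsub>EE\<^esub>n\<in>{2..Suc N}. V (bch_comp n)) = (\<Oplus>\<^bsub>EE\<^esub>n\<in>{2..Suc N}. \<zero>\<^sub>E)"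
      by (intro E.finsum_cong') (auto simp: comp0)
    finally have "(\<Oplus>\<^bsub>EE\<^esub>n\<in>{1..Suc N}. V (bch_comp n)) = d \<boxplus> e"
      using dc by (simp add: E.finsum_zero comp1)
    then have "V (bch_series ncX ncY) \<boxminus> (d \<boxplus> e) \<in> EF N"
      using V_bch_approx[of "Suc N"] E.F_antimono[of N "Suc N"] by auto
    then show "\<exists>c\<in>carrier EE. V (bch_series ncX ncY) \<boxminus> c \<in> EF N \<and> d \<boxplus> e \<boxminus> c \<in> EF N"
      using dc E.F_zero by (intro bexI[of _ "d \<boxplus> e"]) (auto simp: E.r_neg a_minus_def)
  qed (use dc integ_bch_series in auto)
  then show ?thesis using exp_mult by simp
qed

end

context lazard_module
begin

text \<open>
  The logarithm of \<open>1 + u\<close>.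
\<close>

definition log_End :: "('a \<Rightarrow> 'a) \<Rightarrow> 'a \<Rightarrow> 'a" where
  "log_End u = ev u u (subst (fps_ln 1) ncX)"

lemma pairI: "v \<in> EF i \<Longrightarrow> w \<in> EF i \<Longrightarrow> 1 \<le> i \<Longrightarrow> lazard_module_pair L F v w i"
  by unfold_locales

lemma exp_End_filt:
  assumes v: "v \<in> EF i" "1 \<le> i"
  shows "exp_End L F v \<in> carrier EE" "exp_End L F v \<boxminus> \<one>\<^sub>E \<in> EF i"
proof -
  interpret P: lazard_module_pair L F v v i using v by (intro pairI)
  have n: "integ (nexp ncX)" by (simp add: integ_nexp)
  show "exp_End L F v \<in> carrier EE" by (simp add: P.exp_d n)
  have "ordge 1 (nexp ncX - 1)" by (simp add: ordge_1_iff cf_one)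
  then show "exp_End L F v \<boxminus> \<one>\<^sub>E \<in> EF i"
    using ev_filt_1[OF P.dei, of "nexp ncX - 1"] n by (simp add: P.V_diff P.V_one P.exp_d integ_diff)
qed

lemma log_End_filt: "u \<in> EF i \<Longrightarrow> 1 \<le> i \<Longrightarrow> log_End u \<in> EF i"
  unfolding log_End_def
  by (intro ev_filt_1 integ_subst ordge_subst fps_ln_fractions ordge_letter) auto

lemma exp_log_End:
  assumes u: "u \<in> EF i" "1 \<le> i"
  shows "exp_End L F (log_End u) = \<one>\<^sub>E \<boxplus> u"
proof -
  interpret P: lazard_module_pair L F u u i using u by (intro pairI)
  show ?thesis
    unfolding log_End_def
    by (subst P.exp_End_V)
       (auto intro!: integ_subst ordge_subst fps_ln_fractions simp: ordge_letter nexp_ln P.V_add P.V_one P.V_letter)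
qed

lemma log_exp_End:
  assumes v: "v \<in> EF i" "1 \<le> i"
  shows "log_End (exp_End L F v \<boxminus> \<one>\<^sub>E) = v"
proof -
  interpret P: lazard_module_pair L F v v i using v by (intro pairI)
  have n: "integ (nexp ncX)" by (simp add: integ_nexp)
  then have "exp_End L F v \<boxminus> \<one>\<^sub>E = P.V (nexp ncX - 1)"
    by (simp add: P.V_diff P.V_one P.exp_d)
  then have "log_End (exp_End L F v \<boxminus> \<one>\<^sub>E) = P.V (subst (fps_ln 1) (nexp ncX - 1))"
    unfolding log_End_def using n
    by (simp only:) (intro P.ev_compose fps_ln_fractions integ_diff, auto simp: ordge_1_iff cf_one)
  then show ?thesis by (simp add: ln_nexp ordge_letter P.V_letter)
qed

lemma exp_End_minus:
  assumes v: "v \<in> EF i" "1 \<le> i"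
  shows "exp_End L F v \<star> exp_End L F (\<ominus>\<^bsub>EE\<^esub> v) = \<one>\<^sub>E"
proof -
  interpret P: lazard_module_pair L F v v i using v by (intro pairI)
  have "exp_End L F (\<ominus>\<^bsub>EE\<^esub> v) = P.V (nexp (- ncX))"
    using P.exp_End_V[of "- ncX"] by (simp add: P.V_uminus P.V_letter integ_uminus ordge_uminus ordge_letter)
  then show ?thesis
    using nexp_uminus[OF ordge_letter, of True]
    by (simp add: P.exp_d P.V_one integ_nexp integ_uminus flip: P.V_mult)
qed

end

section \<open>Derivations and automorphisms\<close>

context lazard_module
begin

lemma ev_commute:
  assumes a: "a \<in> EF i" "1 \<le> i" and g: "g \<in> carrier EE" and comm: "a \<star> g = g \<star> a"
    and f: "integ f"
  shows "ev a a f \<star> g = g \<star> ev a a f"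
proof -
  interpret R: ring EE by (rule End_ring)
  have lm: "lazard_module L F" ..
  have ag: "a (g x) = g (a x)" if "x \<in> carrier L" for x
    using fun_cong[OF comm, of x] that by simp
  have w: "word_op a a w (g x) = g (word_op a a w x)" if "x \<in> carrier L" for w x
    using that word_op_carrier[OF a(1) a(1)] by (induction w) (auto simp: ag)
  have eF: "ev a a f \<in> carrier EE" using ev_carrier[OF a(1) a(1) a(2) f] .
  show ?thesis
  proof (rule End_ext)
    fix x assume x: "x \<in> carrier L"
    have "g (ev a a f x) = ser f (\<lambda>w. g (word_op a a w x))"
      using ser_hom[OF lm lm End_hom[OF g] _ f adm_word_op[OF a(1) a(1) a(2) x]] g x
      by (simp add: ev_def End_ring_def)
    then show "(ev a a f \<star> g) x = (g \<star> ev a a f) x"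
      using x g by (simp add: w ev_def End_closed)
  qed (use eF g in auto)
qed

text \<open>
  If \<open>p\<close> and \<open>q\<close> commute and agree at \<open>x\<close>, then so do their powers, and hence all series in them.
\<close>

lemma ev_eq_at:
  assumes p: "p \<in> EF i" and q: "q \<in> EF i" and comm: "p \<star> q = q \<star> p"
    and x: "x \<in> carrier L" "p x = q x"
  shows "ev p p f x = ev q q f x"
proof -
  have pq: "p (q y) = q (p y)" if "y \<in> carrier L" for y
    using fun_cong[OF comm, of y] that by simp
  have "word_op q q w (p y) = p (word_op q q w y)" if "y \<in> carrier L" for y w
    using that word_op_carrier[OF q q] by (induction w) (auto simp: pq)
  moreover have "word_op q q w (q y) = q (word_op q q w y)" for y w
    by (induction w) auto
  ultimately have "word_op p p w x = word_op q q w x" for w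
    using x by (induction w) (auto, metis)
  then show ?thesis using x by (simp add: ev_def)
qed

subsection \<open>Filtered functions of two arguments\<close>

definition pairs :: "nat \<Rightarrow> ('a \<times> 'a) set" where
  "pairs k = {(x, y). \<exists>i j. i + j = k \<and> x \<in> F i \<and> y \<in> F j}"

abbreviation (input) "MM \<equiv> Fun_mod L F pairs"
abbreviation (input) "MF \<equiv> Fun_filt L F pairs"

lemma pairs_0: "pairs 0 = carrier L \<times> carrier L"
  by (auto simp: pairs_def F_0)

lemma pairs_subset: "pairs k \<subseteq> pairs 0"
  unfolding pairs_0 by (auto simp: pairs_def dest: F_carrier)

lemma pairsI: "x \<in> F i \<Longrightarrow> y \<in> F j \<Longrightarrow> (x, y) \<in> pairs (i + j)"
  by (auto simp: pairs_def)

lemma MM_module: "lazard_module MM MF"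
  by (rule Fun_mod_module(1)[where S = pairs, OF pairs_subset])

definition lift_op :: "(('a \<times> 'a \<Rightarrow> 'a) \<Rightarrow> 'a \<Rightarrow> 'a \<Rightarrow> 'a) \<Rightarrow> ('a \<times> 'a \<Rightarrow> 'a) \<Rightarrow> 'a \<times> 'a \<Rightarrow> 'a" where
  "lift_op h = (\<lambda>\<beta>\<in>carrier MM. \<lambda>p\<in>pairs 0. h \<beta> (fst p) (snd p))"

text \<open>
  The operators on functions of two arguments by which \<open>u\<close> acts on the first argument, on the
  second argument, and on the value.
\<close>

definition op1 where "op1 u = lift_op (\<lambda>\<beta> x y. \<beta> (u x, y))"
definition op2 where "op2 u = lift_op (\<lambda>\<beta> x y. \<beta> (x, u y))"
definition op3 where "op3 u = lift_op (\<lambda>\<beta> x y. u (\<beta> (x, y)))"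

lemma MM_val: "\<beta> \<in> MF k \<Longrightarrow> p \<in> pairs j \<Longrightarrow> \<beta> p \<in> F (j + k)"
  by (auto simp: Fun_filt_def)

lemma MM_carrier: "MF 0 = carrier MM"
  using lazard_module.F_0[OF MM_module] .

lemma MM_closed: "\<beta> \<in> carrier MM \<Longrightarrow> x \<in> carrier L \<Longrightarrow> y \<in> carrier L \<Longrightarrow> \<beta> (x, y) \<in> carrier L"
  using MM_val[of \<beta> 0 "(x, y)" 0] by (simp add: MM_carrier pairs_0 F_0)

lemma MM_ext:
  "\<beta> \<in> carrier MM \<Longrightarrow> \<gamma> \<in> carrier MM \<Longrightarrow>
   (\<And>x y. x \<in> carrier L \<Longrightarrow> y \<in> carrier L \<Longrightarrow> \<beta> (x, y) = \<gamma> (x, y)) \<Longrightarrow> \<beta> = \<gamma>"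
  by (auto simp: Fun_mod_def pairs_0 intro!: extensionalityI)

lemma MM_add: "x \<in> carrier L \<Longrightarrow> y \<in> carrier L \<Longrightarrow> (\<beta> \<oplus>\<^bsub>MM\<^esub> \<gamma>) (x, y) = \<beta> (x, y) \<oplus> \<gamma> (x, y)"
  by (simp add: Fun_mod_def pairs_0)

lemma lift_op_val:
  "\<beta> \<in> carrier MM \<Longrightarrow> x \<in> carrier L \<Longrightarrow> y \<in> carrier L \<Longrightarrow> lift_op h \<beta> (x, y) = h \<beta> x y"
  by (simp add: lift_op_def pairs_0)

lemma lift_op_filt:
  assumes filt: "\<And>\<beta> j k p. \<beta> \<in> MF k \<Longrightarrow> p \<in> pairs j \<Longrightarrow> h \<beta> (fst p) (snd p) \<in> F (j + (k + i))"
    and add: "\<And>\<beta> \<gamma> x y. \<beta> \<in> carrier MM \<Longrightarrow> \<gamma> \<in> carrier MM \<Longrightarrow> x \<in> carrier L \<Longrightarrow> y \<in> carrier L \<Longrightarrow>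
      h (\<beta> \<oplus>\<^bsub>MM\<^esub> \<gamma>) x y = h \<beta> x y \<oplus> h \<gamma> x y"
  shows "lift_op h \<in> End_filt MM MF i"
proof -
  interpret M: lazard_module MM MF by (rule MM_module)
  have mem: "lift_op h \<beta> \<in> MF (k + i)" if "\<beta> \<in> MF k" for \<beta> k
    using filt[OF that] M.F_carrier[OF that] pairs_subset
    by (force simp: lift_op_def Fun_filt_def subset_iff)
  have c: "lift_op h \<beta> \<in> carrier MM" if "\<beta> \<in> carrier MM" for \<beta>
    using mem[of \<beta> 0] that M.F_carrier by (auto simp: MM_carrier)
  show ?thesis
    unfolding M.End_filt_iff
  proof (intro conjI ballI allI)
    show "lift_op h \<in> extensional (carrier MM)" by (simp add: lift_op_def)
    fix \<beta> \<gamma> assume b: "\<beta> \<in> carrier MM" "\<gamma> \<in> carrier MM"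
    then show "lift_op h (\<beta> \<oplus>\<^bsub>MM\<^esub> \<gamma>) = lift_op h \<beta> \<oplus>\<^bsub>MM\<^esub> lift_op h \<gamma>"
      by (intro MM_ext c M.a_closed) (auto simp: lift_op_val MM_add add c)
  qed (use mem in auto)
qed

lemma op_filt:
  assumes u: "u \<in> EF i"
  shows "op1 u \<in> End_filt MM MF i" "op2 u \<in> End_filt MM MF i" "op3 u \<in> End_filt MM MF i"
proof -
  have uc: "u \<in> carrier EE" using u by (rule End_filt_carrier)
  show "op1 u \<in> End_filt MM MF i"
    unfolding op1_def
  proof (rule lift_op_filt)
    fix \<beta> j k p assume b: "\<beta> \<in> MF k" and "p \<in> pairs j"
    then obtain x y m n where p: "p = (x, y)" "m + n = j" "x \<in> F m" "y \<in> F n" by (auto simp: pairs_def)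
    have "(u x, y) \<in> pairs (j + i)"
      using pairsI[OF End_val[OF u p(3)] p(4)] p(2) by (simp add: ac_simps)
    then show "\<beta> (u (fst p), snd p) \<in> F (j + (k + i))"
      using MM_val[OF b] p(1) by (fastforce simp: ac_simps)
  qed (use uc in \<open>auto simp: MM_add End_closed\<close>)
  show "op2 u \<in> End_filt MM MF i"
    unfolding op2_def
  proof (rule lift_op_filt)
    fix \<beta> j k p assume b: "\<beta> \<in> MF k" and "p \<in> pairs j"
    then obtain x y m n where p: "p = (x, y)" "m + n = j" "x \<in> F m" "y \<in> F n" by (auto simp: pairs_def)
    have "(x, u y) \<in> pairs (j + i)"
      using pairsI[OF p(3) End_val[OF u p(4)]] p(2) by (simp add: ac_simps)
    then show "\<beta> (fst p, u (snd p)) \<in> F (j + (k + i))"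
      using MM_val[OF b] p(1) by (fastforce simp: ac_simps)
  qed (use uc in \<open>auto simp: MM_add End_closed\<close>)
  show "op3 u \<in> End_filt MM MF i"
    unfolding op3_def
  proof (rule lift_op_filt)
    fix \<beta> j k p assume b: "\<beta> \<in> MF k" and p: "p \<in> pairs j"
    show "u (\<beta> (fst p, snd p)) \<in> F (j + (k + i))"
      using End_val[OF u MM_val[OF b p]] by (simp add: ac_simps)
  qed (use uc in \<open>auto simp: MM_add End_add MM_closed\<close>)
qed

lemma op_val:
  assumes "\<beta> \<in> carrier MM" "x \<in> carrier L" "y \<in> carrier L"
  shows "op1 u \<beta> (x, y) = \<beta> (u x, y)" "op2 u \<beta> (x, y) = \<beta> (x, u y)" "op3 u \<beta> (x, y) = u (\<beta> (x, y))"
  using assms by (simp_all add: op1_def op2_def op3_def lift_op_val)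

lemma op_commute:
  assumes u: "u \<in> carrier EE"
  shows "op1 u \<otimes>\<^bsub>End_ring MM MF\<^esub> op2 u = op2 u \<otimes>\<^bsub>End_ring MM MF\<^esub> op1 u"
    "op1 u \<otimes>\<^bsub>End_ring MM MF\<^esub> op3 u = op3 u \<otimes>\<^bsub>End_ring MM MF\<^esub> op1 u"
    "op2 u \<otimes>\<^bsub>End_ring MM MF\<^esub> op3 u = op3 u \<otimes>\<^bsub>End_ring MM MF\<^esub> op2 u"
proof -
  interpret M: lazard_module MM MF by (rule MM_module)
  interpret R: ring "End_ring MM MF" by (rule M.End_ring)
  have o: "op1 u \<in> carrier (End_ring MM MF)" "op2 u \<in> carrier (End_ring MM MF)" "op3 u \<in> carrier (End_ring MM MF)"
    using op_filt[of u 0] u by (auto simp: End_filt_0 M.End_filt_0)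
  have c: "\<beta> \<in> carrier MM \<Longrightarrow> op1 u \<beta> \<in> carrier MM" "\<beta> \<in> carrier MM \<Longrightarrow> op2 u \<beta> \<in> carrier MM"
    "\<beta> \<in> carrier MM \<Longrightarrow> op3 u \<beta> \<in> carrier MM" for \<beta>
    using o M.End_closed by auto
  show "op1 u \<otimes>\<^bsub>End_ring MM MF\<^esub> op2 u = op2 u \<otimes>\<^bsub>End_ring MM MF\<^esub> op1 u"
    "op1 u \<otimes>\<^bsub>End_ring MM MF\<^esub> op3 u = op3 u \<otimes>\<^bsub>End_ring MM MF\<^esub> op1 u"
    "op2 u \<otimes>\<^bsub>End_ring MM MF\<^esub> op3 u = op3 u \<otimes>\<^bsub>End_ring MM MF\<^esub> op2 u"
    using o u by (intro M.End_ext R.m_closed; auto intro!: MM_ext simp: c op_val End_closed MM_closed)+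
qed

lemma ev_MM_eval:
  assumes U: "U \<in> End_filt MM MF i" "1 \<le> i" and f: "integ f" and b: "\<beta> \<in> carrier MM"
    and xy: "x \<in> carrier L" "y \<in> carrier L"
  shows "lazard_module.ev MM MF U U f \<beta> (x, y) = ser f (\<lambda>w. word_op U U w \<beta> (x, y))"
proof -
  interpret M: lazard_module MM MF by (rule MM_module)
  have lm: "lazard_module L F" ..
  have hom: "(\<lambda>\<beta>. \<beta> (x, y)) \<in> hom (add_monoid MM) (add_monoid L)"
    using xy by (auto simp: hom_def MM_closed MM_add)
  have "(\<lambda>\<beta>. \<beta> (x, y)) ` MF k \<subseteq> F k" for k
    using MM_val[of _ k "(x, y)" 0] xy by (auto simp: pairs_0)
  from ser_hom[OF MM_module lm hom this f M.adm_word_op[OF U(1) U(1) U(2) b]] b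
  show ?thesis by (simp add: M.ev_def)
qed

lemma word_op_swap: "word_op u u w (u x) = u (word_op u u w x)"
  by (induction w) auto

text \<open>
  Series in \<open>op1 u\<close> amount to the same series in \<open>u\<close>, applied to the first argument. Continuity of
  \<open>\<beta>\<close> in that argument is needed to move the sum inside, and it comes from additivity.
\<close>

lemma ev_op1:
  assumes u: "u \<in> EF i" "1 \<le> i" and f: "integ f" and b: "\<beta> \<in> carrier MM"
    and add: "\<And>x x'. x \<in> carrier L \<Longrightarrow> x' \<in> carrier L \<Longrightarrow> \<beta> (x \<oplus> x', y) = \<beta> (x, y) \<oplus> \<beta> (x', y)"
    and xy: "x \<in> carrier L" "y \<in> carrier L"
  shows "lazard_module.ev MM MF (op1 u) (op1 u) f \<beta> (x, y) = \<beta> (ev u u f x, y)"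
proof -
  interpret M: lazard_module MM MF by (rule MM_module)
  have lm: "lazard_module L F" ..
  have uc: "u \<in> carrier EE" using u(1) by (rule End_filt_carrier)
  have w: "word_op (op1 u) (op1 u) w \<beta> (z, y) = \<beta> (word_op u u w z, y)" if "z \<in> carrier L" for w z
    using that
  proof (induction w arbitrary: z)
    case (Cons c w)
    have "word_op (op1 u) (op1 u) w \<beta> \<in> carrier MM"
      using M.word_op_carrier[OF op_filt(1)[OF u(1)] op_filt(1)[OF u(1)] b] .
    then show ?case using Cons xy uc by (simp add: op_val End_closed word_op_swap)
  qed simp
  have hom: "(\<lambda>z. \<beta> (z, y)) \<in> hom (add_monoid L) (add_monoid L)"
    using xy b add by (auto simp: hom_def MM_closed)
  have "(\<lambda>z. \<beta> (z, y)) ` F k \<subseteq> F k" for k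
  proof
    fix v assume "v \<in> (\<lambda>z. \<beta> (z, y)) ` F k"
    then obtain z where z: "z \<in> F k" "v = \<beta> (z, y)" by blast
    have "(z, y) \<in> pairs (k + 0)" using z xy F_0 by (intro pairsI) auto
    then show "v \<in> F k" using MM_val[of \<beta> 0 "(z, y)" k] b z by (simp add: MM_carrier)
  qed
  from ser_hom[OF lm lm hom this f adm_word_op[OF u(1) u(1) u(2) xy(1)]]
  show ?thesis
    using ev_MM_eval[OF op_filt(1)[OF u(1)] u(2) f b xy] xy by (simp add: w ev_def)
qed

lemma ev_op2:
  assumes u: "u \<in> EF i" "1 \<le> i" and f: "integ f" and b: "\<beta> \<in> carrier MM"
    and add: "\<And>y y'. y \<in> carrier L \<Longrightarrow> y' \<in> carrier L \<Longrightarrow> \<beta> (x, y \<oplus> y') = \<beta> (x, y) \<oplus> \<beta> (x, y')"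
    and xy: "x \<in> carrier L" "y \<in> carrier L"
  shows "lazard_module.ev MM MF (op2 u) (op2 u) f \<beta> (x, y) = \<beta> (x, ev u u f y)"
proof -
  interpret M: lazard_module MM MF by (rule MM_module)
  have lm: "lazard_module L F" ..
  have uc: "u \<in> carrier EE" using u(1) by (rule End_filt_carrier)
  have w: "word_op (op2 u) (op2 u) w \<beta> (x, z) = \<beta> (x, word_op u u w z)" if "z \<in> carrier L" for w z
    using that
  proof (induction w arbitrary: z)
    case (Cons c w)
    have "word_op (op2 u) (op2 u) w \<beta> \<in> carrier MM"
      using M.word_op_carrier[OF op_filt(2)[OF u(1)] op_filt(2)[OF u(1)] b] .
    then show ?case using Cons xy uc by (simp add: op_val End_closed word_op_swap)
  qed simp
  have hom: "(\<lambda>z. \<beta> (x, z)) \<in> hom (add_monoid L) (add_monoid L)"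
    using xy b add by (auto simp: hom_def MM_closed)
  have "(\<lambda>z. \<beta> (x, z)) ` F k \<subseteq> F k" for k
  proof
    fix v assume "v \<in> (\<lambda>z. \<beta> (x, z)) ` F k"
    then obtain z where z: "z \<in> F k" "v = \<beta> (x, z)" by blast
    have "(x, z) \<in> pairs (0 + k)" using z xy F_0 by (intro pairsI) auto
    then show "v \<in> F k" using MM_val[of \<beta> 0 "(x, z)" k] b z by (simp add: MM_carrier)
  qed
  from ser_hom[OF lm lm hom this f adm_word_op[OF u(1) u(1) u(2) xy(2)]]
  show ?thesis
    using ev_MM_eval[OF op_filt(2)[OF u(1)] u(2) f b xy] xy by (simp add: w ev_def)
qed

lemma ev_op3:
  assumes u: "u \<in> EF i" "1 \<le> i" and f: "integ f" and b: "\<beta> \<in> carrier MM"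
    and xy: "x \<in> carrier L" "y \<in> carrier L"
  shows "lazard_module.ev MM MF (op3 u) (op3 u) f \<beta> (x, y) = ev u u f (\<beta> (x, y))"
proof -
  interpret M: lazard_module MM MF by (rule MM_module)
  have "word_op (op3 u) (op3 u) w \<beta> (x, y) = word_op u u w (\<beta> (x, y))" for w
  proof (induction w)
    case (Cons c w)
    have "word_op (op3 u) (op3 u) w \<beta> \<in> carrier MM"
      using M.word_op_carrier[OF op_filt(3)[OF u(1)] op_filt(3)[OF u(1)] b] .
    then show ?case using Cons xy by (simp add: op_val)
  qed simp
  then show ?thesis
    using ev_MM_eval[OF op_filt(3)[OF u(1)] u(2) f b xy] xy b by (simp add: ev_def MM_closed)
qed

lemma exp_End_ev: "v \<in> EF i \<Longrightarrow> 1 \<le> i \<Longrightarrow> exp_End L F v = ev v v (nexp ncX)"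
  using lazard_module_pair.exp_d[OF pairI] .

end

lemma (in lazard_lie_ring) lazard_module: "lazard_module L F"
proof (rule lazard_moduleI)
  show "abelian_group L" ..
  show "additive_subgroup (F i) L" for i
    using filt_ideal[of i] by (simp add: lie_ideal_def)
qed (use filt_zero filt_decreasing lazard in auto)

sublocale lazard_lie_ring \<subseteq> lazard_module L F
  by (rule lazard_module)

context lazard_lie_ring
begin

definition bracket_fun :: "'a \<times> 'a \<Rightarrow> 'a" where
  "bracket_fun = (\<lambda>p\<in>pairs 0. fst p \<otimes> snd p)"

lemma bracket_fun_val: "x \<in> carrier L \<Longrightarrow> y \<in> carrier L \<Longrightarrow> bracket_fun (x, y) = x \<otimes> y"
  by (simp add: bracket_fun_def pairs_0)

lemma bracket_fun_carrier: "bracket_fun \<in> carrier MM"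
proof -
  have "bracket_fun p \<in> F k" if "p \<in> pairs k" for p k
  proof -
    obtain x y i j where p: "p = (x, y)" "i + j = k" "x \<in> F i" "y \<in> F j" using \<open>p \<in> pairs k\<close> by (auto simp: pairs_def)
    then show ?thesis using filt_bracket[OF p(3,4)] F_carrier by (auto simp: bracket_fun_val)
  qed
  then have "bracket_fun ` pairs k \<subseteq> F k" for k by blast
  moreover have "bracket_fun \<in> extensional (pairs 0)" by (simp add: bracket_fun_def)
  ultimately show ?thesis by (simp add: Fun_mod_def)
qed

text \<open>
  The derivation rule says that \<open>op1 d + op2 d\<close> and \<open>op3 d\<close> agree at the bracket. They commute, so their
  exponentials agree there too, and the exponential of the sum is the product of the exponentials.
\<close>

lemma exp_derivation_bracket:
  assumes d: "d \<in> EF i" "1 \<le> i"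
    and der: "\<And>x y. x \<in> carrier L \<Longrightarrow> y \<in> carrier L \<Longrightarrow> d (x \<otimes> y) = d x \<otimes> y \<oplus> x \<otimes> d y"
    and xy: "x \<in> carrier L" "y \<in> carrier L"
  shows "exp_End L F d (x \<otimes> y) = exp_End L F d x \<otimes> exp_End L F d y"
proof -
  interpret M: lazard_module MM MF by (rule MM_module)
  interpret RM: ring "End_ring MM MF" by (rule M.End_ring)
  let ?E = "End_ring MM MF"
  let ?b = bracket_fun and ?e = "nexp ncX"
  have dc: "d \<in> carrier EE" using d End_filt_carrier by auto
  note o = op_filt[OF d(1)]
  note oc = o[THEN M.End_filt_carrier]
  note com = op_commute[OF dc]
  interpret P: lazard_module_pair MM MF "op1 d" "op2 d" i
    using M.pairI[OF o(1,2) d(2)] .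
  have ie: "integ ?e" by (simp add: integ_nexp)
  have s: "op1 d \<oplus>\<^bsub>?E\<^esub> op2 d \<in> End_filt MM MF i"
    using lazard_module.F_add[OF M.End_module o(1,2)] .
  have e_exp: "exp_End L F d = ev d d ?e" by (rule exp_End_ev[OF d])
  have ec: "ev d d ?e \<in> carrier EE" using ev_carrier[OF d(1) d(1) d(2) ie] .
  have bc: "bracket_fun \<in> carrier MM" by (rule bracket_fun_carrier)
  have "M.ev (op1 d \<oplus>\<^bsub>?E\<^esub> op2 d) (op1 d \<oplus>\<^bsub>?E\<^esub> op2 d) ?e ?b = M.ev (op3 d) (op3 d) ?e ?b"
  proof (rule M.ev_eq_at[OF s o(3) _ bc])
    show "(op1 d \<oplus>\<^bsub>?E\<^esub> op2 d) \<otimes>\<^bsub>?E\<^esub> op3 d = op3 d \<otimes>\<^bsub>?E\<^esub> (op1 d \<oplus>\<^bsub>?E\<^esub> op2 d)"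
      using oc com by (simp add: RM.l_distr RM.r_distr)
    show "(op1 d \<oplus>\<^bsub>?E\<^esub> op2 d) ?b = op3 d ?b"
      using bc oc M.End_closed
      by (intro MM_ext) (auto simp: MM_add op_val bracket_fun_val der End_closed[OF dc] bracket_closed)
  qed
  then have "M.ev (op3 d) (op3 d) ?e ?b = exp_End MM MF (op1 d \<oplus>\<^bsub>?E\<^esub> op2 d) ?b"
    using M.exp_End_ev[OF s d(2)] by simp
  also have "\<dots> = M.ev (op1 d) (op1 d) ?e (M.ev (op2 d) (op2 d) ?e ?b)"
    using bc by (simp add: P.exp_add_commute[OF com(1)] M.exp_End_ev[OF o(1) d(2)] M.exp_End_ev[OF o(2) d(2)])
  finally have eq: "M.ev (op3 d) (op3 d) ?e ?b = M.ev (op1 d) (op1 d) ?e (M.ev (op2 d) (op2 d) ?e ?b)" .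
  have v2: "M.ev (op2 d) (op2 d) ?e ?b (z, t) = z \<otimes> ev d d ?e t" if "z \<in> carrier L" "t \<in> carrier L" for z t
    using ev_op2[OF d ie bc _ that] that by (simp add: bracket_fun_val bracket_add_right ec End_closed)
  have v2c: "M.ev (op2 d) (op2 d) ?e ?b \<in> carrier MM"
    using M.End_closed[OF M.ev_carrier[OF o(2) o(2) d(2) ie] bc] .
  have "M.ev (op1 d) (op1 d) ?e (M.ev (op2 d) (op2 d) ?e ?b) (x, y) = ev d d ?e x \<otimes> ev d d ?e y"
    using xy ev_op1[OF d ie v2c _ xy] ec by (simp add: v2 bracket_add_left End_closed)
  moreover have "M.ev (op3 d) (op3 d) ?e ?b (x, y) = ev d d ?e (x \<otimes> y)"
    using xy by (simp add: ev_op3[OF d ie bc xy] bracket_fun_val)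
  ultimately show ?thesis using eq by (simp add: e_exp)
qed

text \<open>
  The homomorphism rule says that \<open>p = op1 u + op2 u + op1 u op2 u\<close> and \<open>op3 u\<close> agree at the bracket.
  Since \<open>1 + p\<close> is a product of commuting factors, its logarithm is the sum of their logarithms.
\<close>

lemma log_derivation:
  assumes u: "u \<in> EF i" "1 \<le> i"
    and hom: "\<And>x y. x \<in> carrier L \<Longrightarrow> y \<in> carrier L \<Longrightarrow>
      x \<otimes> y \<oplus> u (x \<otimes> y) = (x \<oplus> u x) \<otimes> (y \<oplus> u y)"
    and xy: "x \<in> carrier L" "y \<in> carrier L"
  shows "log_End u (x \<otimes> y) = log_End u x \<otimes> y \<oplus> x \<otimes> log_End u y"
proof -
  interpret M: lazard_module MM MF by (rule MM_module)
  interpret RM: ring "End_ring MM MF" by (rule M.End_ring)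
  interpret EM: lazard_module "End_ring MM MF" "End_filt MM MF" by (rule M.End_module)
  let ?E = "End_ring MM MF"
  let ?b = bracket_fun and ?l = "subst (fps_ln 1) ncX"
  have uc: "u \<in> carrier EE" using u End_filt_carrier by auto
  note o = op_filt[OF u(1)]
  note oc = o[THEN M.End_filt_carrier]
  note com = op_commute[OF uc]
  have il: "integ ?l" by (intro integ_subst fps_ln_fractions) simp
  let ?A = "M.log_End (op1 u)" and ?B = "M.log_End (op2 u)"
  have A: "?A \<in> End_filt MM MF i" and B: "?B \<in> End_filt MM MF i"
    using M.log_End_filt o u(2) by auto
  note Ac = A[THEN M.End_filt_carrier] and Bc = B[THEN M.End_filt_carrier]
  have "?A \<otimes>\<^bsub>?E\<^esub> op2 u = op2 u \<otimes>\<^bsub>?E\<^esub> ?A"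
    unfolding M.log_End_def using M.ev_commute[OF o(1) u(2) oc(2) com(1) il] .
  then have AB: "?A \<otimes>\<^bsub>?E\<^esub> ?B = ?B \<otimes>\<^bsub>?E\<^esub> ?A"
    using M.ev_commute[OF o(2) u(2) Ac _ il] by (simp add: M.log_End_def)
  interpret P: lazard_module_pair MM MF ?A ?B i
    using M.pairI[OF A B u(2)] .
  define p where "p = op1 u \<oplus>\<^bsub>?E\<^esub> op2 u \<oplus>\<^bsub>?E\<^esub> op1 u \<otimes>\<^bsub>?E\<^esub> op2 u"
  have p: "p \<in> End_filt MM MF i"
    unfolding p_def using o M.End_mult_filt[OF o(1,2)] M.End_filt_antimono[of i "i + i"]
    by (intro EM.F_add) auto
  have pc: "p \<in> carrier ?E" using p by (rule M.End_filt_carrier)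
  have "exp_End MM MF (?A \<oplus>\<^bsub>?E\<^esub> ?B) = (\<one>\<^bsub>?E\<^esub> \<oplus>\<^bsub>?E\<^esub> op1 u) \<otimes>\<^bsub>?E\<^esub> (\<one>\<^bsub>?E\<^esub> \<oplus>\<^bsub>?E\<^esub> op2 u)"
    using P.exp_add_commute[OF AB] M.exp_log_End[OF o(1) u(2)] M.exp_log_End[OF o(2) u(2)] by simp
  also have "\<dots> = \<one>\<^bsub>?E\<^esub> \<oplus>\<^bsub>?E\<^esub> p"
    using oc by (simp add: p_def RM.l_distr RM.r_distr RM.a_ac)
  finally have "exp_End MM MF (?A \<oplus>\<^bsub>?E\<^esub> ?B) \<ominus>\<^bsub>?E\<^esub> \<one>\<^bsub>?E\<^esub> = p"
    using pc by (simp add: a_minus_def RM.a_comm[of "\<one>\<^bsub>?E\<^esub>"] RM.a_assoc RM.r_neg)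
  then have lp: "M.log_End p = ?A \<oplus>\<^bsub>?E\<^esub> ?B"
    using M.log_exp_End[OF EM.F_add[OF A B] u(2)] by simp
  have bc: "bracket_fun \<in> carrier MM" by (rule bracket_fun_carrier)
  have "M.ev p p ?l ?b = M.ev (op3 u) (op3 u) ?l ?b"
  proof (rule M.ev_eq_at[OF p o(3) _ bc])
    have "op1 u \<otimes>\<^bsub>?E\<^esub> op2 u \<otimes>\<^bsub>?E\<^esub> op3 u = op3 u \<otimes>\<^bsub>?E\<^esub> (op1 u \<otimes>\<^bsub>?E\<^esub> op2 u)"
      using oc com by (metis RM.m_assoc)
    then show "p \<otimes>\<^bsub>?E\<^esub> op3 u = op3 u \<otimes>\<^bsub>?E\<^esub> p"
      using oc com by (simp add: p_def RM.l_distr RM.r_distr)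
    show "p ?b = op3 u ?b"
    proof (rule MM_ext)
      fix x y assume xy: "x \<in> carrier L" "y \<in> carrier L"
      have c: "u x \<in> carrier L" "u y \<in> carrier L" "u (x \<otimes> y) \<in> carrier L"
        using xy uc by (auto simp: End_closed bracket_closed)
      have "x \<otimes> y \<oplus> u (x \<otimes> y) = x \<otimes> y \<oplus> (u x \<otimes> y \<oplus> x \<otimes> u y \<oplus> u x \<otimes> u y)"
        using hom[OF xy] xy c by (simp add: bracket_add_left bracket_add_right bracket_closed a_ac)
      then have "u (x \<otimes> y) = u x \<otimes> y \<oplus> x \<otimes> u y \<oplus> u x \<otimes> u y"
        using xy c by (simp add: bracket_closed)
      then show "p ?b (x, y) = op3 u ?b (x, y)"
        using xy bc c oc M.End_closed
        by (simp add: p_def MM_add op_val bracket_fun_val)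
    qed (use pc oc bc M.End_closed in auto)
  qed
  then have eq: "M.ev (op3 u) (op3 u) ?l ?b = (?A \<oplus>\<^bsub>?E\<^esub> ?B) ?b"
    using lp by (simp add: M.log_End_def)
  have lc: "log_End u \<in> carrier EE" using log_End_filt[OF u] End_filt_carrier by auto
  have "M.ev (op3 u) (op3 u) ?l ?b (x, y) = log_End u (x \<otimes> y)"
    using xy by (simp add: ev_op3[OF u il bc xy] bracket_fun_val log_End_def)
  moreover have "?A ?b (x, y) = log_End u x \<otimes> y"
    unfolding M.log_End_def log_End_def
    using ev_op1[OF u il bc _ xy] xy lc by (simp add: bracket_fun_val bracket_add_left End_closed log_End_def)
  moreover have "?B ?b (x, y) = x \<otimes> log_End u y"
    unfolding M.log_End_def log_End_def
    using ev_op2[OF u il bc _ xy] xy lc by (simp add: bracket_fun_val bracket_add_right End_closed log_End_def)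
  ultimately show ?thesis using eq bc xy by (simp add: MM_add)
qed

end

section \<open>The Lazard Lie ring of derivations\<close>

lemma (in abelian_group) telescope_zero:
  assumes "s \<in> carrier G" "t \<in> carrier G" "u \<in> carrier G"
  shows "(s \<ominus> t) \<oplus> (t \<ominus> u) \<oplus> (u \<ominus> s) = \<zero>"
proof -
  have "(s \<ominus> t) \<oplus> (t \<ominus> u) = s \<ominus> u"
    using assms by (simp add: a_minus_def a_assoc r_neg1)
  then show ?thesis using assms by (simp add: a_minus_def a_assoc r_neg1 r_neg)
qed

text \<open>
  The twelve products are grouped so that the sum telescopes.
\<close>

lemma (in ring) commutator_jacobi:
  assumes x: "x \<in> carrier R" "y \<in> carrier R" "z \<in> carrier R"
  defines "br \<equiv> \<lambda>f g. f \<otimes> g \<ominus> g \<otimes> f"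
  shows "br x (br y z) \<oplus> br y (br z x) \<oplus> br z (br x y) = \<zero>"
proof -
  have e: "br a (br b c) = (a \<otimes> b \<otimes> c \<oplus> c \<otimes> b \<otimes> a) \<ominus> (a \<otimes> c \<otimes> b \<oplus> b \<otimes> c \<otimes> a)"
    if "a \<in> carrier R" "b \<in> carrier R" "c \<in> carrier R" for a b c
    using that by (simp add: br_def a_minus_def l_distr r_distr l_minus r_minus m_assoc minus_add a_ac)
  have "br x (br y z) \<oplus> br y (br z x) \<oplus> br z (br x y) =
     ((x \<otimes> y \<otimes> z \<oplus> z \<otimes> y \<otimes> x) \<ominus> (x \<otimes> z \<otimes> y \<oplus> y \<otimes> z \<otimes> x)) \<oplus>
     ((x \<otimes> z \<otimes> y \<oplus> y \<otimes> z \<otimes> x) \<ominus> (y \<otimes> x \<otimes> z \<oplus> z \<otimes> x \<otimes> y)) \<oplus>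
     ((y \<otimes> x \<otimes> z \<oplus> z \<otimes> x \<otimes> y) \<ominus> (x \<otimes> y \<otimes> z \<oplus> z \<otimes> y \<otimes> x))"
    using x by (simp add: e a_comm)
  then show ?thesis using x by (simp add: telescope_zero)
qed

context filtered_lie_ring
begin

lemma nested_bracket_filt:
  assumes "xs \<noteq> []" "set xs \<subseteq> F 1" shows "nested_bracket L xs \<in> F (length xs)"
  using assms
proof (induction xs rule: induct_list012)
  case (3 x y zs)
  then show ?case using filt_bracket[of x 1 "nested_bracket L (y # zs)" "length (y # zs)"]
    by (simp add: One_nat_def)
qed (simp_all add: One_nat_def)

end

context lazard_lie_ring
begin

abbreviation (input) "DD \<equiv> plus_obj (Der L F) (Der_filt L F)"
abbreviation (input) "DF \<equiv> plus_filt (Der_filt L F)"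

lemma Der_filt_iff:
  "d \<in> Der_filt L F i \<longleftrightarrow> d \<in> EF i \<and>
     (\<forall>x\<in>carrier L. \<forall>y\<in>carrier L. d (x \<otimes> y) = d x \<otimes> y \<oplus> x \<otimes> d y)"
  by (auto simp: Der_filt_def Der_def derivations_def dest: End_filt_carrier)

lemma DD_simps:
  "carrier DD = Der_filt L F 1" "add DD = add EE" "zero DD = zero EE"
  "mult DD = (\<lambda>f g. f \<star> g \<boxminus> g \<star> f)"
  by (simp_all add: plus_obj_def Der_def)

text \<open>
  Since \<open>plus_filt\<close> repeats the first term at index \<open>0\<close>, the intersection describes all indices at once.
\<close>

lemma DF_eq: "DF i = Der_filt L F 1 \<inter> EF i"
proof (cases "i = 0")
  case True
  have "EF 1 \<subseteq> EF 0" by (rule End_filt_antimono) simp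
  then show ?thesis using True by (auto simp: plus_filt_def Der_filt_iff)
next
  case False
  then have "EF i \<subseteq> EF 1" by (intro End_filt_antimono) simp
  then show ?thesis using False by (auto simp: plus_filt_def Der_filt_iff)
qed

lemma bracket_left_hom: "y \<in> carrier L \<Longrightarrow> (\<lambda>x. x \<otimes> y) \<in> hom (add_monoid L) (add_monoid L)"
  and bracket_right_hom: "x \<in> carrier L \<Longrightarrow> (\<lambda>y. x \<otimes> y) \<in> hom (add_monoid L) (add_monoid L)"
  by (auto simp: hom_def bracket_closed bracket_add_left bracket_add_right)

lemma bracket_zero_left: "y \<in> carrier L \<Longrightarrow> \<zero> \<otimes> y = \<zero>"
  using bracket_add_left[of \<zero> \<zero> y] by (simp add: bracket_closed add.l_cancel_one')

lemma bracket_zero_right: "x \<in> carrier L \<Longrightarrow> x \<otimes> \<zero> = \<zero>"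
  using bracket_add_right[of x \<zero> \<zero>] by (simp add: bracket_closed add.l_cancel_one')

lemma bracket_minus_left: "x \<in> carrier L \<Longrightarrow> y \<in> carrier L \<Longrightarrow> (\<ominus> x) \<otimes> y = \<ominus> (x \<otimes> y)"
  using bracket_add_left[of "\<ominus> x" x y] bracket_zero_left[of y]
  by (intro minus_equality[symmetric]) (auto simp: bracket_closed l_neg)

lemma bracket_minus_right: "x \<in> carrier L \<Longrightarrow> y \<in> carrier L \<Longrightarrow> x \<otimes> (\<ominus> y) = \<ominus> (x \<otimes> y)"
  using bracket_add_right[of x "\<ominus> y" y] bracket_zero_right[of x]
  by (intro minus_equality[symmetric]) (auto simp: bracket_closed l_neg)

lemma bracket_close:
  assumes "a \<in> carrier L" "b \<in> carrier L" "x \<in> carrier L" "y \<in> carrier L" "a \<ominus> b \<in> F N" "x \<ominus> y \<in> F N"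
  shows "a \<otimes> x \<ominus> b \<otimes> y \<in> F N"
proof -
  have "a \<otimes> x \<ominus> b \<otimes> x = (a \<ominus> b) \<otimes> x" "b \<otimes> x \<ominus> b \<otimes> y = b \<otimes> (x \<ominus> y)"
    using assms(1-4) by (simp_all add: a_minus_def bracket_add_left bracket_add_right bracket_minus_left bracket_minus_right)
  moreover have "(a \<ominus> b) \<otimes> x \<in> F N" using filt_bracket[OF assms(5), of x 0] assms(3) F_0 by simp
  moreover have "b \<otimes> (x \<ominus> y) \<in> F N" using filt_bracket[OF _ assms(6), of b 0] assms(2) F_0 by simp
  ultimately show ?thesis
    using F_diff_trans[of "a \<otimes> x" "b \<otimes> x" "b \<otimes> y" N] assms by (simp add: bracket_closed)
qed

lemma End_close:
  assumes f: "f \<in> carrier EE" and g: "g \<in> carrier EE" and N: "g \<boxminus> f \<in> EF N" and x: "x \<in> carrier L"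
  shows "f x \<ominus> g x \<in> F N"
proof -
  have "(g \<boxminus> f) x \<in> F (0 + N)" using x F_0 by (intro End_val[OF N]) simp
  then have "g x \<ominus> f x \<in> F N" using f g x by (simp add: End_val_diff)
  then show ?thesis using F_diff_sym[OF End_closed[OF g x] End_closed[OF f x]] by blast
qed

lemma Der_closed:
  assumes f: "f \<in> carrier EE" and lim: "\<And>N. \<exists>g\<in>Der_filt L F 1. g \<boxminus> f \<in> EF N"
  shows "f \<in> Der_filt L F 1"
  unfolding Der_filt_iff
proof (intro conjI ballI)
  interpret E: lazard_module EE EF by (rule End_module)
  have "\<exists>g\<in>EF 1. g \<boxminus> f \<in> EF N" for N
    using lim[of N] Der_filt_iff by blast
  then show "f \<in> EF 1" by (rule E.F_closed[OF f])
  fix x y assume xy: "x \<in> carrier L" "y \<in> carrier L"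
  show "f (x \<otimes> y) = f x \<otimes> y \<oplus> x \<otimes> f y"
  proof (rule F_eq_if_close)
    fix N
    obtain g where g: "g \<in> Der_filt L F 1" "g \<boxminus> f \<in> EF N" using lim by blast
    then have gc: "g \<in> carrier EE" by (auto simp: Der_filt_iff dest: End_filt_carrier)
    note c = End_close[OF f gc g(2)]
    have z: "a \<ominus> a \<in> F N" if "a \<in> carrier L" for a using that F_zero by (simp add: a_minus_def r_neg)
    have 1: "f (x \<otimes> y) \<ominus> g (x \<otimes> y) \<in> F N" using xy by (intro c) (simp add: bracket_closed)
    have "f x \<otimes> y \<ominus> g x \<otimes> y \<in> F N" "x \<otimes> f y \<ominus> x \<otimes> g y \<in> F N"
      using xy f gc c z by (auto intro!: bracket_close simp: End_closed)
    then have "(f x \<otimes> y \<oplus> x \<otimes> f y) \<ominus> (g x \<otimes> y \<oplus> x \<otimes> g y) \<in> F N"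
      using xy f gc by (intro diff_add_F) (auto simp: End_closed bracket_closed)
    moreover have "g (x \<otimes> y) = g x \<otimes> y \<oplus> x \<otimes> g y" using g(1) xy by (simp add: Der_filt_iff)
    ultimately show "\<exists>c\<in>carrier L. f (x \<otimes> y) \<ominus> c \<in> F N \<and> f x \<otimes> y \<oplus> x \<otimes> f y \<ominus> c \<in> F N"
      using 1 xy gc by (intro bexI[of _ "g (x \<otimes> y)"]) (auto simp: End_closed bracket_closed)
  qed (use xy f in \<open>auto simp: End_closed bracket_closed\<close>)
qed

lemma Der_subgroup: "additive_subgroup (Der_filt L F 1) EE"
proof -
  interpret E: lazard_module EE EF by (rule End_module)
  have c: "f \<in> carrier EE" if "f \<in> Der_filt L F 1" for f
    using that by (auto simp: Der_filt_iff dest: End_filt_carrier)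
  show ?thesis
  proof (intro additive_subgroup.intro E.add.subgroupI)
    have "\<zero>\<^sub>E \<in> Der_filt L F 1"
      using E.F_zero by (simp add: Der_filt_iff bracket_zero_left bracket_zero_right bracket_closed)
    then show "Der_filt L F 1 \<noteq> {}" by auto
  next
    fix f assume f: "f \<in> Der_filt L F 1"
    then show "\<ominus>\<^bsub>EE\<^esub> f \<in> Der_filt L F 1"
      using c[OF f] E.F_minus[of f 1]
      by (simp add: Der_filt_iff End_val_minus bracket_closed bracket_minus_left bracket_minus_right End_closed minus_add)
  next
    fix f g assume f: "f \<in> Der_filt L F 1" and g: "g \<in> Der_filt L F 1"
    then show "f \<boxplus> g \<in> Der_filt L F 1"
      using c[OF f] c[OF g] E.F_add[of f 1 g]
      by (simp add: Der_filt_iff bracket_closed bracket_add_left bracket_add_right End_closed a_ac)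
  qed (use c in auto)
qed

text \<open>
  Derivations are closed under limits by continuity of the bracket. A quotient of a derivation satisfies
  the derivation rule after multiplication by the divisor, in a term without the relevant torsion.
\<close>

lemma DD_module: "lazard_module DD DF"
proof (rule lazard_submodule[OF End_module Der_subgroup DD_simps(1,3,2) DF_eq Der_closed])
  interpret E: lazard_module EE EF by (rule End_module)
  fix i b f assume i: "1 \<le> i" "smooth i b" and f: "f \<in> EF i" and bf: "add_pow EE (int b) f \<in> Der_filt L F 1"
  have fc: "f \<in> carrier EE" using f by (rule End_filt_carrier)
  have g: "abelian_group L" ..
  have fF: "f x \<in> F i" if "x \<in> carrier L" for x
    using End_val[OF f, of x 0] that F_0 by simp
  show "f \<in> Der_filt L F 1"
    unfolding Der_filt_iff
  proof (intro conjI ballI)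
    show "f \<in> EF 1" using f End_filt_antimono[OF i(1)] by blast
    fix x y assume xy: "x \<in> carrier L" "y \<in> carrier L"
    have c: "f x \<in> carrier L" "f y \<in> carrier L" using xy fc by (auto simp: End_closed)
    have "add_pow L (int b) (f (x \<otimes> y)) = add_pow EE (int b) f (x \<otimes> y)"
      using xy fc by (simp add: End_val_pow bracket_closed)
    also have "\<dots> = add_pow L (int b) (f x) \<otimes> y \<oplus> x \<otimes> add_pow L (int b) (f y)"
      using xy bf fc by (simp add: Der_filt_iff End_val_pow)
    also have "\<dots> = add_pow L (int b) (f x \<otimes> y \<oplus> x \<otimes> f y)"
      using xy c add_pow_hom[OF g g bracket_left_hom[OF xy(2)] c(1), of "int b"]
        add_pow_hom[OF g g bracket_right_hom[OF xy(1)] c(2), of "int b"]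
      by (simp add: add.int_pow_distrib bracket_closed)
    finally show "f (x \<otimes> y) = f x \<otimes> y \<oplus> x \<otimes> f y"
    proof (rule F_torsion_free[OF i(2), rotated 2])
      show "f (x \<otimes> y) \<in> F i" using xy by (intro fF) (simp add: bracket_closed)
      have "f x \<otimes> y \<in> F i" "x \<otimes> f y \<in> F i"
        using filt_bracket[OF fF[OF xy(1)], of y 0] filt_bracket[OF _ fF[OF xy(2)], of x 0] xy F_0 by auto
      then show "f x \<otimes> y \<oplus> x \<otimes> f y \<in> F i" by (rule F_add)
    qed
  qed
qed auto

lemma commutator_Der:
  assumes f: "f \<in> Der_filt L F i" and g: "g \<in> Der_filt L F j"
  shows "f \<star> g \<boxminus> g \<star> f \<in> Der_filt L F (i + j)"
  unfolding Der_filt_iff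
proof (intro conjI ballI)
  interpret E: lazard_module EE EF by (rule End_module)
  interpret R: ring EE by (rule End_ring)
  have fc: "f \<in> carrier EE" "g \<in> carrier EE"
    using f g by (auto simp: Der_filt_iff dest: End_filt_carrier)
  have "f \<star> g \<in> EF (i + j)" "g \<star> f \<in> EF (i + j)"
    using End_mult_filt[of f i g j] End_mult_filt[of g j f i] f g by (auto simp: Der_filt_iff add.commute)
  then show "f \<star> g \<boxminus> g \<star> f \<in> EF (i + j)" by (rule E.F_diff)
  fix x y assume xy: "x \<in> carrier L" "y \<in> carrier L"
  have df: "f (a \<otimes> b) = f a \<otimes> b \<oplus> a \<otimes> f b" "g (a \<otimes> b) = g a \<otimes> b \<oplus> a \<otimes> g b"
    if "a \<in> carrier L" "b \<in> carrier L" for a b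
    using f g that by (auto simp: Der_filt_iff)
  let ?h = "f \<star> g \<boxminus> g \<star> f"
  have c: "f a \<in> carrier L" "g a \<in> carrier L" if "a \<in> carrier L" for a
    using fc that by (auto simp: End_closed)
  have h: "?h a = f (g a) \<ominus> g (f a)" if "a \<in> carrier L" for a
    using that fc by (simp add: End_val_diff)
  let ?A = "f (g x) \<otimes> y" and ?B = "g x \<otimes> f y" and ?C = "f x \<otimes> g y" and ?D = "x \<otimes> f (g y)"
    and ?E = "g (f x) \<otimes> y" and ?G = "x \<otimes> g (f y)"
  have cc: "?A \<in> carrier L" "?B \<in> carrier L" "?C \<in> carrier L" "?D \<in> carrier L" "?E \<in> carrier L" "?G \<in> carrier L"
    using xy c by (simp_all add: bracket_closed)
  have "?h (x \<otimes> y) = (?A \<oplus> ?B \<oplus> (?C \<oplus> ?D)) \<ominus> (?E \<oplus> ?C \<oplus> (?B \<oplus> ?G))"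
    using xy c fc by (simp add: h df bracket_closed End_add)
  also have "\<dots> = ((?A \<oplus> ?D) \<oplus> (?B \<oplus> ?C)) \<ominus> ((?E \<oplus> ?G) \<oplus> (?B \<oplus> ?C))"
    using cc by (simp add: a_ac)
  also have "\<dots> = (?A \<oplus> ?D) \<ominus> (?E \<oplus> ?G)"
  proof -
    have "(s \<oplus> t) \<ominus> (u \<oplus> t) = s \<ominus> u" if "s \<in> carrier L" "t \<in> carrier L" "u \<in> carrier L" for s t u
    proof -
      have "t \<oplus> (\<ominus> t \<oplus> \<ominus> u) = \<ominus> u" using that by (simp add: r_neg2)
      then show ?thesis using that by (simp add: a_minus_def minus_add a_assoc a_comm[of "\<ominus> u"])
    qed
    then show ?thesis using cc by simp
  qed
  also have "\<dots> = (?A \<ominus> ?E) \<oplus> (?D \<ominus> ?G)"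
    using cc by (simp add: a_minus_def minus_add a_ac)
  also have "\<dots> = ?h x \<otimes> y \<oplus> x \<otimes> ?h y"
    unfolding h[OF xy(1)] h[OF xy(2)]
    using xy c by (simp add: a_minus_def bracket_add_left bracket_add_right bracket_minus_left bracket_minus_right)
  finally show "?h (x \<otimes> y) = ?h x \<otimes> y \<oplus> x \<otimes> ?h y" .
qed

lemma DF_bracket: "f \<in> DF i \<Longrightarrow> g \<in> DF j \<Longrightarrow> f \<otimes>\<^bsub>DD\<^esub> g \<in> DF (i + j)"
proof -
  assume f: "f \<in> DF i" and g: "g \<in> DF j"
  have "f \<in> Der_filt L F (max 1 i)" "g \<in> Der_filt L F (max 1 j)"
    using f g by (auto simp: DF_eq Der_filt_iff max_def)
  then have "f \<otimes>\<^bsub>DD\<^esub> g \<in> Der_filt L F (max 1 i + max 1 j)"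
    by (simp add: DD_simps commutator_Der)
  moreover have "EF (max 1 i + max 1 j) \<subseteq> EF 1" "EF (max 1 i + max 1 j) \<subseteq> EF (i + j)"
    by (intro End_filt_antimono; simp)+
  ultimately show ?thesis by (auto simp: DF_eq Der_filt_iff)
qed

lemma Der_lazard: "lazard_lie_ring DD DF"
proof -
  interpret D: lazard_module DD DF by (rule DD_module)
  interpret R: ring EE by (rule End_ring)
  have c: "f \<in> carrier EE" if "f \<in> carrier DD" for f
    using that by (auto simp: DD_simps Der_filt_iff dest: End_filt_carrier)
  have mc: "f \<otimes>\<^bsub>DD\<^esub> g \<in> carrier DD" if "f \<in> carrier DD" "g \<in> carrier DD" for f g
    using DF_bracket[of f 0 g 0] that by (simp add: D.F_0)
  interpret DL: lie_ring DD
  proof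
    fix f g h assume f: "f \<in> carrier DD" and g: "g \<in> carrier DD" and h: "h \<in> carrier DD"
    note fc = c[OF f] c[OF g] c[OF h]
    show "(f \<oplus>\<^bsub>DD\<^esub> g) \<otimes>\<^bsub>DD\<^esub> h = f \<otimes>\<^bsub>DD\<^esub> h \<oplus>\<^bsub>DD\<^esub> g \<otimes>\<^bsub>DD\<^esub> h"
      using fc by (simp add: DD_simps a_minus_def R.l_distr R.r_distr R.minus_add R.a_ac)
    show "f \<otimes>\<^bsub>DD\<^esub> (g \<oplus>\<^bsub>DD\<^esub> h) = f \<otimes>\<^bsub>DD\<^esub> g \<oplus>\<^bsub>DD\<^esub> f \<otimes>\<^bsub>DD\<^esub> h"
      using fc by (simp add: DD_simps a_minus_def R.l_distr R.r_distr R.minus_add R.a_ac)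
    show "f \<otimes>\<^bsub>DD\<^esub> f = \<zero>\<^bsub>DD\<^esub>"
      using fc by (simp add: DD_simps a_minus_def R.r_neg)
    show "f \<otimes>\<^bsub>DD\<^esub> (g \<otimes>\<^bsub>DD\<^esub> h) \<oplus>\<^bsub>DD\<^esub> g \<otimes>\<^bsub>DD\<^esub> (h \<otimes>\<^bsub>DD\<^esub> f) \<oplus>\<^bsub>DD\<^esub> h \<otimes>\<^bsub>DD\<^esub> (f \<otimes>\<^bsub>DD\<^esub> g) = \<zero>\<^bsub>DD\<^esub>"
      using R.commutator_jacobi[OF fc] by (simp add: DD_simps)
  qed (rule mc)
  show ?thesis
  proof (intro lazard_lie_ring.intro filtered_lie_ring.intro filtered_lie_ring_axioms.intro lazard_lie_ring_axioms.intro)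
    show "lie_ring DD" ..
    show "lie_ideal (DF i) DD" for i
    proof (intro lie_ideal.intro lie_ideal_axioms.intro D.F_subgroup)
      show "lie_ring DD" ..
      show "f \<otimes>\<^bsub>DD\<^esub> g \<in> DF i" if "f \<in> carrier DD" "g \<in> DF i" for f g
        using DF_bracket[of f 0 g i] that by (simp add: D.F_0)
    qed
    show "lazard_filtration (add_monoid DD) DF"
      by (rule D.lazard_filtration) (simp add: plus_filt_def)
  qed (use D.F_0 D.F_Suc DF_bracket in auto)
qed

subsection \<open>Evaluation of the group law on derivations\<close>

lemma DD_transfer:
  shows DD_finsum: "finite A \<Longrightarrow> f \<in> A \<rightarrow> carrier DD \<Longrightarrow> finsum DD f A = finsum EE f A"
    and DD_minus: "q \<in> carrier DD \<Longrightarrow> \<ominus>\<^bsub>DD\<^esub> q = \<ominus>\<^bsub>EE\<^esub> q"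
    and DD_pow: "q \<in> carrier DD \<Longrightarrow> add_pow DD (a::int) q = add_pow EE a q"
proof -
  interpret D: lazard_module DD DF by (rule DD_module)
  interpret E: lazard_module EE EF by (rule End_module)
  have c: "f \<in> carrier EE" if "f \<in> carrier DD" for f
    using that by (auto simp: DD_simps Der_filt_iff dest: End_filt_carrier)
  show "finsum DD f A = finsum EE f A" if "finite A" "f \<in> A \<rightarrow> carrier DD" for f and A :: "'z set"
    using that
  proof (induction A)
    case (insert x A)
    then have "f \<in> A \<rightarrow> carrier EE" "f x \<in> carrier EE" using c by auto
    then show ?case using insert by (simp add: D.finsum_insert E.finsum_insert DD_simps(2) Pi_iff)
  qed (simp add: DD_simps(3))
  show "\<ominus>\<^bsub>DD\<^esub> q = \<ominus>\<^bsub>EE\<^esub> q" if "q \<in> carrier DD"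
    using E.minus_equality[of "\<ominus>\<^bsub>DD\<^esub> q" q] D.l_neg[OF that] c[OF that] c[OF D.a_inv_closed[OF that]]
    by (simp add: DD_simps(2,3))
  show "add_pow DD (a::int) q = add_pow EE a q" if "q \<in> carrier DD"
    using add_pow_hom[OF D.abelian_group_axioms E.abelian_group_axioms, of "\<lambda>x. x" q a] that c
    by (auto simp: hom_def DD_simps(2))
qed

lemma DD_root:
  assumes n: "1 \<le> n" and b: "smooth n b" and z: "z \<in> DF n"
  shows "filt_root (add_monoid DD) DF n b z = filt_root (add_monoid EE) EF n b z"
    and "filt_root (add_monoid DD) DF n b z \<in> DF n"
proof -
  interpret D: lazard_module DD DF by (rule DD_module)
  interpret E: lazard_module EE EF by (rule End_module)
  obtain y where y: "y \<in> DF n" "add_pow DD (int b) y = z" using D.F_divide[OF b z] .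
  have yE: "y \<in> EF n" "add_pow EE (int b) y = z"
    using y DD_pow[OF D.F_carrier[OF y(1)]] by (auto simp: DF_eq)
  have "filt_root (add_monoid DD) DF n b z = y"
    unfolding filt_root_def
    by (rule the_equality) (use y D.F_torsion_free[OF b] in \<open>auto simp: add_pow_def int_pow_int\<close>)
  moreover have "filt_root (add_monoid EE) EF n b z = y"
    unfolding filt_root_def
    by (rule the_equality) (use yE E.F_torsion_free[OF b] in \<open>auto simp: add_pow_def int_pow_int\<close>)
  ultimately show "filt_root (add_monoid DD) DF n b z = filt_root (add_monoid EE) EF n b z"
    "filt_root (add_monoid DD) DF n b z \<in> DF n" using y by auto
qed

text \<open>
  The \<open>n\<close>-th term of the Baker--Campbell--Hausdorff series is the value of the homogeneous component of
  \<open>log (exp X exp Y)\<close> of degree \<open>n\<close>, hence the sum is the value of that series.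
\<close>

lemma BCH_exp:
  assumes d: "d \<in> Der_filt L F 1" and e: "e \<in> Der_filt L F 1"
  shows "BCH DD DF d e \<in> Der_filt L F 1"
    and "exp_End L F (BCH DD DF d e) = exp_End L F d \<star> exp_End L F e"
proof -
  interpret D: lazard_module DD DF by (rule DD_module)
  interpret DL: lazard_lie_ring DD DF by (rule Der_lazard)
  interpret E: lazard_module EE EF by (rule End_module)
  interpret P: lazard_module_pair L F d e 1
    by (rule pairI) (use d e in \<open>auto simp: Der_filt_iff\<close>)
  have c: "f \<in> carrier EE" if "f \<in> carrier DD" for f
    using that by (auto simp: DD_simps Der_filt_iff dest: End_filt_carrier)
  have bt: "bch_term DD DF n d e = P.V (bch_comp n)" "bch_term DD DF n d e \<in> carrier DD" if n: "1 \<le> n" for n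
  proof -
    let ?q = "\<lambda>R E ps. filt_root (add_monoid R) E n (n * length ps * (\<Prod>(r, s)\<leftarrow>ps. fact r * fact s))
         (nested_bracket DD (bch_word d e ps))"
    have root: "?q DD DF ps = ?q EE EF ps" "?q DD DF ps \<in> carrier DD" if ps: "ps \<in> bch_index n" for ps
    proof -
      have b: "smooth n (n * length ps * (\<Prod>(r, s)\<leftarrow>ps. fact r * fact s))"
        using smooth_bch_divisor[OF ps] n by (simp add: bch_divisor_def)
      have len: "length (bch_word d e ps) = n" using ps by (simp add: length_bch_word bch_index_def)
      have "set (bch_word d e ps) \<subseteq> {d, e}" by (auto simp: bch_word_def split: if_splits)
      then have "set (bch_word d e ps) \<subseteq> DF 1" using d e by (auto simp: plus_filt_def)
      then have z: "nested_bracket DD (bch_word d e ps) \<in> DF n"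
        using DL.nested_bracket_filt[of "bch_word d e ps"] len n by (cases "bch_word d e ps = []") auto
      show "?q DD DF ps = ?q EE EF ps" "?q DD DF ps \<in> carrier DD"
        using DD_root[OF n b z] D.F_carrier by auto
    qed
    have fin: "bch_term DD DF n d e = (\<Oplus>\<^bsub>DD\<^esub>ps\<in>bch_index n. if odd (length ps) then ?q DD DF ps else \<ominus>\<^bsub>DD\<^esub> ?q DD DF ps)"
      by (simp only: bch_term_def Let_def)
    have mem: "(\<lambda>ps. if odd (length ps) then ?q DD DF ps else \<ominus>\<^bsub>DD\<^esub> ?q DD DF ps) \<in> bch_index n \<rightarrow> carrier DD"
      using root(2) by auto
    then show "bch_term DD DF n d e \<in> carrier DD"
      unfolding fin by (rule D.finsum_closed)
    have "bch_term DD DF n d e = (\<Oplus>\<^bsub>EE\<^esub>ps\<in>bch_index n. if odd (length ps) then ?q DD DF ps else \<ominus>\<^bsub>DD\<^esub> ?q DD DF ps)"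
      unfolding fin by (rule DD_finsum[OF finite_bch_index mem])
    also have "\<dots> = (\<Oplus>\<^bsub>EE\<^esub>ps\<in>bch_index n. if odd (length ps) then ?q EE EF ps else \<ominus>\<^bsub>EE\<^esub> ?q EE EF ps)"
    proof (rule E.finsum_cong'[OF refl])
      show "(\<lambda>ps. if odd (length ps) then ?q EE EF ps else \<ominus>\<^bsub>EE\<^esub> ?q EE EF ps) \<in> bch_index n \<rightarrow> carrier EE"
        using root c by (auto simp flip: root(1))
    qed (use root DD_minus in auto)
    also have "\<dots> = P.V (bch_comp n)"
      using P.V_bch_comp[of n DD] n by (simp only: DD_simps Let_def)
    finally show "bch_term DD DF n d e = P.V (bch_comp n)" .
  qed
  let ?Z = "P.V (bch_series ncX ncY)"
  let ?s = "\<lambda>N. \<Oplus>\<^bsub>DD\<^esub>n\<in>{1..N}. bch_term DD DF n d e"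
  have sc: "?s N \<in> carrier DD" for N using bt(2) by (intro D.finsum_closed) auto
  have s: "?s N = (\<Oplus>\<^bsub>EE\<^esub>n\<in>{1..N}. P.V (bch_comp n))" for N
  proof -
    have "?s N = (\<Oplus>\<^bsub>EE\<^esub>n\<in>{1..N}. bch_term DD DF n d e)"
      using bt(2) by (intro DD_finsum) auto
    also have "\<dots> = (\<Oplus>\<^bsub>EE\<^esub>n\<in>{1..N}. P.V (bch_comp n))"
      using bch_comp_facts by (intro E.finsum_cong') (auto simp: bt(1))
    finally show ?thesis .
  qed
  have Zc: "?Z \<in> carrier EE" by (simp add: integ_bch_series)
  have close: "?s N \<boxminus> ?Z \<in> EF N" for N
    using E.F_diff_sym[OF Zc c[OF sc] ] P.V_bch_approx[of N] by (simp add: s)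
  have Z: "?Z \<in> Der_filt L F 1"
    using sc close by (intro Der_closed Zc) (auto simp: DD_simps(1))
  have "BCH DD DF d e = ?Z"
    unfolding BCH_def
  proof (rule D.filt_lim_add)
    show "?s n \<in> carrier DD" for n by (rule sc)
    show "?Z \<in> carrier DD" using Z by (simp add: DD_simps)
    fix k
    have "?s n \<ominus>\<^bsub>DD\<^esub> ?Z \<in> DF k" if "k \<le> n" for n
    proof -
      have m: "?s n \<ominus>\<^bsub>DD\<^esub> ?Z = ?s n \<boxminus> ?Z"
        using DD_minus[of ?Z] Z by (simp add: a_minus_def DD_simps(1,2))
      have "?s n \<ominus>\<^bsub>DD\<^esub> ?Z \<in> carrier DD" using sc Z by (simp add: DD_simps(1) del: One_nat_def flip: DD_simps(1))
      moreover have "?s n \<boxminus> ?Z \<in> EF k" using close[of n] E.F_antimono[OF that] by blast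
      ultimately show ?thesis by (simp add: DF_eq m DD_simps(1))
    qed
    then show "\<exists>N. \<forall>n\<ge>N. ?s n \<ominus>\<^bsub>DD\<^esub> ?Z \<in> DF k" by blast
  qed
  then show "BCH DD DF d e \<in> Der_filt L F 1"
    "exp_End L F (BCH DD DF d e) = exp_End L F d \<star> exp_End L F e"
    using Z P.exp_mult by auto
qed

end

section \<open>The Lazard group of automorphisms\<close>

lemma group_transport:
  assumes H: "group H" and bij: "bij_betw h (carrier G) (carrier H)"
    and closed: "\<And>x y. x \<in> carrier G \<Longrightarrow> y \<in> carrier G \<Longrightarrow> x \<otimes>\<^bsub>G\<^esub> y \<in> carrier G"
    and hom: "\<And>x y. x \<in> carrier G \<Longrightarrow> y \<in> carrier G \<Longrightarrow> h (x \<otimes>\<^bsub>G\<^esub> y) = h x \<otimes>\<^bsub>H\<^esub> h y"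
    and one: "\<one>\<^bsub>G\<^esub> \<in> carrier G" "h \<one>\<^bsub>G\<^esub> = \<one>\<^bsub>H\<^esub>"
  shows "group G"
proof -
  interpret H: group H by fact
  have inj: "x = y" if "x \<in> carrier G" "y \<in> carrier G" "h x = h y" for x y
    using bij that by (auto simp: bij_betw_def inj_on_def)
  have hc: "h x \<in> carrier H" if "x \<in> carrier G" for x
    using bij that by (auto simp: bij_betw_def)
  show ?thesis
  proof (rule groupI)
    fix x assume x: "x \<in> carrier G"
    have "inv\<^bsub>H\<^esub> (h x) \<in> h ` carrier G" using hc[OF x] bij by (simp add: bij_betw_def)
    then obtain y where y: "y \<in> carrier G" "inv\<^bsub>H\<^esub> (h x) = h y" by blast
    have "y \<otimes>\<^bsub>G\<^esub> x = \<one>\<^bsub>G\<^esub>"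
      using x y one hc[OF x] by (intro inj closed) (auto simp: hom simp flip: y(2))
    then show "\<exists>y\<in>carrier G. y \<otimes>\<^bsub>G\<^esub> x = \<one>\<^bsub>G\<^esub>" using y by blast
    show "\<one>\<^bsub>G\<^esub> \<otimes>\<^bsub>G\<^esub> x = x"
      using x one hc[OF x] by (intro inj closed) (auto simp: hom)
  next
    fix x y z assume "x \<in> carrier G" "y \<in> carrier G" "z \<in> carrier G"
    then show "x \<otimes>\<^bsub>G\<^esub> y \<otimes>\<^bsub>G\<^esub> z = x \<otimes>\<^bsub>G\<^esub> (y \<otimes>\<^bsub>G\<^esub> z)"
      using hc by (intro inj) (auto simp: hom closed H.m_assoc)
  qed (use closed one in auto)
qed

context lazard_lie_ring
begin

abbreviation (input) "AP \<equiv> plus_obj (Aut L F) (Aut_filt L F)"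
abbreviation (input) "PF \<equiv> plus_filt (Aut_filt L F)"

definition lie_hom :: "('a \<Rightarrow> 'a) \<Rightarrow> bool" where
  "lie_hom f \<longleftrightarrow> (\<forall>x\<in>carrier L. \<forall>y\<in>carrier L. f (x \<otimes> y) = f x \<otimes> f y)"

text \<open>
  Invertibility in the endomorphism ring encodes both bijectivity and the condition that each term of the
  filtration is mapped onto itself. Filtered automorphisms can thus be handled by ring calculations.
\<close>

lemma Aut_iff:
  "f \<in> carrier (Aut L F) \<longleftrightarrow> f \<in> carrier EE \<and> lie_hom f \<and>
     (\<exists>g\<in>carrier EE. f \<star> g = \<one>\<^sub>E \<and> g \<star> f = \<one>\<^sub>E)"
proof (intro iffI conjI)
  assume f: "f \<in> carrier (Aut L F)"
  then have bij: "bij_betw f (carrier L) (carrier L)" and ext: "f \<in> extensional (carrier L)"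
    and hom: "f \<in> hom (add_monoid L) (add_monoid L)" and filt: "f ` F i = F i" for i
    by (auto simp: Aut_def Bij_def)
  show fc: "f \<in> carrier EE" using ext hom filt by (simp add: End_ring_def)
  show "lie_hom f" using f by (simp add: Aut_def lie_hom_def)
  define g where "g = restrict (inv_into (carrier L) f) (carrier L)"
  have inj: "inj_on f (carrier L)" and surj: "f ` carrier L = carrier L"
    using bij by (auto simp: bij_betw_def)
  have gf: "g (f x) = x" if "x \<in> carrier L" for x
    using that inj surj by (auto simp: g_def)
  have fg: "f (g x) = x" and gcl: "g x \<in> carrier L" if "x \<in> carrier L" for x
    using that surj f_inv_into_f[of x f "carrier L"] inv_into_into[of x f "carrier L"] by (auto simp: g_def)
  have "g ` F i \<subseteq> F i" for i
  proof
    fix y assume "y \<in> g ` F i"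
    then obtain x where x: "x \<in> F i" "y = g x" by blast
    then obtain z where "z \<in> F i" "x = f z" using filt[of i] by (metis imageE)
    then show "y \<in> F i" using x gf F_carrier by auto
  qed
  moreover have "g (x \<oplus> y) = g x \<oplus> g y" if xy: "x \<in> carrier L" "y \<in> carrier L" for x y
  proof -
    have "x \<oplus> y = f (g x \<oplus> g y)" using xy by (simp add: End_add[OF fc] gcl fg)
    then show ?thesis using gf xy gcl by simp
  qed
  ultimately have gc: "g \<in> carrier EE"
    using gcl by (simp add: End_ring_def hom_def g_def)
  have one: "\<one>\<^sub>E \<in> carrier EE" using End_ring ring.ring_simprules(6) by blast
  show "\<exists>g\<in>carrier EE. f \<star> g = \<one>\<^sub>E \<and> g \<star> f = \<one>\<^sub>E"
    using gc fc one End_ring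
    by (intro bexI[of _ g] conjI End_ext ring.ring_simprules(5)) (auto simp: fg gf)
next
  assume a: "f \<in> carrier EE \<and> lie_hom f \<and>
     (\<exists>g\<in>carrier EE. f \<star> g = \<one>\<^sub>E \<and> g \<star> f = \<one>\<^sub>E)"
  then obtain g where g: "g \<in> carrier EE" "f \<star> g = \<one>\<^sub>E" "g \<star> f = \<one>\<^sub>E" by blast
  have fc: "f \<in> carrier EE" using a by blast
  have fg: "f (g x) = x" and gf: "g (f x) = x" if "x \<in> carrier L" for x
    using that fun_cong[OF g(2), of x] fun_cong[OF g(3), of x] by simp_all
  have filt: "f ` F i = F i" for i
  proof
    show "f ` F i \<subseteq> F i" using fc by (simp add: End_ring_def)
    show "F i \<subseteq> f ` F i"
    proof
      fix x assume x: "x \<in> F i"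
      then have "g x \<in> F i" using g(1) by (auto simp: End_ring_def)
      moreover have "x = f (g x)" using fg F_carrier[OF x] by simp
      ultimately show "x \<in> f ` F i" by blast
    qed
  qed
  have "bij_betw f (carrier L) (carrier L)"
    by (rule bij_betw_byWitness[where f' = g]) (use fg gf fc g(1) End_closed in auto)
  then show "f \<in> carrier (Aut L F)"
    using a filt by (simp add: Aut_def Bij_def End_ring_def lie_hom_def)
qed

lemma Aut_filt_iff:
  "f \<in> Aut_filt L F i \<longleftrightarrow> f \<in> carrier (Aut L F) \<and> f \<boxminus> \<one>\<^sub>E \<in> EF i"
  by (simp add: Aut_filt_def)

lemma exp_Der:
  assumes i: "1 \<le> i" and d: "d \<in> Der_filt L F i"
  shows "exp_End L F d \<in> Aut_filt L F i"
proof -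
  interpret E: lazard_module EE EF by (rule End_module)
  have de: "d \<in> EF i" and der: "\<And>x y. x \<in> carrier L \<Longrightarrow> y \<in> carrier L \<Longrightarrow> d (x \<otimes> y) = d x \<otimes> y \<oplus> x \<otimes> d y"
    using d by (auto simp: Der_filt_iff)
  have dc: "d \<in> carrier EE" using de by (rule End_filt_carrier)
  have m: "\<ominus>\<^bsub>EE\<^esub> d \<in> EF i" using de by (rule E.F_minus)
  have mm: "\<ominus>\<^bsub>EE\<^esub> (\<ominus>\<^bsub>EE\<^esub> d) = d" using dc by simp
  have "lie_hom (exp_End L F d)"
    using exp_derivation_bracket[OF de i der] by (simp add: lie_hom_def)
  then show ?thesis
    using exp_End_filt[OF de i] exp_End_filt(1)[OF m i] exp_End_minus[OF de i] exp_End_minus[OF m i]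
    by (auto simp: Aut_filt_iff Aut_iff mm)
qed

lemma log_Aut:
  assumes i: "1 \<le> i" and f: "f \<in> Aut_filt L F i"
  defines "d \<equiv> log_End (f \<boxminus> \<one>\<^sub>E)"
  shows "d \<in> Der_filt L F i" "exp_End L F d = f"
proof -
  interpret R: ring EE by (rule End_ring)
  let ?u = "f \<boxminus> \<one>\<^sub>E"
  have u: "?u \<in> EF i" and fc: "f \<in> carrier EE" and lh: "lie_hom f"
    using f by (auto simp: Aut_filt_iff Aut_iff)
  have fu: "f = \<one>\<^sub>E \<boxplus> ?u"
    using fc by (simp add: a_minus_def R.a_lcomm[of "\<one>\<^sub>E" f] R.r_neg)
  have val: "x \<oplus> ?u x = f x" if "x \<in> carrier L" for x
    using fun_cong[OF fu, of x] that by simp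
  have "d (x \<otimes> y) = d x \<otimes> y \<oplus> x \<otimes> d y" if "x \<in> carrier L" "y \<in> carrier L" for x y
    unfolding d_def
  proof (rule log_derivation[OF u i _ that])
    fix x y assume "x \<in> carrier L" "y \<in> carrier L"
    then show "x \<otimes> y \<oplus> ?u (x \<otimes> y) = (x \<oplus> ?u x) \<otimes> (y \<oplus> ?u y)"
      using lh by (simp add: val bracket_closed lie_hom_def)
  qed
  then show "d \<in> Der_filt L F i"
    using log_End_filt[OF u i] by (simp add: Der_filt_iff d_def)
  show "exp_End L F d = f"
    unfolding d_def using exp_log_End[OF u i] fu by simp
qed

lemma Aut_eq_exp_Der: "1 \<le> i \<Longrightarrow> Aut_filt L F i = exp_End L F ` Der_filt L F i"
  using exp_Der log_Aut by (metis (no_types, lifting) equalityI image_eqI image_subsetI subsetI)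

lemma exp_inj: "inj_on (exp_End L F) (Der_filt L F 1)"
  by (rule inj_on_inverseI[where g = "\<lambda>f. log_End (f \<boxminus> \<one>\<^sub>E)"])
     (auto simp: Der_filt_iff intro: log_exp_End)

subsection \<open>The group structure\<close>

lemma AP_simps:
  "carrier AP = Aut_filt L F 1"
  "\<one>\<^bsub>AP\<^esub> = \<one>\<^sub>E"
  by (simp_all add: plus_obj_def Aut_def BijGroup_def End_ring_def)

lemma AP_mult: "f \<in> carrier (Aut L F) \<Longrightarrow> g \<in> carrier (Aut L F) \<Longrightarrow> f \<otimes>\<^bsub>AP\<^esub> g = f \<star> g"
  by (simp add: plus_obj_def Aut_def BijGroup_def End_ring_def)

lemma Aut_filt_antimono: "i \<le> j \<Longrightarrow> Aut_filt L F j \<subseteq> Aut_filt L F i"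
  using End_filt_antimono[of i j] by (auto simp: Aut_filt_iff)

text \<open>
  As \<open>plus_filt\<close> repeats the first term at index \<open>0\<close>.
\<close>

lemma PF_eq: "PF i = Aut_filt L F (max 1 i)"
  by (auto simp: plus_filt_def max_def)

lemma Aut_EE: "f \<in> Aut_filt L F i \<Longrightarrow> f \<in> carrier EE"
  by (simp add: Aut_filt_iff Aut_iff)

lemma Aut_Aut: "f \<in> Aut_filt L F i \<Longrightarrow> f \<in> carrier (Aut L F)"
  by (simp add: Aut_filt_iff)

lemma Aut_filt_one: "\<one>\<^sub>E \<in> Aut_filt L F i"
proof -
  interpret R: ring EE by (rule End_ring)
  interpret E: lazard_module EE EF by (rule End_module)
  show ?thesis
    using E.F_zero by (auto simp: Aut_filt_iff Aut_iff lie_hom_def bracket_closed a_minus_def R.r_neg)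
qed

lemma Aut_filt_mult:
  assumes f: "f \<in> Aut_filt L F i" and g: "g \<in> Aut_filt L F i"
  shows "f \<star> g \<in> Aut_filt L F i"
proof -
  interpret R: ring EE by (rule End_ring)
  interpret E: lazard_module EE EF by (rule End_module)
  note c = Aut_EE[OF f] Aut_EE[OF g]
  obtain f' g' where i: "f' \<in> carrier EE" "f \<star> f' = \<one>\<^sub>E" "f' \<star> f = \<one>\<^sub>E"
    "g' \<in> carrier EE" "g \<star> g' = \<one>\<^sub>E" "g' \<star> g = \<one>\<^sub>E"
    using f g by (auto simp: Aut_filt_iff Aut_iff)
  have cancel: "a \<star> b \<star> (b' \<star> a') = \<one>\<^sub>E"
    if "a \<in> carrier EE" "b \<in> carrier EE" "a' \<in> carrier EE" "b' \<in> carrier EE"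
      "a \<star> a' = \<one>\<^sub>E" "b \<star> b' = \<one>\<^sub>E" for a b a' b'
  proof -
    have "a \<star> b \<star> (b' \<star> a') = a \<star> (b \<star> b') \<star> a'"
      using that(1-4) by (simp add: R.m_assoc)
    then show ?thesis using that by simp
  qed
  have "f \<star> g \<star> (g' \<star> f') = \<one>\<^sub>E" "g' \<star> f' \<star> (f \<star> g) = \<one>\<^sub>E"
    using cancel[of f g f' g'] cancel[of g' f' g f] c i by auto
  moreover have "lie_hom (f \<star> g)"
    using f g c by (auto simp: Aut_filt_iff Aut_iff lie_hom_def bracket_closed End_closed)
  ultimately have A: "f \<star> g \<in> carrier (Aut L F)"
    using c i unfolding Aut_iff by blast
  have "f \<star> g \<boxminus> \<one>\<^sub>E = (f \<boxminus> \<one>\<^sub>E) \<star> g \<boxplus> (g \<boxminus> \<one>\<^sub>E)"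
    using c by (simp add: a_minus_def R.l_distr R.l_minus R.a_assoc R.r_neg1)
  moreover have "(f \<boxminus> \<one>\<^sub>E) \<star> g \<in> EF i"
    using End_mult_filt[of "f \<boxminus> \<one>\<^sub>E" i g 0] f c by (simp add: Aut_filt_iff End_filt_0)
  ultimately show ?thesis using A g E.F_add by (simp add: Aut_filt_iff)
qed

lemma Aut_filt_inverse:
  assumes f: "f \<in> Aut_filt L F i"
  obtains g where "g \<in> Aut_filt L F i" "f \<star> g = \<one>\<^sub>E" "g \<star> f = \<one>\<^sub>E"
proof -
  interpret R: ring EE by (rule End_ring)
  interpret E: lazard_module EE EF by (rule End_module)
  note fc = Aut_EE[OF f]
  obtain g where g: "g \<in> carrier EE" "f \<star> g = \<one>\<^sub>E" "g \<star> f = \<one>\<^sub>E"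
    using f by (auto simp: Aut_filt_iff Aut_iff)
  have fg: "f (g x) = x" "g (f x) = x" if "x \<in> carrier L" for x
    using that fun_cong[OF g(2), of x] fun_cong[OF g(3), of x] by simp_all
  have "lie_hom g"
    unfolding lie_hom_def
  proof (intro ballI)
    fix x y assume xy: "x \<in> carrier L" "y \<in> carrier L"
    have "f (g x \<otimes> g y) = x \<otimes> y"
      using f xy g(1) by (simp add: Aut_filt_iff Aut_iff lie_hom_def End_closed fg)
    then show "g (x \<otimes> y) = g x \<otimes> g y"
      using fg(2)[of "g x \<otimes> g y"] xy g(1) by (simp add: End_closed bracket_closed)
  qed
  then have A: "g \<in> carrier (Aut L F)" using g fc by (auto simp: Aut_iff)
  have "g \<boxminus> \<one>\<^sub>E = \<ominus>\<^bsub>EE\<^esub> ((f \<boxminus> \<one>\<^sub>E) \<star> g)"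
    using fc g by (simp add: a_minus_def R.l_distr R.l_minus R.minus_add R.a_comm)
  moreover have "(f \<boxminus> \<one>\<^sub>E) \<star> g \<in> EF i"
    using End_mult_filt[of "f \<boxminus> \<one>\<^sub>E" i g 0] f g by (simp add: Aut_filt_iff End_filt_0)
  ultimately have "g \<in> Aut_filt L F i" using A E.F_minus by (simp add: Aut_filt_iff)
  then show ?thesis using g that by blast
qed

lemma AP_group: "group AP"
proof (rule groupI)
  interpret R: ring EE by (rule End_ring)
  have mult: "f \<otimes>\<^bsub>AP\<^esub> g = f \<star> g" if "f \<in> carrier AP" "g \<in> carrier AP" for f g
    using that AP_mult Aut_Aut by (simp add: AP_simps)
  have cl: "f \<otimes>\<^bsub>AP\<^esub> g \<in> carrier AP" if "f \<in> carrier AP" "g \<in> carrier AP" for f g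
    using that by (simp add: mult) (simp add: AP_simps Aut_filt_mult)
  have c: "f \<in> carrier EE" if "f \<in> carrier AP" for f using that Aut_EE by (simp add: AP_simps)
  show one: "\<one>\<^bsub>AP\<^esub> \<in> carrier AP" by (simp add: AP_simps Aut_filt_one)
  fix f g h assume f: "f \<in> carrier AP"
  show "\<one>\<^bsub>AP\<^esub> \<otimes>\<^bsub>AP\<^esub> f = f" using f one c by (simp add: mult) (simp add: AP_simps)
  obtain g where g: "g \<in> Aut_filt L F 1" "g \<star> f = \<one>\<^sub>E"
    using f Aut_filt_inverse[of f 1] by (auto simp: AP_simps)
  have "g \<in> carrier AP" using g by (simp add: AP_simps)
  moreover have "g \<otimes>\<^bsub>AP\<^esub> f = \<one>\<^bsub>AP\<^esub>" using mult[OF calculation f] g by (simp add: AP_simps)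
  ultimately show "\<exists>g\<in>carrier AP. g \<otimes>\<^bsub>AP\<^esub> f = \<one>\<^bsub>AP\<^esub>" by blast
  {
    fix g assume g: "g \<in> carrier AP"
    show "f \<otimes>\<^bsub>AP\<^esub> g \<in> carrier AP" using cl f g .
    fix h assume h: "h \<in> carrier AP"
    show "f \<otimes>\<^bsub>AP\<^esub> g \<otimes>\<^bsub>AP\<^esub> h = f \<otimes>\<^bsub>AP\<^esub> (g \<otimes>\<^bsub>AP\<^esub> h)"
      using f g h c cl by (metis mult R.m_assoc)
  }
qed

lemma AP_props:
  assumes "f \<in> Aut_filt L F 1" "g \<in> Aut_filt L F 1"
  shows AP_mult': "f \<otimes>\<^bsub>AP\<^esub> g = f \<star> g"
    and AP_inv: "inv\<^bsub>AP\<^esub> f \<in> Aut_filt L F 1" "f \<star> inv\<^bsub>AP\<^esub> f = \<one>\<^sub>E" "inv\<^bsub>AP\<^esub> f \<star> f = \<one>\<^sub>E"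
proof -
  interpret A: group AP by (rule AP_group)
  show *: "f \<otimes>\<^bsub>AP\<^esub> g = f \<star> g" using assms AP_mult Aut_Aut by simp
  show i: "inv\<^bsub>AP\<^esub> f \<in> Aut_filt L F 1" using A.inv_closed[of f] assms by (simp add: AP_simps)
  show "f \<star> inv\<^bsub>AP\<^esub> f = \<one>\<^sub>E" "inv\<^bsub>AP\<^esub> f \<star> f = \<one>\<^sub>E"
    using A.r_inv[of f] A.l_inv[of f] assms(1) AP_mult[OF Aut_Aut[OF assms(1)] Aut_Aut[OF i]]
      AP_mult[OF Aut_Aut[OF i] Aut_Aut[OF assms(1)]] by (simp_all add: AP_simps)
qed

end

context lazard_lie_ring
begin

lemma AP_subgroup: "subgroup (PF i) AP"
proof -
  interpret A: group AP by (rule AP_group)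
  have sub: "PF i \<subseteq> Aut_filt L F 1"
    unfolding PF_eq by (rule Aut_filt_antimono) simp
  show ?thesis
  proof (rule A.subgroupI)
    show "PF i \<subseteq> carrier AP" using sub by (simp add: AP_simps)
    show "PF i \<noteq> {}" using Aut_filt_one by (auto simp: PF_eq)
    fix f assume f: "f \<in> PF i"
    have f1: "f \<in> Aut_filt L F 1" using f sub by blast
    obtain g where g: "g \<in> Aut_filt L F (max 1 i)" "f \<star> g = \<one>\<^sub>E" "g \<star> f = \<one>\<^sub>E"
      using Aut_filt_inverse f by (metis PF_eq)
    have g1: "g \<in> Aut_filt L F 1" using g(1) sub by (auto simp: PF_eq)
    have "inv\<^bsub>AP\<^esub> f = g"
      using f1 g1 g(3) by (intro A.inv_equality) (simp_all add: AP_mult' AP_simps)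
    then show "inv\<^bsub>AP\<^esub> f \<in> PF i" using g(1) by (simp add: PF_eq)
  next
    fix f g assume fg: "f \<in> PF i" "g \<in> PF i"
    then have "f \<otimes>\<^bsub>AP\<^esub> g = f \<star> g" using sub by (intro AP_mult') auto
    then show "f \<otimes>\<^bsub>AP\<^esub> g \<in> PF i" using fg by (simp add: PF_eq Aut_filt_mult)
  qed
qed

lemma PF_mem: "f \<in> Aut_filt L F 1 \<Longrightarrow> f \<boxminus> \<one>\<^sub>E \<in> EF i \<Longrightarrow> f \<in> PF i"
  by (auto simp: PF_eq Aut_filt_iff max_def)

lemma PF_1: "f \<in> PF i \<Longrightarrow> f \<in> Aut_filt L F 1"
  using Aut_filt_antimono[of 1 "max 1 i"] by (auto simp: PF_eq)

lemma PF_diff: "f \<in> PF i \<Longrightarrow> f \<boxminus> \<one>\<^sub>E \<in> EF (max 1 i)"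
  by (simp add: PF_eq Aut_filt_iff)

text \<open>
  Put \<open>u = f - 1\<close> and \<open>v = g - 1\<close>. A group commutator minus \<open>1\<close> is \<open>(f g - g f) f\<^sup>-\<^sup>1 g\<^sup>-\<^sup>1\<close>, and
  \<open>f g - g f = u v - v u\<close> has the sum of the degrees of \<open>u\<close> and \<open>v\<close>.
\<close>

lemma AP_filtered: "filtered_group AP PF"
proof (intro filtered_group.intro filtered_group_axioms.intro AP_group)
  interpret A: group AP by (rule AP_group)
  interpret R: ring EE by (rule End_ring)
  interpret E: lazard_module EE EF by (rule End_module)
  have cl: "f \<otimes>\<^bsub>AP\<^esub> g \<in> Aut_filt L F 1" if "f \<in> Aut_filt L F 1" "g \<in> Aut_filt L F 1" for f g
    using A.m_closed that by (simp add: AP_simps)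
  show "PF 0 = carrier AP" by (simp add: AP_simps plus_filt_def)
  show "PF (Suc i) \<subseteq> PF i" for i
    unfolding PF_eq by (rule Aut_filt_antimono) simp
  show "PF i \<lhd> AP" for i
    unfolding A.normal_inv_iff
  proof (intro conjI ballI AP_subgroup)
    fix f h assume f: "f \<in> carrier AP" and h: "h \<in> PF i"
    have f1: "f \<in> Aut_filt L F 1" using f by (simp add: AP_simps)
    have h1: "h \<in> Aut_filt L F 1" using h by (rule PF_1)
    note fi = AP_inv[OF f1 f1]
    note c = Aut_EE[OF f1] Aut_EE[OF h1] Aut_EE[OF fi(1)]
    let ?g = "inv\<^bsub>AP\<^esub> f"
    have eq: "f \<otimes>\<^bsub>AP\<^esub> h \<otimes>\<^bsub>AP\<^esub> ?g = f \<star> h \<star> ?g"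
      using f1 h1 fi(1) cl by (simp add: AP_mult')
    have "f \<star> h \<star> ?g \<boxminus> \<one>\<^sub>E = f \<star> (h \<boxminus> \<one>\<^sub>E) \<star> ?g"
      using c fi(2) by (simp add: a_minus_def R.l_distr R.r_distr R.l_minus R.r_minus)
    also have "\<dots> \<in> EF (0 + max 1 i + 0)"
      using c PF_diff[OF h] by (intro End_mult_filt) (auto simp: End_filt_0)
    finally have "f \<otimes>\<^bsub>AP\<^esub> h \<otimes>\<^bsub>AP\<^esub> ?g \<boxminus> \<one>\<^sub>E \<in> EF (max 1 i)" by (simp add: eq)
    moreover have "f \<otimes>\<^bsub>AP\<^esub> h \<otimes>\<^bsub>AP\<^esub> ?g \<in> Aut_filt L F 1" using f1 h1 fi(1) cl by simp
    ultimately show "f \<otimes>\<^bsub>AP\<^esub> h \<otimes>\<^bsub>AP\<^esub> ?g \<in> PF i"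
      using End_filt_antimono[of i "max 1 i"] by (intro PF_mem) auto
  qed
  fix f g i j assume f: "f \<in> PF i" and g: "g \<in> PF j"
  have f1: "f \<in> Aut_filt L F 1" and g1: "g \<in> Aut_filt L F 1" using f g PF_1 by auto
  note fi = AP_inv[OF f1 f1] and gi = AP_inv[OF g1 g1]
  note c = Aut_EE[OF f1] Aut_EE[OF g1] Aut_EE[OF fi(1)] Aut_EE[OF gi(1)]
  let ?f = "inv\<^bsub>AP\<^esub> f" and ?g = "inv\<^bsub>AP\<^esub> g"
  let ?u = "f \<boxminus> \<one>\<^sub>E" and ?v = "g \<boxminus> \<one>\<^sub>E"
  have eq: "f \<otimes>\<^bsub>AP\<^esub> g \<otimes>\<^bsub>AP\<^esub> ?f \<otimes>\<^bsub>AP\<^esub> ?g = f \<star> g \<star> ?f \<star> ?g"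
    using f1 g1 fi(1) gi(1) cl by (simp add: AP_mult')
  have eq2: "f \<star> g \<star> ?f \<star> ?g \<boxminus> \<one>\<^sub>E = (f \<star> g \<boxminus> g \<star> f) \<star> ?f \<star> ?g"
  proof -
    have "g \<star> f \<star> ?f \<star> ?g = g \<star> (f \<star> ?f) \<star> ?g"
      using c by (simp add: R.m_assoc)
    then have "g \<star> f \<star> ?f \<star> ?g = \<one>\<^sub>E" using c fi(2) gi(2) by simp
    then show ?thesis using c by (simp add: a_minus_def R.l_distr R.l_minus)
  qed
  have eq3: "f \<star> g \<boxminus> g \<star> f = ?u \<star> ?v \<boxminus> ?v \<star> ?u"
  proof -
    have uv: "?u \<in> carrier EE" "?v \<in> carrier EE" using c by auto
    have e: "f = \<one>\<^sub>E \<boxplus> ?u" "g = \<one>\<^sub>E \<boxplus> ?v"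
      using c by (simp_all add: a_minus_def R.a_lcomm[of "\<one>\<^sub>E"] R.r_neg)
    have "(\<one>\<^sub>E \<boxplus> u) \<star> (\<one>\<^sub>E \<boxplus> v) \<boxminus> (\<one>\<^sub>E \<boxplus> v) \<star> (\<one>\<^sub>E \<boxplus> u) =
        u \<star> v \<boxminus> v \<star> u" if "u \<in> carrier EE" "v \<in> carrier EE" for u v
    proof -
      let ?s = "\<one>\<^sub>E \<boxplus> u \<boxplus> v"
      have "(\<one>\<^sub>E \<boxplus> u) \<star> (\<one>\<^sub>E \<boxplus> v) = u \<star> v \<boxplus> ?s"
        "(\<one>\<^sub>E \<boxplus> v) \<star> (\<one>\<^sub>E \<boxplus> u) = v \<star> u \<boxplus> ?s"
        using that by (simp_all add: R.l_distr R.r_distr R.a_ac)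
      moreover have "(a \<boxplus> s) \<boxminus> (b \<boxplus> s) = a \<boxminus> b"
        if "a \<in> carrier EE" "b \<in> carrier EE" "s \<in> carrier EE" for a b s
      proof -
        have "s \<boxplus> (\<ominus>\<^bsub>EE\<^esub> s \<boxplus> \<ominus>\<^bsub>EE\<^esub> b) = \<ominus>\<^bsub>EE\<^esub> b" using that by (simp add: R.r_neg2)
        then show ?thesis using that by (simp add: a_minus_def R.minus_add R.a_assoc R.a_comm[of "\<ominus>\<^bsub>EE\<^esub> b"])
      qed
      ultimately show ?thesis using that by simp
    qed
    from this[OF uv] show ?thesis unfolding e(1)[symmetric] e(2)[symmetric] .
  qed
  have "?u \<star> ?v \<in> EF (max 1 i + max 1 j)"
    by (rule End_mult_filt[OF PF_diff[OF f] PF_diff[OF g]])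
  moreover have "?v \<star> ?u \<in> EF (max 1 i + max 1 j)"
    using End_mult_filt[OF PF_diff[OF g] PF_diff[OF f]] by (simp add: add.commute)
  ultimately have "?u \<star> ?v \<boxminus> ?v \<star> ?u \<in> EF (max 1 i + max 1 j)"
    by (rule E.F_diff)
  from End_mult_filt[OF End_mult_filt[OF this, of ?f 0], of ?g 0]
  have "(?u \<star> ?v \<boxminus> ?v \<star> ?u) \<star> ?f \<star> ?g \<in> EF (max 1 i + max 1 j + 0 + 0)"
    using c by (simp add: End_filt_0)
  then have "f \<otimes>\<^bsub>AP\<^esub> g \<otimes>\<^bsub>AP\<^esub> ?f \<otimes>\<^bsub>AP\<^esub> ?g \<boxminus> \<one>\<^sub>E \<in> EF (max 1 i + max 1 j)"
    unfolding eq eq2 eq3 by simp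
  moreover have "EF (max 1 i + max 1 j) \<subseteq> EF (i + j)" by (intro End_filt_antimono) simp
  ultimately show "f \<otimes>\<^bsub>AP\<^esub> g \<otimes>\<^bsub>AP\<^esub> ?f \<otimes>\<^bsub>AP\<^esub> ?g \<in> PF (i + j)"
    using f1 g1 fi(1) gi(1) cl by (intro PF_mem) auto
qed

lemma lie_hom_closed:
  assumes f: "f \<in> carrier EE" and lim: "\<And>N. \<exists>g\<in>carrier EE. lie_hom g \<and> g \<boxminus> f \<in> EF N"
  shows "lie_hom f"
  unfolding lie_hom_def
proof (intro ballI)
  fix x y assume xy: "x \<in> carrier L" "y \<in> carrier L"
  show "f (x \<otimes> y) = f x \<otimes> f y"
  proof (rule F_eq_if_close)
    fix N
    obtain g where g: "g \<in> carrier EE" "lie_hom g" "g \<boxminus> f \<in> EF N" using lim by blast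
    note c = End_close[OF f g(1,3)]
    have "f (x \<otimes> y) \<ominus> g (x \<otimes> y) \<in> F N" using xy by (intro c) (simp add: bracket_closed)
    moreover have "f x \<otimes> f y \<ominus> g x \<otimes> g y \<in> F N"
      using xy f g(1) by (intro bracket_close c) (auto simp: End_closed)
    ultimately show "\<exists>c\<in>carrier L. f (x \<otimes> y) \<ominus> c \<in> F N \<and> f x \<otimes> f y \<ominus> c \<in> F N"
      using xy g by (intro bexI[of _ "g (x \<otimes> y)"]) (auto simp: lie_hom_def End_closed bracket_closed)
  qed (use xy f in \<open>auto simp: End_closed bracket_closed\<close>)
qed

lemma exp_pow:
  assumes d: "d \<in> Der_filt L F 1"
  shows "exp_End L F d [^]\<^bsub>AP\<^esub> (n::nat) = exp_End L F (add_pow EE (int n) d)"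
    and "add_pow EE (int n) d \<in> Der_filt L F 1"
proof -
  interpret A: group AP by (rule AP_group)
  interpret R: ring EE by (rule End_ring)
  interpret E: lazard_module EE EF by (rule End_module)
  interpret D: lazard_module DD DF by (rule DD_module)
  have dE: "d \<in> EF 1" using d by (simp add: Der_filt_iff)
  have dc: "d \<in> carrier EE" using dE by (rule End_filt_carrier)
  have dD: "d \<in> carrier DD" using d by (simp add: DD_simps)
  show mem: "add_pow EE (int n) d \<in> Der_filt L F 1" for n
    using D.add.int_pow_closed[OF dD, of "int n"] DD_pow[OF dD, of "int n"] by (simp add: DD_simps)
  show "exp_End L F d [^]\<^bsub>AP\<^esub> n = exp_End L F (add_pow EE (int n) d)"
  proof (induction n)
    case 0
    have z: "add_pow EE (int 0) d = \<zero>\<^sub>E" by (simp add: add_pow_def)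
    have "exp_End L F \<zero>\<^sub>E = \<one>\<^sub>E"
    proof -
      interpret P: lazard_module_pair L F "\<zero>\<^sub>E" "\<zero>\<^sub>E" 1
        by (rule pairI) (use E.F_zero in auto)
      have "exp_End L F (P.V 0) = P.V (nexp 0)" by (rule P.exp_End_V) auto
      moreover have "nexp 0 = 1"
      proof (rule ncs_eqI)
        fix w :: "bool list"
        have "cf (nexp 0) w = (\<Sum>m\<in>{0}. fps_nth (fps_exp 1) m * cf (0 ^ m) w)"
          unfolding nexp_def cf_subst by (intro sum.mono_neutral_right) (auto simp: power_0_left)
        then show "cf (nexp 0) w = cf 1 w" by simp
      qed
      ultimately show ?thesis by (simp add: P.V_zero P.V_one)
    qed
    then show ?case unfolding z by (simp add: AP_simps)
  next
    case (Suc n)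
    let ?e = "add_pow EE (int n) d"
    have eE: "?e \<in> EF 1" using mem by (simp add: Der_filt_iff)
    have g: "abelian_group L" ..
    interpret P: lazard_module_pair L F ?e d 1
      by (rule pairI) (use eE dE in auto)
    have comm: "?e \<star> d = d \<star> ?e"
      using dc add_pow_hom[OF g g End_hom[OF dc]]
      by (intro End_ext) (auto simp: End_val_pow End_closed)
    have "exp_End L F d [^]\<^bsub>AP\<^esub> Suc n = exp_End L F ?e \<otimes>\<^bsub>AP\<^esub> exp_End L F d"
      using Suc by simp
    also have "\<dots> = exp_End L F ?e \<star> exp_End L F d"
      using exp_Der[OF _ mem, of n] exp_Der[OF _ d] by (intro AP_mult') auto
    also have "\<dots> = exp_End L F (?e \<boxplus> d)" by (rule P.exp_add_commute[OF comm, symmetric])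
    also have "?e \<boxplus> d = add_pow EE (int (Suc n)) d"
      using dc R.add.int_pow_mult[of d "int n" 1] by (simp add: add.commute)
    finally show ?case .
  qed
qed

text \<open>
  A Cauchy sequence of automorphisms and the sequence of their inverses both converge among
  endomorphisms, and the limits are inverse to each other. Roots correspond to quotients of derivations
  under the exponential, whose restriction to the powers of one element is additive (\<open>exp_pow\<close>).
\<close>

lemma AP_lazard: "lazard_group AP PF"
proof (intro lazard_group.intro lazard_group_axioms.intro AP_filtered)
  interpret A: group AP by (rule AP_group)
  interpret R: ring EE by (rule End_ring)
  interpret E: lazard_module EE EF by (rule End_module)
  interpret D: lazard_module DD DF by (rule DD_module)
  interpret d: descending_subgroups AP PF
  proof (intro descending_subgroups.intro descending_subgroups_axioms.intro AP_group AP_subgroup)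
    show "PF (Suc i) \<subseteq> PF i" for i unfolding PF_eq by (rule Aut_filt_antimono) simp
  qed
  have haus: "Hausdorff_space (filt_topology AP PF)"
    unfolding d.Hausdorff_filt_topology
  proof (intro ballI impI)
    fix f assume f: "f \<in> carrier AP" "\<forall>k. f \<in> PF k"
    have fc: "f \<in> carrier EE" using f Aut_EE by (auto simp: AP_simps)
    have "f \<boxminus> \<one>\<^sub>E \<in> EF k" for k
      using PF_diff[of f k] f E.F_antimono[of k "max 1 k"] by auto
    then show "f = \<one>\<^bsub>AP\<^esub>" using fc by (simp add: AP_simps E.F_eqI)
  qed
  have compl: "filt_complete AP PF"
    unfolding d.filt_complete_iff
  proof (intro allI impI)
    fix s assume s: "(\<forall>n. s n \<in> carrier AP) \<and> (\<forall>n. inv\<^bsub>AP\<^esub> s n \<otimes>\<^bsub>AP\<^esub> s (Suc n) \<in> PF n)"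
    define t where "t n = inv\<^bsub>AP\<^esub> s n" for n
    have s1: "s n \<in> Aut_filt L F 1" for n using s by (simp add: AP_simps)
    have t1: "t n \<in> Aut_filt L F 1" and st: "s n \<star> t n = \<one>\<^sub>E" "t n \<star> s n = \<one>\<^sub>E" for n
      using AP_inv[OF s1 s1] by (auto simp: t_def)
    have sc: "s n \<in> carrier EE" and tc: "t n \<in> carrier EE" for n using s1 t1 Aut_EE by auto
    have ts: "t n \<star> s (Suc n) \<boxminus> \<one>\<^sub>E \<in> EF n" for n
    proof -
      have "inv\<^bsub>AP\<^esub> s n \<otimes>\<^bsub>AP\<^esub> s (Suc n) = t n \<star> s (Suc n)"
        using AP_mult'[OF t1 s1] by (simp add: t_def)
      then have "t n \<star> s (Suc n) \<in> PF n" using s by metis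
      from PF_diff[OF this] show ?thesis using E.F_antimono[of n "max 1 n"] by auto
    qed
    have sd: "s (Suc n) \<boxminus> s n \<in> EF n" for n
    proof -
      have "s n \<star> (t n \<star> s (Suc n)) = s (Suc n)"
        using sc tc st(1) by (simp add: R.m_assoc[symmetric])
      then have "s (Suc n) \<boxminus> s n = s n \<star> (t n \<star> s (Suc n) \<boxminus> \<one>\<^sub>E)"
        using sc tc by (simp add: a_minus_def R.r_distr R.r_minus)
      then show ?thesis using End_mult_filt[OF _ ts, of "s n" 0 n] sc by (simp add: End_filt_0)
    qed
    have td: "t (Suc n) \<boxminus> t n \<in> EF n" for n
    proof -
      have "t n \<star> s (Suc n) \<star> t (Suc n) = t n"
        using sc tc st(1) by (simp add: R.m_assoc)
      then have "t (Suc n) \<boxminus> t n = \<ominus>\<^bsub>EE\<^esub> ((t n \<star> s (Suc n) \<boxminus> \<one>\<^sub>E) \<star> t (Suc n))"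
        using sc tc by (simp add: a_minus_def R.l_distr R.l_minus R.minus_add R.a_comm)
      then show ?thesis using E.F_minus[OF End_mult_filt[OF ts, of "t (Suc n)" 0 n]] tc by (simp add: End_filt_0)
    qed
    from E.F_complete[OF sc sd] obtain l where l: "l \<in> carrier EE" "\<forall>n. s n \<boxminus> l \<in> EF n" by blast
    from E.F_complete[OF tc td] obtain m where m: "m \<in> carrier EE" "\<forall>n. t n \<boxminus> m \<in> EF n" by blast
    have prod: "a \<star> b = \<one>\<^sub>E"
      if a: "a \<in> carrier EE" "\<And>n. p n \<in> carrier EE" "\<forall>n. p n \<boxminus> a \<in> EF n"
        and b: "b \<in> carrier EE" "\<And>n. q n \<in> carrier EE" "\<forall>n. q n \<boxminus> b \<in> EF n"
        and pq: "\<And>n. p n \<star> q n = \<one>\<^sub>E" for a b p q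
    proof (rule E.F_eqI)
      fix k
      have "p k \<star> q k \<boxminus> a \<star> b =
          (p k \<boxminus> a) \<star> q k \<boxplus> a \<star> (q k \<boxminus> b)"
        using a(1,2) b(1,2) by (simp add: a_minus_def R.l_distr R.r_distr R.l_minus R.r_minus R.a_assoc R.r_neg1)
      moreover have "(p k \<boxminus> a) \<star> q k \<in> EF k" "a \<star> (q k \<boxminus> b) \<in> EF k"
        using End_mult_filt[of "p k \<boxminus> a" k "q k" 0] End_mult_filt[of a 0 "q k \<boxminus> b" k] a b
        by (simp_all add: End_filt_0)
      ultimately have "\<one>\<^sub>E \<boxminus> a \<star> b \<in> EF k" using pq E.F_add by simp
      then show "a \<star> b \<boxminus> \<one>\<^sub>E \<in> EF k" 
        using E.F_diff_sym[of "\<one>\<^sub>E" "a \<star> b" k] a b by simp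
    qed (use a b in auto)
    have lm: "l \<star> m = \<one>\<^sub>E" using prod[OF l(1) sc l(2) m(1) tc m(2) st(1)] .
    have ml: "m \<star> l = \<one>\<^sub>E" using prod[OF m(1) tc m(2) l(1) sc l(2) st(2)] .
    have "lie_hom l"
    proof (rule lie_hom_closed[OF l(1)])
      show "\<exists>g\<in>carrier EE. lie_hom g \<and> g \<boxminus> l \<in> EF N" for N
        using s1[of N] sc[of N] l(2) by (intro bexI[of _ "s N"]) (auto simp: Aut_filt_iff Aut_iff)
    qed
    then have lA: "l \<in> carrier (Aut L F)" using l(1) m(1) lm ml by (auto simp: Aut_iff)
    have "l \<boxminus> \<one>\<^sub>E \<in> EF 1"
      using E.F_diff_trans[of l "s 1" "\<one>\<^sub>E" 1] E.F_diff_sym[of "s 1" l 1] l sc[of 1] s1[of 1]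
      by (simp add: Aut_filt_iff)
    then have l1: "l \<in> Aut_filt L F 1" using lA by (simp add: Aut_filt_iff)
    have lc: "l \<in> carrier AP" using l1 by (simp add: AP_simps)
    have li: "inv\<^bsub>AP\<^esub> l = m"
    proof -
      have "inv\<^bsub>AP\<^esub> l \<in> carrier EE" "l \<star> inv\<^bsub>AP\<^esub> l = \<one>\<^sub>E"
        using AP_inv[OF l1 l1] Aut_EE by auto
      then show ?thesis using R.m_assoc[of m l "inv\<^bsub>AP\<^esub> l"] m(1) l(1) ml by simp
    qed
    have "inv\<^bsub>AP\<^esub> l \<otimes>\<^bsub>AP\<^esub> s n \<in> PF n" for n
    proof (rule PF_mem)
      have i1: "inv\<^bsub>AP\<^esub> l \<in> Aut_filt L F 1" by (rule AP_inv(1)[OF l1 l1])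
      show "inv\<^bsub>AP\<^esub> l \<otimes>\<^bsub>AP\<^esub> s n \<in> Aut_filt L F 1"
        using A.m_closed[of "inv\<^bsub>AP\<^esub> l" "s n"] i1 s1 by (simp add: AP_simps)
      have eq: "inv\<^bsub>AP\<^esub> l \<otimes>\<^bsub>AP\<^esub> s n = m \<star> s n" using AP_mult'[OF i1 s1] li by simp
      have "m \<star> s n \<boxminus> \<one>\<^sub>E = m \<star> (s n \<boxminus> l)"
        using m(1) l(1) sc[of n] ml by (simp add: a_minus_def R.r_distr R.r_minus)
      then show "inv\<^bsub>AP\<^esub> l \<otimes>\<^bsub>AP\<^esub> s n \<boxminus> \<one>\<^sub>E \<in> EF n"
        unfolding eq using End_mult_filt[of m 0 "s n \<boxminus> l" n] m(1) l(2) by (simp add: End_filt_0)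
    qed
    then show "\<exists>l\<in>carrier AP. \<forall>n. inv\<^bsub>AP\<^esub> l \<otimes>\<^bsub>AP\<^esub> s n \<in> PF n" using lc by blast
  qed
  have roots: "\<exists>!y. y \<in> PF i \<and> y [^]\<^bsub>AP\<^esub> n = x"
    if i: "1 \<le> i" and n: "1 \<le> n" "\<forall>p. Factorial_Ring.prime p \<and> p dvd n \<longrightarrow> p \<le> i" and x: "x \<in> PF i" for i x and n :: nat
  proof -
    have sm: "smooth i n" using n by (simp add: smooth_def)
    have P: "PF i = exp_End L F ` DF i"
      using Aut_eq_exp_Der[OF i] i by (simp add: plus_filt_def)
    have D1: "DF i \<subseteq> Der_filt L F 1" by (auto simp: DF_eq)
    obtain e where e: "e \<in> DF i" "x = exp_End L F e" using x P by blast
    obtain g where g: "g \<in> DF i" "add_pow DD (int n) g = e" using D.F_divide[OF sm e(1)] .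
    have pw: "exp_End L F h [^]\<^bsub>AP\<^esub> n = exp_End L F (add_pow DD (int n) h)" "add_pow DD (int n) h \<in> Der_filt L F 1"
      if "h \<in> DF i" for h
      using exp_pow[of h n] DD_pow[of h "int n"] that D1 by (auto simp: DD_simps)
    show ?thesis
    proof (rule ex1I)
      show "exp_End L F g \<in> PF i \<and> exp_End L F g [^]\<^bsub>AP\<^esub> n = x"
        using pw[OF g(1)] g e P by auto
      fix y assume y: "y \<in> PF i \<and> y [^]\<^bsub>AP\<^esub> n = x"
      then obtain h where h: "h \<in> DF i" "y = exp_End L F h" using P by blast
      have "exp_End L F (add_pow DD (int n) h) = exp_End L F e"
        using y h pw[OF h(1)] e by simp
      then have "add_pow DD (int n) h = e"
        using exp_inj pw(2)[OF h(1)] e(1) D1 by (auto dest: inj_onD)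
      then show "y = exp_End L F g"
        using D.F_torsion_free[OF sm h(1) g(1)] g h by simp
    qed
  qed
  show "lazard_filtration AP PF"
    unfolding lazard_filtration_def
  proof (intro conjI haus compl allI impI ballI)
    show "PF 0 = PF 1" by (simp add: plus_filt_def)
  qed (rule roots; assumption)
qed

lemma Laz_Der_iso:
  shows "group (Laz DD DF)" and "exp_End L F \<in> iso (Laz DD DF) AP"
proof -
  interpret D: lazard_module DD DF by (rule DD_module)
  have c: "carrier (Laz DD DF) = Der_filt L F 1" "\<one>\<^bsub>Laz DD DF\<^esub> = \<zero>\<^sub>E"
    "f \<otimes>\<^bsub>Laz DD DF\<^esub> g = BCH DD DF f g" for f g
    by (simp_all add: Laz_def DD_simps)
  have bij: "bij_betw (exp_End L F) (carrier (Laz DD DF)) (carrier AP)"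
    using Aut_eq_exp_Der[of 1] exp_inj by (simp add: bij_betw_def c AP_simps)
  have closed: "f \<otimes>\<^bsub>Laz DD DF\<^esub> g \<in> carrier (Laz DD DF)"
    if "f \<in> carrier (Laz DD DF)" "g \<in> carrier (Laz DD DF)" for f g
    using that BCH_exp(1) by (simp add: c)
  have hom: "exp_End L F (f \<otimes>\<^bsub>Laz DD DF\<^esub> g) = exp_End L F f \<otimes>\<^bsub>AP\<^esub> exp_End L F g"
    if "f \<in> carrier (Laz DD DF)" "g \<in> carrier (Laz DD DF)" for f g
    using that BCH_exp(2) AP_mult'[OF exp_Der exp_Der] by (simp add: c)
  have zero: "\<zero>\<^sub>E \<in> Der_filt L F 1" using D.F_zero[of 1] by (simp add: DF_eq DD_simps)
  have "add_pow EE (int 0) \<zero>\<^sub>E = \<zero>\<^sub>E" by (simp add: add_pow_def)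
  then have one: "exp_End L F \<one>\<^bsub>Laz DD DF\<^esub> = \<one>\<^bsub>AP\<^esub>"
    using exp_pow(1)[OF zero, of 0] by (simp add: c)
  show "group (Laz DD DF)"
  proof (rule group_transport[OF AP_group bij])
    show "\<one>\<^bsub>Laz DD DF\<^esub> \<in> carrier (Laz DD DF)" using zero by (simp add: c)
  qed (rule closed hom one; assumption?)+
  show "exp_End L F \<in> iso (Laz DD DF) AP"
    using bij hom by (auto simp: iso_def hom_def bij_betw_def)
qed

end

theorem lemma5p1:
  fixes L :: "('a, 'm) ring_scheme" and F :: "nat \<Rightarrow> 'a set"
  assumes "lazard_lie_ring L F"
  shows "(\<forall>i\<ge>1. Aut_filt L F i = exp_End L F ` Der_filt L F i) \<and>
    lazard_lie_ring (plus_obj (Der L F) (Der_filt L F)) (plus_filt (Der_filt L F)) \<and>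
    group (Laz (plus_obj (Der L F) (Der_filt L F)) (plus_filt (Der_filt L F))) \<and>
    exp_End L F \<in> iso (Laz (plus_obj (Der L F) (Der_filt L F)) (plus_filt (Der_filt L F)))
                       (plus_obj (Aut L F) (Aut_filt L F)) \<and>
    lazard_group (plus_obj (Aut L F) (Aut_filt L F)) (plus_filt (Aut_filt L F))"
proof -
  interpret lazard_lie_ring L F by fact
  show ?thesis
    using Aut_eq_exp_Der Der_lazard Laz_Der_iso AP_lazard by blast
qed

end
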